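(* Let $$m(x,y)=\begin{bmatrix}1\\ y\\ y^2\\ y^3\\ y^4\\ y^5\end{bmatrix}^T\begin{bmatrix}a_0&b_0&a_1&b_1&a_2&b_2\\ b_8&a_8&b_7&a_7&b_6&a_6\\ a_3&b_3&a_4&b_4&a_5&b_5\\ b_5&a_5&b_4&a_4&b_3&a_3\\ a_6&b_6&a_7&b_7&a_8&b_8\\ b_2&a_2&b_1&a_1&b_0&a_0\end{bmatrix}\begin{bmatrix}1\\ x\\ x^2\\ x^3\\ x^4\\ x^5\end{bmatrix}$$ with real $a_i,b_i$ satisfy: (i) $m(1,1)=1$; (ii) $|m(x,y)|^2+|m(-x,y)|^2+|m(x,-y)|^2+|m(-x,-y)|^2=1$ for all complex $x,y$ with $|x|=|y|=1$; (iii) $m(1/x,1/y)=x^{-5}y^{-5}m(x,y)$; (iv) $m(x,y)=(x+1)(y+1)\tilde m(x,y)$ for some polynomial $\tilde m$. Suppose that one of the following holds: - $a_1+a_4+a_7=\frac14$ and $a_3+a_4+a_5=0$; - $a_1+a_4+a_7=0$ and $a_3+a_4+a_5=\frac14$; - $a_1+a_4+a_7=0$ and $a_3+a_4+a_5=0$. Let $\phi\in L_2(\mathbb R^2)$ be the function with $$\hat\phi(\omega_1,\omega_2)=\prod_{k=1}^\infty m\big(e^{i\omega_1/2^k},e^{i\omega_2/2^k}\big).$$ Then $\{\phi(\cdot-\ell_1,\cdot-\ell_2):(\ell_1,\ell_2)\in\mathbb Z^2\}$ is not an orthonormal set. Nevertheless $\phi$ has an associated tight frame: with $m_1(x,y)=m(-x,y)$,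 $m_2(x,y)=x\,m(x,-y)$, $m_3(x,y)=x\,m(-x,-y)$ and $$\hat\psi_i(\omega_1,\omega_2)=m_i\big(e^{i\omega_1/2},e^{i\omega_2/2}\big)\,\hat\phi(\omega_1/2,\omega_2/2),\quad i=1,2,3,$$ the system $\{2^j\psi_i(2^j\cdot-k): i=1,2,3,\ j\in\mathbb Z,\ k\in\mathbb Z^2\}$ is a tight frame of $L_2(\mathbb R^2)$.
   Context: The Fourier transform convention is $\hat f(\omega)=\int_{\mathbb R^2}f(u)e^{iu\cdot\omega}\,du$, so that $\phi$ satisfies the refinement equation $\phi(u)=4\sum_{k\in\{0,\dots,5\}^2}h_k\phi(2u-k)$, where $m(x,y)=\sum h_{k_1,k_2}x^{k_1}y^{k_2}$. A tight frame of a Hilbert space $H$ is a family $(f_n)$ for which there is a constant $A>0$ with $\sum_n|\langle f,f_n\rangle|^2=A\|f\|^2$ for all $f\in H$. *)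

theory Defs
  imports "HOL-Analysis.Analysis" "HOL-Computational_Algebra.Polynomial"
begin

section \<open>The refinement mask\<close>

definition mask_matrix :: "(nat \<Rightarrow> real) \<Rightarrow> (nat \<Rightarrow> real) \<Rightarrow> real list list" where
  "mask_matrix a b =
    [[a 0, b 0, a 1, b 1, a 2, b 2],
     [b 8, a 8, b 7, a 7, b 6, a 6],
     [a 3, b 3, a 4, b 4, a 5, b 5],
     [b 5, a 5, b 4, a 4, b 3, a 3],
     [a 6, b 6, a 7, b 7, a 8, b 8],
     [b 2, a 2, b 1, a 1, b 0, a 0]]"

text \<open>Rows of the matrix belong to powers of \<open>y\<close>, columns to powers of \<open>x\<close>.\<close>

definition refinement_mask :: "(nat \<Rightarrow> real) \<Rightarrow> (nat \<Rightarrow> real) \<Rightarrow> complex \<Rightarrow> complex \<Rightarrow> complex" where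
  "refinement_mask a b x y =
    (\<Sum>r<6. \<Sum>c<6. y ^ r * complex_of_real (mask_matrix a b ! r ! c) * x ^ c)"

text \<open>A bivariate polynomial is a polynomial in \<open>y\<close> whose coefficients are polynomials in \<open>x\<close>.\<close>

definition bivariate_polynomial :: "(complex \<Rightarrow> complex \<Rightarrow> complex) \<Rightarrow> bool" where
  "bivariate_polynomial f \<longleftrightarrow> (\<exists>p :: complex poly poly. \<forall>x y. f x y = poly (poly p [:y:]) x)"

definition wavelet_mask ::
  "(nat \<Rightarrow> real) \<Rightarrow> (nat \<Rightarrow> real) \<Rightarrow> nat \<Rightarrow> complex \<Rightarrow> complex \<Rightarrow> complex" where
  "wavelet_mask a b i x y =
    (if i = 1 then refinement_mask a b (- x) y
     else if i = 2 then x * refinement_mask a b x (- y)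
     else x * refinement_mask a b (- x) (- y))"


section \<open>Square-integrable functions on the plane\<close>

text \<open>Elements of \<open>L2\<close> are represented by Borel functions; equality in \<open>L2\<close> is equality
  almost everywhere.\<close>

definition L2 :: "(real \<times> real \<Rightarrow> complex) set" where
  "L2 = {f. f \<in> borel_measurable lborel \<and> integrable lborel (\<lambda>u. (cmod (f u))\<^sup>2)}"

definition L2_inner :: "(real \<times> real \<Rightarrow> complex) \<Rightarrow> (real \<times> real \<Rightarrow> complex) \<Rightarrow> complex" where
  "L2_inner f g = (LINT u|lborel. f u * cnj (g u))"

definition orthonormal_set_L2 :: "(real \<times> real \<Rightarrow> complex) set \<Rightarrow> bool" where
  "orthonormal_set_L2 S \<longleftrightarrow> S \<subseteq> L2 \<and> (\<forall>f\<in>S. L2_inner f f = 1) \<and>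
    (\<forall>f\<in>S. \<forall>g\<in>S. \<not> (AE u in lborel. f u = g u) \<longrightarrow> L2_inner f g = 0)"

definition tight_frame_L2 :: "'n set \<Rightarrow> ('n \<Rightarrow> real \<times> real \<Rightarrow> complex) \<Rightarrow> bool" where
  "tight_frame_L2 I F \<longleftrightarrow> (\<forall>n\<in>I. F n \<in> L2) \<and>
    (\<exists>A>0. \<forall>f\<in>L2.
      ((\<lambda>n. (cmod (L2_inner f (F n)))\<^sup>2) has_sum A * (LINT u|lborel. (cmod (f u))\<^sup>2)) I)"


section \<open>The Fourier transform\<close>

definition fourier_integral :: "(real \<times> real \<Rightarrow> complex) \<Rightarrow> real \<times> real \<Rightarrow> complex" where
  "fourier_integral f \<omega> = (LINT u|lborel. f u * exp (\<i> * complex_of_real (u \<bullet> \<omega>)))"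

definition tendsto_L2 ::
  "(nat \<Rightarrow> real \<times> real \<Rightarrow> complex) \<Rightarrow> (real \<times> real \<Rightarrow> complex) \<Rightarrow> bool" where
  "tendsto_L2 F f \<longleftrightarrow>
    (\<lambda>n. \<integral>\<^sup>+ u. ennreal ((cmod (F n u - f u))\<^sup>2) \<partial>lborel) \<longlonglongrightarrow> 0"

text \<open>\<open>g\<close> is the Fourier transform of \<open>f\<close> in the sense of Plancherel: the transform on \<open>L2\<close> is
  the continuous extension of the Fourier integral on the integrable functions in \<open>L2\<close>, so its
  graph is the closure of the graph of the latter. It determines \<open>g\<close> from \<open>f\<close>, and \<open>f\<close>
  from \<open>g\<close>, up to null sets.\<close>

definition has_fourier_L2 ::
  "(real \<times> real \<Rightarrow> complex) \<Rightarrow> (real \<times> real \<Rightarrow> complex) \<Rightarrow> bool" where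
  "has_fourier_L2 f g \<longleftrightarrow> f \<in> L2 \<and> g \<in> L2 \<and>
    (\<exists>F. (\<forall>n. F n \<in> L2 \<and> integrable lborel (F n)) \<and>
      tendsto_L2 F f \<and> tendsto_L2 (\<lambda>n. fourier_integral (F n)) g)"


section \<open>The scaling function and the wavelet system\<close>

definition scaling_hat :: "(nat \<Rightarrow> real) \<Rightarrow> (nat \<Rightarrow> real) \<Rightarrow> real \<times> real \<Rightarrow> complex" where
  "scaling_hat a b \<omega> =
    (\<Prod>k. refinement_mask a b (exp (\<i> * complex_of_real (fst \<omega> / 2 ^ Suc k)))
                  (exp (\<i> * complex_of_real (snd \<omega> / 2 ^ Suc k))))"

definition wavelet_hat :: "(nat \<Rightarrow> real) \<Rightarrow> (nat \<Rightarrow> real) \<Rightarrow> nat \<Rightarrow> real \<times> real \<Rightarrow> complex" where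
  "wavelet_hat a b i \<omega> =
    wavelet_mask a b i (exp (\<i> * complex_of_real (fst \<omega> / 2)))
                       (exp (\<i> * complex_of_real (snd \<omega> / 2)))
      * scaling_hat a b (fst \<omega> / 2, snd \<omega> / 2)"

definition lattice_point :: "int \<times> int \<Rightarrow> real \<times> real" where
  "lattice_point k = (real_of_int (fst k), real_of_int (snd k))"

definition translate ::
  "(real \<times> real \<Rightarrow> complex) \<Rightarrow> int \<times> int \<Rightarrow> real \<times> real \<Rightarrow> complex" where
  "translate \<phi> l u = \<phi> (u - lattice_point l)"

definition wavelet_system ::
  "(nat \<Rightarrow> real \<times> real \<Rightarrow> complex) \<Rightarrow> nat \<times> int \<times> (int \<times> int) \<Rightarrow> real \<times> real \<Rightarrow> complex" where
  "wavelet_system \<psi> = (\<lambda>(i, j, k) u.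
    complex_of_real (2 powi j) * \<psi> i ((2 powi j) *\<^sub>R u - lattice_point k))"

end

theory Submission
  imports Defs "HOL-Probability.Probability"
begin

text \<open>Write \<open>M\<close> for the mask on the torus and \<open>\<Phi>\<close> for the infinite product.

  \<^bold>\<open>Failure of orthonormality.\<close> On the axis \<open>y = 1\<close> the mask is
  \<open>(x ^ i + x ^ (5 - i)) / 2\<close>, and \<open>a 1 + a 4 + a 7 = 0\<close> excludes \<open>i = 2\<close>; so \<open>\<bar>M\<bar> = 1\<close> along the
  doubling orbit of a point \<open>\<theta> = (2 * pi / N, 0)\<close> with \<open>N\<close> 3 or 5 (on the other axis if
  \<open>a 3 + a 4 + a 5 = 0\<close>). The truncated products have squared norm exactly \<open>4 * pi\<^sup>2\<close>, and a fixed
  part of it sits near \<open>2 ^ n *\<^sub>R \<theta>\<close>, which escapes to infinity. By Fatou \<open>\<phi>\<close> has norm less than 1.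

  \<^bold>\<open>Tight frame.\<close> Let \<open>S f\<close> be the sum of the squared moduli of the inner products of \<open>f\<close> with the
  integer translates of \<open>\<phi>\<close>, and \<open>D\<close> the unitary dilation. The four filters form a paraunitary filter
  bank, which says that \<open>S (D f) - S f\<close> is the wavelet energy of \<open>f\<close> at scale 0. The frame identity
  telescopes to the limits of \<open>S (D\<^sup>j f)\<close> at \<open>\<plusminus>\<infinity>\<close>. Averaging \<open>S\<close> over the
  translates of \<open>f\<close> by the unit square gives the \<open>L2\<close> norm of \<open>fourier_integral f \<cdot> \<Phi>\<close> by Plancherel, without cross terms;
  together with the monotonicity of \<open>S\<close> under \<open>D\<close> and the continuity of translation this yields both
  the Bessel bound and the limit at \<open>\<infinity>\<close>, with no Fourier series and no decay or
  support property of \<open>\<phi>\<close>.\<close>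

text \<open>The three candidates on an axis have modulus |cos (5t/2)|, |cos (3t/2)| and |cos (t/2)|.
  The last equals 1 only at the trivial point, so it alone offers no cycle, and each of the three
  alternatives rules it out on at least one axis.

  Paraunitarity is where the symmetry of the matrix enters. The quadrature condition controls
  autocorrelations summed over all four cosets of the even lattice, while a filter bank must control
  single coset sums. Reflection in \<open>(5, 5)\<close>, a vector with both coordinates odd,
  exchanges the cosets in pairs, and the factor x in m_2 and m_3 joins a coset to one from the other
  pair.

  The obstacle in the limits is that the translates of \<open>\<phi>\<close> are not orthonormal, so
  no Bessel inequality is given in advance. Energies therefore take values in \<open>ennreal\<close>
  until monotonicity makes them finite. An average over shifts only yields information about some
  unknown shift; but a shift of unit size after \<open>n\<close> dilations is one of size 2^(-n)
  before them, and so it disappears in the limit.\<close>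

type_synonym plane_fun = "real \<times> real \<Rightarrow> complex"

section \<open>Square-integrable functions\<close>

text \<open>Extended-valued, so that it makes sense before square-integrability is known;
  \<open>L2I\<close> derives membership from it. \<open>L2_norm\<close> defaults to 0 when the
  square is not integrable and is meaningful only on \<open>L2\<close>.\<close>

definition L2_mass :: "plane_fun \<Rightarrow> ennreal" where
  "L2_mass f = (\<integral>\<^sup>+ u. ennreal ((cmod (f u))\<^sup>2) \<partial>lborel)"

definition L2_norm :: "plane_fun \<Rightarrow> real" where
  "L2_norm f = sqrt (LINT u|lborel. (cmod (f u))\<^sup>2)"

lemma borel_measurable_cnj [measurable (raw)]:
  "f \<in> borel_measurable M \<Longrightarrow> (\<lambda>x. cnj (f x)) \<in> borel_measurable M"
  by (rule measurable_compose[of f M borel cnj borel])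
     (auto intro: borel_measurable_continuous_onI continuous_intros)

lemma L2_measurable [measurable_dest]: "f \<in> L2 \<Longrightarrow> f \<in> borel_measurable borel"
  by (simp add: L2_def)

lemma L2_integrable: "f \<in> L2 \<Longrightarrow> integrable lborel (\<lambda>u. (cmod (f u))\<^sup>2)"
  by (simp add: L2_def)

lemma L2_norm_nonneg [simp]: "L2_norm f \<ge> 0"
  by (simp add: L2_norm_def)

lemma L2_norm_sq: "(L2_norm f)\<^sup>2 = (LINT u|lborel. (cmod (f u))\<^sup>2)"
  by (simp add: L2_norm_def)

lemma L2_mass_eq: "f \<in> L2 \<Longrightarrow> L2_mass f = ennreal ((L2_norm f)\<^sup>2)"
  unfolding L2_mass_def L2_norm_sq by (intro nn_integral_eq_integral L2_integrable) auto

lemma L2_mass_finite: "f \<in> L2 \<Longrightarrow> L2_mass f < \<infinity>"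
  by (simp add: L2_mass_eq)

lemma L2I: "f \<in> borel_measurable borel \<Longrightarrow> L2_mass f < \<infinity> \<Longrightarrow> f \<in> L2"
  unfolding L2_def L2_mass_def integrable_iff_bounded by simp

lemma cmod_add_sq_le: "(cmod (x + y))\<^sup>2 \<le> 2 * (cmod x)\<^sup>2 + 2 * (cmod y)\<^sup>2"
proof -
  have "(cmod (x + y))\<^sup>2 \<le> (cmod x + cmod y)\<^sup>2"
    by (intro power_mono norm_triangle_ineq) auto
  also have "\<dots> \<le> 2 * (cmod x)\<^sup>2 + 2 * (cmod y)\<^sup>2"
    using sum_squares_ge_zero[of "cmod x - cmod y" 0] by (simp add: power2_eq_square algebra_simps)
  finally show ?thesis .
qed

lemma L2I_bound:
  assumes "f \<in> borel_measurable borel" "integrable lborel w" "\<And>u. (cmod (f u))\<^sup>2 \<le> w u"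
  shows "f \<in> L2"
proof -
  have "integrable lborel (\<lambda>u. (cmod (f u))\<^sup>2)"
  proof (rule Bochner_Integration.integrable_bound[OF assms(2)])
    show "(\<lambda>u. (cmod (f u))\<^sup>2) \<in> borel_measurable lborel"
      using assms(1) by measurable
    show "AE u in lborel. norm ((cmod (f u))\<^sup>2) \<le> norm (w u)"
      using assms(3) by (intro AE_I2) (smt (verit) real_norm_def zero_le_power2)
  qed
  then show ?thesis using assms(1) by (simp add: L2_def)
qed

lemma L2_add:
  assumes "f \<in> L2" "g \<in> L2"
  shows "(\<lambda>u. f u + g u) \<in> L2"
proof (rule L2I_bound)
  show "(\<lambda>u. f u + g u) \<in> borel_measurable borel" using assms by measurable
  show "integrable lborel (\<lambda>u. 2 * (cmod (f u))\<^sup>2 + 2 * (cmod (g u))\<^sup>2)"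
    using assms by (intro Bochner_Integration.integrable_add integrable_mult_right L2_integrable)
qed (rule cmod_add_sq_le)

lemma L2_scale: "f \<in> L2 \<Longrightarrow> (\<lambda>u. c * f u) \<in> L2"
  unfolding L2_def by (auto simp: norm_mult power_mult_distrib)

lemma L2_zero: "(\<lambda>u. 0) \<in> L2"
  unfolding L2_def by auto

lemma L2_diff: "f \<in> L2 \<Longrightarrow> g \<in> L2 \<Longrightarrow> (\<lambda>u. f u - g u) \<in> L2"
  using L2_add[of f "\<lambda>u. -1 * g u"] L2_scale[of g "-1"] by simp

lemma L2_sum: "finite K \<Longrightarrow> (\<And>k. k \<in> K \<Longrightarrow> f k \<in> L2) \<Longrightarrow> (\<lambda>u. \<Sum>k\<in>K. f k u) \<in> L2"
  by (induction K rule: finite_induct) (auto simp: L2_zero intro!: L2_add)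

lemma L2_bounded_mult:
  assumes "f \<in> L2" "g \<in> borel_measurable borel" "\<And>u. cmod (g u) \<le> 1"
  shows "(\<lambda>u. g u * f u) \<in> L2"
proof -
  have le: "(cmod (g u * f u))\<^sup>2 \<le> (cmod (f u))\<^sup>2" for u
    using assms(3)[of u] by (intro power_mono) (auto simp: norm_mult mult_left_le_one_le)
  show ?thesis
    by (rule L2I_bound[OF _ L2_integrable[OF assms(1)] le]) (use assms(1,2) in measurable)
qed

lemma L2_mult_integrable:
  assumes "f \<in> L2" "g \<in> L2"
  shows "integrable lborel (\<lambda>u. f u * cnj (g u))"
proof (rule Bochner_Integration.integrable_bound)
  show "integrable lborel (\<lambda>u. (cmod (f u))\<^sup>2 + (cmod (g u))\<^sup>2)"
    using assms by (intro Bochner_Integration.integrable_add L2_integrable)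
  show "(\<lambda>u. f u * cnj (g u)) \<in> borel_measurable lborel"
    using assms by measurable
  show "AE u in lborel. norm (f u * cnj (g u)) \<le> norm ((cmod (f u))\<^sup>2 + (cmod (g u))\<^sup>2)"
  proof (intro AE_I2)
    fix u
    have "0 \<le> (cmod (f u) - cmod (g u))\<^sup>2" "0 \<le> cmod (f u) * cmod (g u)" by auto
    then have "cmod (f u) * cmod (g u) \<le> (cmod (f u))\<^sup>2 + (cmod (g u))\<^sup>2"
      unfolding power2_diff by linarith
    then show "norm (f u * cnj (g u)) \<le> norm ((cmod (f u))\<^sup>2 + (cmod (g u))\<^sup>2)"
      by (simp add: norm_mult)
  qed
qed

section \<open>Inner product and norm\<close>

lemma L2_inner_self: "L2_inner f f = complex_of_real ((L2_norm f)\<^sup>2)"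
proof -
  have "L2_inner f f = (LINT u|lborel. complex_of_real ((cmod (f u))\<^sup>2))"
    unfolding L2_inner_def complex_norm_square ..
  then show ?thesis unfolding L2_norm_sq by (simp del: of_real_power)
qed

lemma L2_inner_add_left:
  "f \<in> L2 \<Longrightarrow> g \<in> L2 \<Longrightarrow> h \<in> L2 \<Longrightarrow> L2_inner (\<lambda>u. f u + g u) h = L2_inner f h + L2_inner g h"
  unfolding L2_inner_def
  by (subst Bochner_Integration.integral_add[symmetric]) (auto simp: algebra_simps intro: L2_mult_integrable)

lemma L2_inner_add_right:
  "f \<in> L2 \<Longrightarrow> g \<in> L2 \<Longrightarrow> h \<in> L2 \<Longrightarrow> L2_inner h (\<lambda>u. f u + g u) = L2_inner h f + L2_inner h g"
  unfolding L2_inner_def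
  by (subst Bochner_Integration.integral_add[symmetric]) (auto simp: algebra_simps intro: L2_mult_integrable)

lemma L2_inner_diff_left:
  "f \<in> L2 \<Longrightarrow> g \<in> L2 \<Longrightarrow> h \<in> L2 \<Longrightarrow> L2_inner (\<lambda>u. f u - g u) h = L2_inner f h - L2_inner g h"
  unfolding L2_inner_def
  by (subst Bochner_Integration.integral_diff[symmetric]) (auto simp: algebra_simps intro: L2_mult_integrable)

lemma L2_inner_scale_right: "L2_inner h (\<lambda>u. c * f u) = cnj c * L2_inner h f"
  unfolding L2_inner_def by (simp add: mult.left_commute)

lemma L2_inner_sum_right:
  assumes "finite K" "h \<in> L2" "\<And>k. k \<in> K \<Longrightarrow> f k \<in> L2"
  shows "L2_inner h (\<lambda>u. \<Sum>k\<in>K. f k u) = (\<Sum>k\<in>K. L2_inner h (f k))"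
  using assms
  by (induction K rule: finite_induct) (simp_all add: L2_inner_add_right L2_sum L2_inner_def[of h "\<lambda>u. 0"])

lemma L2_inner_commute: "L2_inner g f = cnj (L2_inner f g)"
  unfolding L2_inner_def using Bochner_Integration.integral_cnj[of lborel "\<lambda>u. f u * cnj (g u)"] by (simp add: mult.commute)

lemma L2_inner_cong_AE:
  assumes "f \<in> L2" "g \<in> L2" "h \<in> L2" "AE u in lborel. f u = g u"
  shows "L2_inner h f = L2_inner h g"
  using assms(4) unfolding L2_inner_def
  by (intro integral_cong_AE) (use assms(1-3) in measurable, auto)

lemma L2_Cauchy_Schwarz:
  assumes "f \<in> L2" "g \<in> L2"
  shows "cmod (L2_inner f g) \<le> L2_norm f * L2_norm g"
proof -
  have [measurable]: "f \<in> borel_measurable borel" "g \<in> borel_measurable borel"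
    using assms by auto
  have "ennreal (cmod (L2_inner f g)) \<le> (\<integral>\<^sup>+u. ennreal (cmod (f u * cnj (g u))) \<partial>lborel)"
    unfolding L2_inner_def using L2_mult_integrable[OF assms] by (rule integral_norm_bound_ennreal)
  also have "\<dots> = (\<integral>\<^sup>+u. ennreal (cmod (f u)) * ennreal (cmod (g u)) \<partial>lborel)"
    by (simp add: norm_mult ennreal_mult)
  finally have "(ennreal (cmod (L2_inner f g)))\<^sup>2 \<le> (\<integral>\<^sup>+u. ennreal (cmod (f u)) * ennreal (cmod (g u)) \<partial>lborel)\<^sup>2"
    by (rule power_mono) auto
  also have "\<dots> \<le> (\<integral>\<^sup>+u. ennreal (cmod (f u)) ^ 2 \<partial>lborel) * (\<integral>\<^sup>+u. ennreal (cmod (g u)) ^ 2 \<partial>lborel)"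
    by (rule Cauchy_Schwarz_nn_integral) measurable
  also have "\<dots> = L2_mass f * L2_mass g"
    by (simp add: L2_mass_def ennreal_power)
  also have "\<dots> = ennreal ((L2_norm f * L2_norm g)\<^sup>2)"
    using assms by (simp add: L2_mass_eq ennreal_mult power_mult_distrib)
  finally have "(cmod (L2_inner f g))\<^sup>2 \<le> (L2_norm f * L2_norm g)\<^sup>2"
    by (simp add: ennreal_power)
  then show ?thesis by (rule power2_le_imp_le) simp
qed

lemma L2_norm_add_sq:
  assumes "f \<in> L2" "g \<in> L2"
  shows "(L2_norm (\<lambda>u. f u + g u))\<^sup>2 = (L2_norm f)\<^sup>2 + (L2_norm g)\<^sup>2 + 2 * Re (L2_inner f g)"
proof -
  have "complex_of_real ((L2_norm (\<lambda>u. f u + g u))\<^sup>2) = L2_inner (\<lambda>u. f u + g u) (\<lambda>u. f u + g u)"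
    by (simp add: L2_inner_self)
  also have "\<dots> = L2_inner f f + L2_inner g g + (L2_inner f g + cnj (L2_inner f g))"
    using assms by (simp add: L2_inner_add_left L2_inner_add_right L2_add L2_inner_commute[of f g])
  also have "\<dots> = complex_of_real ((L2_norm f)\<^sup>2 + (L2_norm g)\<^sup>2 + 2 * Re (L2_inner f g))"
    by (simp add: L2_inner_self complex_add_cnj)
  finally show ?thesis
    using of_real_eq_iff by blast
qed

lemma L2_norm_triangle:
  assumes "f \<in> L2" "g \<in> L2"
  shows "L2_norm (\<lambda>u. f u + g u) \<le> L2_norm f + L2_norm g"
proof (rule power2_le_imp_le)
  have "(L2_norm (\<lambda>u. f u + g u))\<^sup>2 = (L2_norm f)\<^sup>2 + (L2_norm g)\<^sup>2 + 2 * Re (L2_inner f g)"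
    by (rule L2_norm_add_sq[OF assms])
  also have "\<dots> \<le> (L2_norm f)\<^sup>2 + (L2_norm g)\<^sup>2 + 2 * (L2_norm f * L2_norm g)"
    using L2_Cauchy_Schwarz[OF assms] complex_Re_le_cmod[of "L2_inner f g"] by linarith
  finally show "(L2_norm (\<lambda>u. f u + g u))\<^sup>2 \<le> (L2_norm f + L2_norm g)\<^sup>2"
    by (simp add: power2_sum algebra_simps)
qed simp

lemma L2_norm_minus: "L2_norm (\<lambda>u. f u - g u) = L2_norm (\<lambda>u. g u - f u)"
  by (simp add: L2_norm_def norm_minus_commute)

lemma L2_norm_diff_triangle:
  assumes "f \<in> L2" "g \<in> L2" "h \<in> L2"
  shows "L2_norm (\<lambda>u. f u - h u) \<le> L2_norm (\<lambda>u. f u - g u) + L2_norm (\<lambda>u. g u - h u)"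
  using L2_norm_triangle[of "\<lambda>u. f u - g u" "\<lambda>u. g u - h u"] assms by (simp add: L2_diff)

lemma L2_norm_diff_le:
  assumes "f \<in> L2" "g \<in> L2"
  shows "\<bar>L2_norm f - L2_norm g\<bar> \<le> L2_norm (\<lambda>u. f u - g u)"
  using L2_norm_triangle[of "\<lambda>u. f u - g u" g] L2_norm_triangle[of "\<lambda>u. g u - f u" f] assms
  by (simp add: L2_diff L2_norm_minus[of f g])

lemma L2_norm_zero_iff:
  assumes "f \<in> L2"
  shows "L2_norm f = 0 \<longleftrightarrow> (AE u in lborel. f u = 0)"
  unfolding L2_norm_def
  using integral_nonneg_eq_0_iff_AE[OF L2_integrable[OF assms]] by simp

section \<open>Convergence in the L2 norm\<close>

lemma tendsto_L2_iff:
  assumes "\<And>n. F n \<in> L2" "f \<in> L2"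
  shows "tendsto_L2 F f \<longleftrightarrow> (\<lambda>n. L2_norm (\<lambda>u. F n u - f u)) \<longlonglongrightarrow> 0"
proof -
  have "tendsto_L2 F f \<longleftrightarrow> (\<lambda>n. ennreal ((L2_norm (\<lambda>u. F n u - f u))\<^sup>2)) \<longlonglongrightarrow> ennreal 0"
    unfolding tendsto_L2_def using assms by (simp add: L2_mass_eq[symmetric] L2_diff L2_mass_def)
  also have "\<dots> \<longleftrightarrow> (\<lambda>n. (L2_norm (\<lambda>u. F n u - f u))\<^sup>2) \<longlonglongrightarrow> 0"
    by (subst tendsto_ennreal_iff) auto
  also have "\<dots> \<longleftrightarrow> (\<lambda>n. L2_norm (\<lambda>u. F n u - f u)) \<longlonglongrightarrow> 0"
    using tendsto_real_sqrt[of "\<lambda>n. (L2_norm (\<lambda>u. F n u - f u))\<^sup>2" 0 sequentially]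
      tendsto_power[of "\<lambda>n. L2_norm (\<lambda>u. F n u - f u)" 0 sequentially 2]
    by auto
  finally show ?thesis .
qed

lemma tendsto_L2_norm:
  assumes "\<And>n. F n \<in> L2" "f \<in> L2" "(\<lambda>n. L2_norm (\<lambda>u. F n u - f u)) \<longlonglongrightarrow> 0"
  shows "(\<lambda>n. L2_norm (F n)) \<longlonglongrightarrow> L2_norm f"
proof (rule Lim_transform2[OF tendsto_const])
  show "(\<lambda>n. L2_norm f - L2_norm (F n)) \<longlonglongrightarrow> 0"
    by (rule Lim_null_comparison[OF _ assms(3)])
       (use L2_norm_diff_le[OF assms(1,2)] in \<open>auto simp: abs_minus_commute\<close>)
qed

lemma tendsto_L2_inner:
  assumes "\<And>n. F n \<in> L2" "f \<in> L2" "g \<in> L2" "(\<lambda>n. L2_norm (\<lambda>u. F n u - f u)) \<longlonglongrightarrow> 0"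
  shows "(\<lambda>n. L2_inner (F n) g) \<longlonglongrightarrow> L2_inner f g"
proof -
  have "(\<lambda>n. L2_inner (F n) g - L2_inner f g) \<longlonglongrightarrow> 0"
  proof (rule Lim_null_comparison)
    show "\<forall>\<^sub>F n in sequentially. norm (L2_inner (F n) g - L2_inner f g)
            \<le> L2_norm (\<lambda>u. F n u - f u) * L2_norm g"
      using assms(1-3) L2_Cauchy_Schwarz[of "\<lambda>u. F _ u - f u" g]
      by (auto simp: L2_inner_diff_left[symmetric] L2_diff)
    show "(\<lambda>n. L2_norm (\<lambda>u. F n u - f u) * L2_norm g) \<longlonglongrightarrow> 0"
      using tendsto_mult_right[OF assms(4), of "L2_norm g"] by simp
  qed
  then show ?thesis using Lim_null by blast
qed

text \<open>Domination is by a multiple of the limit itself, as happens for truncations and for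
  spectra damped by a bounded factor. Then |F n - f|^2 is at most (2 B^2 + 2) |f|^2, which is
  integrable.\<close>

lemma L2_dominated_convergence:
  assumes F: "\<And>n. F n \<in> borel_measurable borel" and f: "f \<in> L2"
    and le: "\<And>n u. cmod (F n u) \<le> B * cmod (f u)"
    and lim: "\<And>u. (\<lambda>n. F n u) \<longlonglongrightarrow> f u"
  shows "\<And>n. F n \<in> L2" "(\<lambda>n. L2_norm (\<lambda>u. F n u - f u)) \<longlonglongrightarrow> 0"
proof -
  have [measurable]: "F n \<in> borel_measurable borel" "f \<in> borel_measurable borel" for n
    using F f by auto
  show L2: "F n \<in> L2" for n
  proof -
    have le2: "(cmod (F n u))\<^sup>2 \<le> B\<^sup>2 * (cmod (f u))\<^sup>2" for u
      using power_mono[OF le[of n u], of 2] by (simp add: power_mult_distrib)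
    show ?thesis
      by (rule L2I_bound[OF _ integrable_mult_right[OF L2_integrable[OF f]] le2]) (rule F)
  qed
  have "(\<lambda>n. LINT u|lborel. (cmod (F n u - f u))\<^sup>2) \<longlonglongrightarrow> (LINT u::real\<times>real|lborel. (0::real))"
  proof (rule integral_dominated_convergence[where w="\<lambda>u. 2 * (B\<^sup>2 * (cmod (f u))\<^sup>2) + 2 * (cmod (f u))\<^sup>2"])
    show "integrable lborel (\<lambda>u. 2 * (B\<^sup>2 * (cmod (f u))\<^sup>2) + 2 * (cmod (f u))\<^sup>2)"
      by (intro Bochner_Integration.integrable_add integrable_mult_right L2_integrable f)
    show "AE u in lborel. (\<lambda>n. (cmod (F n u - f u))\<^sup>2) \<longlonglongrightarrow> 0"
    proof (rule AE_I2)
      fix u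
      have "(\<lambda>n. (cmod (F n u - f u))\<^sup>2) \<longlonglongrightarrow> (cmod (f u - f u))\<^sup>2"
        by (intro tendsto_intros lim)
      then show "(\<lambda>n. (cmod (F n u - f u))\<^sup>2) \<longlonglongrightarrow> 0" by simp
    qed
    show "AE u in lborel. norm ((cmod (F n u - f u))\<^sup>2) \<le> 2 * (B\<^sup>2 * (cmod (f u))\<^sup>2) + 2 * (cmod (f u))\<^sup>2" for n
    proof (rule AE_I2)
      fix u
      have "(cmod (F n u))\<^sup>2 \<le> B\<^sup>2 * (cmod (f u))\<^sup>2"
        using power_mono[OF le[of n u], of 2] by (simp add: power_mult_distrib)
      then show "norm ((cmod (F n u - f u))\<^sup>2) \<le> 2 * (B\<^sup>2 * (cmod (f u))\<^sup>2) + 2 * (cmod (f u))\<^sup>2"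
        using cmod_add_sq_le[of "F n u" "- f u"] by simp
    qed
  qed measurable
  then have "(\<lambda>n. sqrt (LINT u|lborel. (cmod (F n u - f u))\<^sup>2)) \<longlonglongrightarrow> sqrt 0"
    by (intro tendsto_real_sqrt) simp
  then show "(\<lambda>n. L2_norm (\<lambda>u. F n u - f u)) \<longlonglongrightarrow> 0"
    by (simp add: L2_norm_def)
qed

subsection \<open>Affine changes of variables\<close>

text \<open>The Jacobian of scaling in the plane is \<open>c\<close> squared, positive for either
  sign of \<open>c\<close>. Hence the rules of this group also perform reflections and the
  substitution \<open>v = u - e *\<^sub>R z\<close>.\<close>

lemma nn_integral_plane_affine:
  fixes f :: "real \<times> real \<Rightarrow> ennreal"
  assumes [measurable]: "f \<in> borel_measurable borel" and c: "c \<noteq> 0"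
  shows "(\<integral>\<^sup>+u. f u \<partial>lborel) = ennreal (c\<^sup>2) * (\<integral>\<^sup>+u. f (t + c *\<^sub>R u) \<partial>lborel)"
  by (subst lborel_affine[OF c, of t])
     (simp add: nn_integral_density nn_integral_distr nn_integral_cmult power2_eq_square)

lemma integrable_plane_affine:
  fixes f :: "real \<times> real \<Rightarrow> 'b :: {banach, second_countable_topology}"
  assumes f: "integrable lborel f" and c: "c \<noteq> 0"
  shows "integrable lborel (\<lambda>u. f (t + c *\<^sub>R u))"
  using f f[THEN borel_measurable_integrable] c unfolding integrable_iff_bounded
  by (subst (asm) nn_integral_plane_affine[where c=c and t=t]) (auto simp: ennreal_mult_less_top)

lemma integral_plane_affine:
  fixes f :: "real \<times> real \<Rightarrow> 'b :: {banach, second_countable_topology}"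
  assumes [measurable]: "f \<in> borel_measurable borel" and c: "c \<noteq> 0"
  shows "(LINT u|lborel. f u) = c\<^sup>2 *\<^sub>R (LINT u|lborel. f (t + c *\<^sub>R u))"
  by (subst lborel_affine[OF c, of t]) (simp add: integral_density integral_distr power2_eq_square)

lemma L2_affine:
  assumes "f \<in> L2" "c \<noteq> 0"
  shows "(\<lambda>u. f (t + c *\<^sub>R u)) \<in> L2"
  using assms integrable_plane_affine[OF L2_integrable, of f c t] by (auto simp: L2_def)

lemma L2_norm_affine:
  assumes [measurable]: "f \<in> borel_measurable borel" and "c \<noteq> 0"
  shows "L2_norm f = \<bar>c\<bar> * L2_norm (\<lambda>u. f (t + c *\<^sub>R u))"
  unfolding L2_norm_def
  by (subst integral_plane_affine[where c=c and t=t]) (use assms in \<open>auto simp: real_sqrt_mult\<close>)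

subsection \<open>Continuity of translation\<close>

text \<open>Continuity of translation is proved first in L1, where \<open>integrable_induct\<close>
  applies, and carried to L2 by truncation. Null sequences of shifts are used so that dominated
  convergence applies directly.\<close>

definition L1_shift_continuous :: "plane_fun \<Rightarrow> bool" where
  "L1_shift_continuous f \<longleftrightarrow>
    (\<forall>w. w \<longlonglongrightarrow> 0 \<longrightarrow> (\<lambda>n. LINT u|lborel. cmod (f (u - w n) - f u)) \<longlonglongrightarrow> 0)"

lemma integrable_shift:
  fixes f :: "real \<times> real \<Rightarrow> 'b :: {banach, second_countable_topology}"
  shows "integrable lborel f \<Longrightarrow> integrable lborel (\<lambda>u. f (u - w))"
  using integrable_plane_affine[of f 1 "- w"] by simp

lemma integral_shift:
  fixes f :: "real \<times> real \<Rightarrow> 'b :: {banach, second_countable_topology}"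
  shows "f \<in> borel_measurable borel \<Longrightarrow> (LINT u|lborel. f (u - w)) = (LINT u|lborel. f u)"
  using integral_plane_affine[of f 1 "- w"] by simp

text \<open>Three-epsilon argument: Lebesgue measure is translation invariant, so \<open>f\<close>
  and \<open>g\<close> are as close after a shift as before it, whatever the shift.\<close>

lemma L1_shift_continuous_closure:
  assumes f: "integrable lborel f"
    and approx: "\<And>e. e > 0 \<Longrightarrow> \<exists>g. integrable lborel g \<and> L1_shift_continuous g \<and>
                    (LINT u|lborel. cmod (f u - g u)) < e"
  shows "L1_shift_continuous f"
  unfolding L1_shift_continuous_def
proof (intro allI impI)
  fix w :: "nat \<Rightarrow> real \<times> real" assume w: "w \<longlonglongrightarrow> 0"
  show "(\<lambda>n. LINT u|lborel. cmod (f (u - w n) - f u)) \<longlonglongrightarrow> 0"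
  proof (rule metric_LIMSEQ_I)
    fix e :: real assume e: "e > 0"
    then obtain g where g: "integrable lborel g" "L1_shift_continuous g"
        "(LINT u|lborel. cmod (f u - g u)) < e / 3"
      using approx[of "e / 3"] by auto
    then obtain N where N: "\<And>n. n \<ge> N \<Longrightarrow> (LINT u|lborel. cmod (g (u - w n) - g u)) < e / 3"
      using w e LIMSEQ_D[of "\<lambda>n. LINT u|lborel. cmod (g (u - w n) - g u)" 0 "e / 3"]
      unfolding L1_shift_continuous_def by fastforce
    have "dist (LINT u|lborel. cmod (f (u - w n) - f u)) 0 < e" if n: "n \<ge> N" for n
    proof -
      have i1: "integrable lborel (\<lambda>u. f (u - w n) - g (u - w n))"
        and i2: "integrable lborel (\<lambda>u. g (u - w n) - g u)"
        and i3: "integrable lborel (\<lambda>u. f u - g u)"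
        and i4: "integrable lborel (\<lambda>u. f (u - w n) - f u)"
        by (intro Bochner_Integration.integrable_diff integrable_shift f g)+
      have "(LINT u|lborel. cmod (f (u - w n) - f u))
          \<le> (LINT u|lborel. cmod (f (u - w n) - g (u - w n)) + cmod (g (u - w n) - g u) + cmod (f u - g u))"
      proof (rule integral_mono)
        fix u
        show "cmod (f (u - w n) - f u) \<le>
            cmod (f (u - w n) - g (u - w n)) + cmod (g (u - w n) - g u) + cmod (f u - g u)"
          using norm_triangle_ineq[of "f (u - w n) - g (u - w n)" "g (u - w n) - g u + (g u - f u)"]
            norm_triangle_ineq[of "g (u - w n) - g u" "g u - f u"]
          by (simp add: norm_minus_commute)
      qed (intro Bochner_Integration.integrable_add integrable_norm i1 i2 i3 i4)+
      also have "\<dots> = (LINT u|lborel. cmod (f (u - w n) - g (u - w n)))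
          + (LINT u|lborel. cmod (g (u - w n) - g u)) + (LINT u|lborel. cmod (f u - g u))"
        using i1 i2 i3 by simp
      also have "(LINT u|lborel. cmod (f (u - w n) - g (u - w n))) = (LINT u|lborel. cmod (f u - g u))"
        by (rule integral_shift[of "\<lambda>u. cmod (f u - g u)"]) (use f g in auto)
      finally have "(LINT u|lborel. cmod (f (u - w n) - f u)) < e"
        using N[OF n] g(3) by linarith
      then show ?thesis by simp
    qed
    then show "\<exists>N. \<forall>n\<ge>N. dist (LINT u|lborel. cmod (f (u - w n) - f u)) 0 < e" by blast
  qed
qed

text \<open>The indicator of an open set is lower semicontinuous, so the part of \<open>U\<close>
  lost by the shift tends to 0 pointwise, dominated by the indicator of \<open>U\<close>. The part
  gained has the same measure as the part lost, because \<open>U\<close> and its shift have equal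
  finite measure; this gives the factor 2.\<close>

lemma L1_shift_continuous_open:
  assumes U: "open U" "emeasure lborel U < \<infinity>"
  shows "L1_shift_continuous (\<lambda>u. indicator U u *\<^sub>R c)"
  unfolding L1_shift_continuous_def
proof (intro allI impI)
  fix w :: "nat \<Rightarrow> real \<times> real" assume w: "w \<longlonglongrightarrow> 0"
  have [measurable]: "U \<in> sets borel" using U by auto
  define I where "I = (indicator U :: real \<times> real \<Rightarrow> real)"
  have [measurable]: "I \<in> borel_measurable borel" unfolding I_def by measurable
  have I01: "0 \<le> I u" "I u \<le> 1" for u by (auto simp: I_def split: split_indicator)
  have I: "integrable lborel I"
    using U unfolding I_def by auto
  have iw: "integrable lborel (\<lambda>u. I (u - w n))" for n
    by (rule integrable_shift[OF I])
  have pos: "(\<lambda>n. LINT u|lborel. max (I u - I (u - w n)) 0) \<longlonglongrightarrow> (LINT u::real\<times>real|lborel. 0)"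
  proof (rule integral_dominated_convergence[where w=I])
    show "AE u in lborel. norm (max (I u - I (u - w n)) 0) \<le> I u" for n
      using I01 by (intro AE_I2) (auto simp: max_def)
    show "AE u in lborel. (\<lambda>n. max (I u - I (u - w n)) 0) \<longlonglongrightarrow> 0"
    proof (rule AE_I2)
      fix u
      show "(\<lambda>n. max (I u - I (u - w n)) 0) \<longlonglongrightarrow> 0"
      proof (cases "u \<in> U")
        case True
        have "(\<lambda>n. u - w n) \<longlonglongrightarrow> u - 0" by (intro tendsto_intros w)
        then have "\<forall>\<^sub>F n in sequentially. u - w n \<in> U"
          using U True by (auto dest: topological_tendstoD)
        then show ?thesis
          by (intro tendsto_eventually) (auto simp: I_def True elim!: eventually_mono)
      next
        case False
        then have "max (I u - I (u - w n)) 0 = 0" for n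
          using I01[of "u - w n"] by (auto simp: I_def)
        then show ?thesis by simp
      qed
    qed
  qed (use I in auto)
  have imax: "integrable lborel (\<lambda>u. max (I u - I (u - w n)) 0)" for n
    using I iw[of n] by auto
  have "(LINT u|lborel. cmod (indicator U (u - w n) *\<^sub>R c - indicator U u *\<^sub>R c))
      = 2 * cmod c * (LINT u|lborel. max (I u - I (u - w n)) 0)" for n
  proof -
    \<comment> \<open>This is |s| = 2 max(-s, 0) + s, and the last term integrates to 0.\<close>
    have "cmod (indicator U (u - w n) *\<^sub>R c - indicator U u *\<^sub>R c)
        = cmod c * (2 * max (I u - I (u - w n)) 0 + (I (u - w n) - I u))" for u
      by (auto simp: I_def split: split_indicator)
    then have "(LINT u|lborel. cmod (indicator U (u - w n) *\<^sub>R c - indicator U u *\<^sub>R c))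
        = cmod c * (2 * (LINT u|lborel. max (I u - I (u - w n)) 0) + ((LINT u|lborel. I (u - w n)) - (LINT u|lborel. I u)))"
      using I iw[of n] imax[of n] by simp
    also have "(LINT u|lborel. I (u - w n)) = (LINT u|lborel. I u)"
      by (rule integral_shift) simp
    finally show ?thesis by simp
  qed
  then show "(\<lambda>n. LINT u|lborel. cmod (indicator U (u - w n) *\<^sub>R c - indicator U u *\<^sub>R c)) \<longlonglongrightarrow> 0"
    using tendsto_mult_left[OF pos, of "2 * cmod c"] by simp
qed

text \<open>Open sets are the starting point: a set of finite measure lies in an open set with
  little excess measure, and the closure lemma passes to it and to dominated pointwise
  limits.\<close>

lemma integrable_L1_shift_continuous:
  assumes "integrable lborel f"
  shows "L1_shift_continuous f"
  using assms
proof (induction rule: integrable_induct)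
  case (base A c)
  then have A [measurable]: "A \<in> sets borel" by simp
  show ?case
  proof (rule L1_shift_continuous_closure)
    show "integrable lborel (\<lambda>u. indicator A u *\<^sub>R c)"
      using base by (auto intro!: integrable_indicator integrable_scaleR_left)
    fix e :: real assume e: "e > 0"
    \<comment> \<open>The added 1 in the denominator covers \<open>c = 0\<close>.\<close>
    define e' where "e' = e / (cmod c + 1)"
    have e': "e' > 0" "cmod c * e' < e"
      using e by (auto simp: e'_def field_simps add_pos_nonneg)
    obtain U where U: "open U" "A \<subseteq> U" "emeasure lborel (U - A) < e'"
      using outer_regular_lborel[OF A e'(1)] by blast
    have [measurable]: "U \<in> sets borel" using U by auto
    have "emeasure lborel U = emeasure lborel A + emeasure lborel (U - A)"
      using U(2) by (subst plus_emeasure) (auto intro!: arg_cong[of _ _ "emeasure lborel"])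
    then have Ufin: "emeasure lborel U < \<infinity>"
      using base order.strict_trans[OF U(3) ennreal_less_top] by auto
    have "(LINT u|lborel. cmod (indicator A u *\<^sub>R c - indicator U u *\<^sub>R c))
        = (LINT u|lborel. cmod c * indicator (U - A) u)"
      using U(2) by (intro Bochner_Integration.integral_cong) (auto split: split_indicator)
    also have "\<dots> = cmod c * measure lborel (U - A)"
      using U(3) by (simp add: top.not_eq_extremum)
    also have "\<dots> \<le> cmod c * e'"
      using U(3) e' by (intro mult_left_mono) (auto simp: measure_def intro!: enn2real_leI)
    also note e'(2)
    finally show "\<exists>g. integrable lborel g \<and> L1_shift_continuous g \<and>
        (LINT u|lborel. cmod (indicator A u *\<^sub>R c - g u)) < e"
      using L1_shift_continuous_open[OF U(1) Ufin, of c] Ufin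
      by (intro exI[of _ "\<lambda>u. indicator U u *\<^sub>R c"]) auto
  qed
next
  case (add f g)
  show ?case
    unfolding L1_shift_continuous_def
  proof (intro allI impI)
    fix w :: "nat \<Rightarrow> real \<times> real" assume w: "w \<longlonglongrightarrow> 0"
    have i: "integrable lborel (\<lambda>u. f (u - w n) - f u)" "integrable lborel (\<lambda>u. g (u - w n) - g u)" for n
      by (intro Bochner_Integration.integrable_diff integrable_shift add)+
    show "(\<lambda>n. LINT u|lborel. cmod ((f (u - w n) + g (u - w n)) - (f u + g u))) \<longlonglongrightarrow> 0"
    proof (rule Lim_null_comparison)
      show "(\<lambda>n. (LINT u|lborel. cmod (f (u - w n) - f u)) + (LINT u|lborel. cmod (g (u - w n) - g u))) \<longlonglongrightarrow> 0"
        using add.IH w unfolding L1_shift_continuous_def by (intro tendsto_add_zero) auto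
      have "(LINT u|lborel. cmod ((f (u - w n) + g (u - w n)) - (f u + g u)))
          \<le> (LINT u|lborel. cmod (f (u - w n) - f u) + cmod (g (u - w n) - g u))" for n
      proof (rule integral_mono)
        show "integrable lborel (\<lambda>u. cmod ((f (u - w n) + g (u - w n)) - (f u + g u)))"
          by (intro integrable_norm Bochner_Integration.integrable_diff Bochner_Integration.integrable_add integrable_shift add)
        show "cmod ((f (u - w n) + g (u - w n)) - (f u + g u))
            \<le> cmod (f (u - w n) - f u) + cmod (g (u - w n) - g u)" for u
          using norm_triangle_ineq[of "f (u - w n) - f u" "g (u - w n) - g u"] by (simp add: algebra_simps)
      qed (intro Bochner_Integration.integrable_add integrable_norm i)
      then show "\<forall>\<^sub>F n in sequentially. norm (LINT u|lborel. cmod ((f (u - w n) + g (u - w n)) - (f u + g u)))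
          \<le> (LINT u|lborel. cmod (f (u - w n) - f u)) + (LINT u|lborel. cmod (g (u - w n) - g u))"
        using i by simp
    qed
  qed
next
  case (lim f s)
  show ?case
  proof (rule L1_shift_continuous_closure[OF lim.hyps(4)])
    fix e :: real assume e: "e > 0"
    have [measurable]: "f \<in> borel_measurable lborel" "s i \<in> borel_measurable lborel" for i
      using lim.hyps(1)[of i] lim.hyps(4) by auto
    have "(\<lambda>i. LINT u|lborel. cmod (f u - s i u)) \<longlonglongrightarrow> (LINT u::real\<times>real|lborel. 0)"
    proof (rule integral_dominated_convergence[where w="\<lambda>u. 3 * cmod (f u)"])
      show "AE u in lborel. (\<lambda>i. cmod (f u - s i u)) \<longlonglongrightarrow> 0"
      proof (rule AE_I2)
        fix u
        have "(\<lambda>i. cmod (f u - s i u)) \<longlonglongrightarrow> cmod (f u - f u)"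
          by (intro tendsto_intros lim.hyps(2)) simp
        then show "(\<lambda>i. cmod (f u - s i u)) \<longlonglongrightarrow> 0" by simp
      qed
      show "AE u in lborel. norm (cmod (f u - s i u)) \<le> 3 * cmod (f u)" for i
      proof (rule AE_I2)
        fix u
        show "norm (cmod (f u - s i u)) \<le> 3 * cmod (f u)"
          using norm_triangle_ineq4[of "f u" "s i u"] lim.hyps(3)[of u i] by simp
      qed
    qed (use lim.hyps(4) in auto)
    then obtain i where "(LINT u|lborel. cmod (f u - s i u)) < e"
      using LIMSEQ_D[of "\<lambda>i. LINT u|lborel. cmod (f u - s i u)" 0 e] e by fastforce
    then show "\<exists>g. integrable lborel g \<and> L1_shift_continuous g \<and> (LINT u|lborel. cmod (f u - g u)) < e"
      using lim.hyps(1) lim.IH by blast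
  qed
qed

text \<open>Large values and large arguments are cut off together. The value bound serves continuity
  of translation, integrability serves the Fourier integral, and bounded support serves the
  coarse-scale limit.\<close>

definition bounded_part :: "plane_fun \<Rightarrow> nat \<Rightarrow> plane_fun" where
  "bounded_part f m u = (if cmod (f u) \<le> m \<and> norm u \<le> m then f u else 0)"

lemma measurable_bounded_part:
  assumes "f \<in> L2"
  shows "bounded_part f m \<in> borel_measurable borel"
proof -
  have [measurable]: "f \<in> borel_measurable borel" using assms by auto
  show ?thesis unfolding bounded_part_def by measurable
qed

lemma
  assumes f: "f \<in> L2"
  shows bounded_part_L2: "bounded_part f m \<in> L2"
    and bounded_part_tendsto: "(\<lambda>m. L2_norm (\<lambda>u. bounded_part f m u - f u)) \<longlonglongrightarrow> 0"
proof -
  have "(\<lambda>m. bounded_part f m u) \<longlonglongrightarrow> f u" for u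
  proof (rule tendsto_eventually)
    have "\<forall>\<^sub>F m in sequentially. nat \<lceil>max (cmod (f u)) (norm u)\<rceil> \<le> m"
      by (rule eventually_ge_at_top)
    then show "\<forall>\<^sub>F m in sequentially. bounded_part f m u = f u"
    proof (rule eventually_mono)
      fix m assume "nat \<lceil>max (cmod (f u)) (norm u)\<rceil> \<le> m"
      then have "max (cmod (f u)) (norm u) \<le> real m" by linarith
      then show "bounded_part f m u = f u" by (simp add: bounded_part_def)
    qed
  qed
  note dc = L2_dominated_convergence[of "bounded_part f" f 1, OF measurable_bounded_part[OF f] f _ this]
  show "bounded_part f m \<in> L2"
    by (rule dc) (auto simp: bounded_part_def)
  show "(\<lambda>m. L2_norm (\<lambda>u. bounded_part f m u - f u)) \<longlonglongrightarrow> 0"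
    by (rule dc) (auto simp: bounded_part_def)
qed

lemma bounded_part_le: "cmod (bounded_part f m u) \<le> m"
  by (auto simp: bounded_part_def)

lemma bounded_part_integrable:
  assumes f: "f \<in> L2"
  shows "integrable lborel (bounded_part f m)"
proof (rule Bochner_Integration.integrable_bound)
  have "emeasure lborel (cball (0::real\<times>real) m) < \<infinity>"
    using emeasure_lborel_cball_finite[of "0::real\<times>real" "real m"] by (simp add: less_top)
  then show "integrable lborel (\<lambda>u. real m * indicator (cball (0::real\<times>real) m) u)" by simp
  show "bounded_part f m \<in> borel_measurable lborel"
    using measurable_bounded_part[OF f] by simp
  show "AE u in lborel. norm (bounded_part f m u) \<le> norm (real m * indicator (cball (0::real\<times>real) m) u)"
    by (intro AE_I2) (auto simp: bounded_part_def split: split_indicator)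
qed

lemma L2_shift: "f \<in> L2 \<Longrightarrow> (\<lambda>u. f (u - w)) \<in> L2"
  using L2_affine[of f 1 "- w"] by simp

lemma L2_norm_shift: "f \<in> borel_measurable borel \<Longrightarrow> L2_norm (\<lambda>u. f (u - w)) = L2_norm f"
  using L2_norm_affine[of f 1 "- w"] by simp

text \<open>If \<open>g\<close> is bounded by \<open>m\<close>, then |g (u - w) - g u|^2 is at most
  2 m |g (u - w) - g u|, which turns L1 continuity into L2 continuity. Passing to general
  \<open>f\<close> costs twice the truncation error, since shifts preserve the norm.\<close>

theorem L2_shift_continuous:
  assumes f: "f \<in> L2" and w: "w \<longlonglongrightarrow> 0"
  shows "(\<lambda>n. L2_norm (\<lambda>u. f (u - w n) - f u)) \<longlonglongrightarrow> 0"
proof (rule metric_LIMSEQ_I)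
  fix e :: real assume e: "e > 0"
  obtain m where m: "L2_norm (\<lambda>u. bounded_part f m u - f u) < e / 3"
    using LIMSEQ_D[OF bounded_part_tendsto[OF f], of "e / 3"] e by fastforce
  define g where "g = bounded_part f m"
  have g: "g \<in> L2" "integrable lborel g" "\<And>u. cmod (g u) \<le> m"
    by (auto simp: g_def bounded_part_L2[OF f] bounded_part_integrable[OF f] bounded_part_le)
  have gw: "(\<lambda>u. g (u - w n)) \<in> L2" "(\<lambda>u. f (u - w n)) \<in> L2" for n
    by (intro L2_shift g f)+
  have "(\<lambda>n. LINT u|lborel. cmod (g (u - w n) - g u)) \<longlonglongrightarrow> 0"
    using integrable_L1_shift_continuous[OF g(2)] w by (simp add: L1_shift_continuous_def)
  then have "(\<lambda>n. sqrt (2 * m * (LINT u|lborel. cmod (g (u - w n) - g u)))) \<longlonglongrightarrow> sqrt (real (2 * m) * 0)"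
    by (intro tendsto_intros)
  moreover have le: "L2_norm (\<lambda>u. g (u - w n) - g u) \<le> sqrt (2 * m * (LINT u|lborel. cmod (g (u - w n) - g u)))" for n
  proof -
    have "(LINT u|lborel. (cmod (g (u - w n) - g u))\<^sup>2) \<le> (LINT u|lborel. (2 * m) * cmod (g (u - w n) - g u))"
    proof (rule integral_mono)
      show "integrable lborel (\<lambda>u. (cmod (g (u - w n) - g u))\<^sup>2)"
        by (intro L2_integrable L2_diff gw g)
      show "integrable lborel (\<lambda>u. (2 * m) * cmod (g (u - w n) - g u))"
        by (intro integrable_mult_right integrable_norm Bochner_Integration.integrable_diff integrable_shift g)
      fix u
      have "cmod (g (u - w n) - g u) \<le> 2 * m"
        using norm_triangle_ineq4[of "g (u - w n)" "g u"] g(3)[of u] g(3)[of "u - w n"] by linarith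
      then show "(cmod (g (u - w n) - g u))\<^sup>2 \<le> (2 * m) * cmod (g (u - w n) - g u)"
        by (auto simp: power2_eq_square intro!: mult_right_mono)
    qed
    then show ?thesis unfolding L2_norm_def by simp
  qed
  ultimately have "(\<lambda>n. L2_norm (\<lambda>u. g (u - w n) - g u)) \<longlonglongrightarrow> 0"
    by (intro Lim_null_comparison[of "\<lambda>n. L2_norm (\<lambda>u. g (u - w n) - g u)"]) auto
  then obtain N where N: "\<And>n. n \<ge> N \<Longrightarrow> L2_norm (\<lambda>u. g (u - w n) - g u) < e / 3"
    using LIMSEQ_D[of "\<lambda>n. L2_norm (\<lambda>u. g (u - w n) - g u)" 0 "e / 3"] e by fastforce
  have "dist (L2_norm (\<lambda>u. f (u - w n) - f u)) 0 < e" if n: "n \<ge> N" for n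
  proof -
    have "L2_norm (\<lambda>u. f (u - w n) - f u)
        \<le> L2_norm (\<lambda>u. f (u - w n) - g (u - w n)) + L2_norm (\<lambda>u. g (u - w n) - f u)"
      by (intro L2_norm_diff_triangle gw f)
    also have "L2_norm (\<lambda>u. g (u - w n) - f u) \<le> L2_norm (\<lambda>u. g (u - w n) - g u) + L2_norm (\<lambda>u. g u - f u)"
      by (intro L2_norm_diff_triangle gw f g)
    also have "L2_norm (\<lambda>u. f (u - w n) - g (u - w n)) = L2_norm (\<lambda>u. g u - f u)"
      using L2_norm_shift[of "\<lambda>u. f u - g u" "w n"] f g by (simp add: L2_norm_minus[of f g] L2_measurable)
    finally show ?thesis using N[OF n] m by (simp add: g_def)
  qed
  then show "\<exists>N. \<forall>n\<ge>N. dist (L2_norm (\<lambda>u. f (u - w n) - f u)) 0 < e" by blast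
qed

section \<open>Plancherel's theorem on the plane\<close>

lemma borel_measurable_cis [measurable (raw)]:
  "f \<in> borel_measurable M \<Longrightarrow> (\<lambda>x. cis (f x)) \<in> borel_measurable M"
  by (rule measurable_compose[of f M borel cis borel])
     (auto intro!: borel_measurable_continuous_onI continuous_intros)

lemma fourier_integral_cis: "fourier_integral f \<omega> = (LINT u|lborel. f u * cis (u \<bullet> \<omega>))"
  by (simp add: fourier_integral_def cis_conv_exp)

lemma integrable_cis:
  fixes f :: "'a \<Rightarrow> complex"
  assumes "integrable M f" "g \<in> borel_measurable M"
  shows "integrable M (\<lambda>u. f u * cis (g u))"
  by (rule Bochner_Integration.integrable_bound[OF assms(1)]) (use assms in \<open>auto simp: norm_mult\<close>)

lemma
  fixes f :: "'a::euclidean_space \<Rightarrow> complex" and g :: "'b::euclidean_space \<Rightarrow> complex"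
  assumes f: "integrable lborel f" and g: "integrable lborel g"
  shows integrable_pair_mult: "integrable (lborel \<Otimes>\<^sub>M lborel) (\<lambda>p. f (fst p) * g (snd p))"
    and integral_pair_mult: "(LINT p|(lborel \<Otimes>\<^sub>M lborel). f (fst p) * g (snd p)) =
      (LINT x|lborel. f x) * (LINT y|lborel. g y)"
proof -
  have [measurable]: "f \<in> borel_measurable borel" "g \<in> borel_measurable borel"
    using f g by auto
  show *: "integrable (lborel \<Otimes>\<^sub>M lborel) (\<lambda>p. f (fst p) * g (snd p))"
  proof (rule lborel_pair.Fubini_integrable)
    show "integrable lborel (\<lambda>x. LINT y|lborel. norm (f (fst (x, y)) * g (snd (x, y))))"
      using f by (simp add: norm_mult)
    show "AE x in lborel. integrable lborel (\<lambda>y. f (fst (x, y)) * g (snd (x, y)))"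
      using g by simp
  qed measurable
  show "(LINT p|(lborel \<Otimes>\<^sub>M lborel). f (fst p) * g (snd p)) = (LINT x|lborel. f x) * (LINT y|lborel. g y)"
    using lborel_pair.integral_fst'[OF *] by simp
qed

subsection \<open>The Gaussian and its transform\<close>

text \<open>Normalised to total mass 1, so that its rescalings form an approximate identity;
  \<open>2 * pi * gauss2\<close> is 1 at the origin and serves as damping factor on the frequency
  side.\<close>

definition gauss2 :: "real \<times> real \<Rightarrow> real" where
  "gauss2 z = std_normal_density (fst z) * std_normal_density (snd z)"

lemma gauss2_eq: "gauss2 z = exp (- (norm z)\<^sup>2 / 2) / (2 * pi)"
  by (cases z) (simp add: gauss2_def std_normal_density_def norm_Pair exp_add[symmetric] field_simps
        real_sqrt_mult[symmetric] flip: power2_eq_square)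

lemma measurable_gauss2 [measurable]: "gauss2 \<in> borel_measurable borel"
  unfolding gauss2_def by (simp add: borel_prod[symmetric])

lemma gauss2_nonneg: "gauss2 z \<ge> 0"
  by (simp add: gauss2_eq)

lemma std_normal_transform:
  "(LINT x|lborel. complex_of_real (std_normal_density x) * cis (t * x)) = complex_of_real (exp (- t\<^sup>2 / 2))"
proof -
  have "complex_of_real (exp (- t\<^sup>2 / 2)) = char std_normal_distribution t"
    by (simp add: char_std_normal_distribution)
  also have "\<dots> = (LINT x|density lborel std_normal_density. cis (t * x))"
    by (simp add: char_def cis_conv_exp)
  also have "\<dots> = (LINT x|lborel. std_normal_density x *\<^sub>R cis (t * x))"
    by (intro integral_density) (auto simp: normal_density_nonneg)
  finally show ?thesis by (simp add: scaleR_conv_of_real)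
qed

lemma integrable_gauss2: "integrable lborel gauss2"
proof -
  have 1: "integrable lborel (\<lambda>x. complex_of_real (std_normal_density x))"
    by (intro integrable_of_real integrable_normal_density) simp
  have "integrable lborel (\<lambda>z :: real \<times> real. complex_of_real (gauss2 z))"
    using integrable_pair_mult[OF 1 1] by (simp add: lborel_prod gauss2_def)
  then show ?thesis
    using complex_of_real_integrable_eq by blast
qed

lemma gauss2_transform:
  "(LINT z|lborel. complex_of_real (gauss2 z) * cis (z \<bullet> x)) = complex_of_real (2 * pi * gauss2 x)"
proof -
  define g where "g t y = complex_of_real (std_normal_density y) * cis (t * y)" for t y :: real
  have g: "integrable lborel (g t)" for t
    unfolding g_def by (intro integrable_cis integrable_of_real integrable_normal_density) simp_all
  have "(LINT z|lborel. complex_of_real (gauss2 z) * cis (z \<bullet> x))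
      = (LINT z|(lborel \<Otimes>\<^sub>M lborel). g (fst x) (fst z) * g (snd x) (snd z))"
    by (simp add: lborel_prod gauss2_def g_def inner_prod_def cis_mult[symmetric] algebra_simps)
  also have "\<dots> = (LINT y|lborel. g (fst x) y) * (LINT y|lborel. g (snd x) y)"
    by (rule integral_pair_mult[OF g g])
  also have "\<dots> = complex_of_real (exp (- (fst x)\<^sup>2 / 2) * exp (- (snd x)\<^sup>2 / 2))"
    by (simp add: g_def std_normal_transform)
  also have "exp (- (fst x)\<^sup>2 / 2) * exp (- (snd x)\<^sup>2 / 2) = 2 * pi * gauss2 x"
    by (cases x) (simp add: gauss2_eq norm_Pair exp_add[symmetric] field_simps)
  finally show ?thesis .
qed

lemma integral_gauss2: "(LINT z|lborel. gauss2 z) = 1"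
proof -
  have "complex_of_real (LINT z|lborel. gauss2 z) = complex_of_real (2 * pi * gauss2 0)"
    using gauss2_transform[of 0] by simp
  then have "(LINT z|lborel. gauss2 z) = 2 * pi * gauss2 0"
    using of_real_eq_iff by blast
  then show ?thesis by (simp add: gauss2_eq[of 0])
qed

text \<open>As \<open>e\<close> tends to 0, the damping factor tends to 1 and the right side is 4
  pi^2 times an approximate identity of width \<open>e\<close>. This 4 pi^2 is the constant in
  Plancherel's identity for the unnormalised transform.\<close>

lemma gauss2_scaled_transform:
  assumes "e > 0"
  shows "(LINT z|lborel. complex_of_real (2 * pi * gauss2 (e *\<^sub>R z)) * cis (x \<bullet> z))
     = complex_of_real (4 * pi\<^sup>2 / e\<^sup>2 * gauss2 (x /\<^sub>R e))"
proof -
  have "(LINT z|lborel. complex_of_real (gauss2 z) * cis (z \<bullet> (x /\<^sub>R e)))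
      = e\<^sup>2 *\<^sub>R (LINT z|lborel. complex_of_real (gauss2 (e *\<^sub>R z)) * cis (x \<bullet> z))"
    using assms by (subst integral_plane_affine[where c=e and t=0]) (auto simp: inner_commute mult.assoc[symmetric])
  then have "(LINT z|lborel. complex_of_real (gauss2 (e *\<^sub>R z)) * cis (x \<bullet> z))
      = complex_of_real (2 * pi / e\<^sup>2 * gauss2 (x /\<^sub>R e))"
    unfolding gauss2_transform using assms by (simp add: scaleR_conv_of_real field_simps)
  moreover have "(LINT z|lborel. complex_of_real (2 * pi * gauss2 (e *\<^sub>R z)) * cis (x \<bullet> z))
     = complex_of_real (2 * pi) * (LINT z|lborel. complex_of_real (gauss2 (e *\<^sub>R z)) * cis (x \<bullet> z))"
    by (subst integral_mult_right_zero[symmetric]) (simp add: mult.assoc)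
  ultimately show ?thesis by (simp add: power2_eq_square)
qed

subsection \<open>Integrable functions\<close>

lemma measurable_fourier_integral [measurable]:
  assumes [measurable]: "f \<in> borel_measurable borel"
  shows "fourier_integral f \<in> borel_measurable borel"
proof -
  have "(\<lambda>\<omega>. LINT u|lborel. f u * cis (u \<bullet> \<omega>)) \<in> borel_measurable borel"
    by measurable
  then show ?thesis by (simp add: fourier_integral_cis[abs_def])
qed

lemma cmod_fourier_integral_le:
  "cmod (fourier_integral f \<omega>) \<le> (LINT u|lborel. cmod (f u))"
  unfolding fourier_integral_cis
  using integral_norm_bound[of lborel "\<lambda>u. f u * cis (u \<bullet> \<omega>)"] by (simp add: norm_mult)

text \<open>The squared modulus of the transform is a double integral of
  \<open>f u * cnj (f v)\<close> against a character of \<open>u - v\<close>. Damping makes the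
  integral including the frequency absolutely convergent, so the frequency can be integrated out
  first. What remains is the autocorrelation of \<open>f\<close> averaged over shifts of size about
  \<open>e\<close>.\<close>

lemma plancherel_gauss:
  assumes f: "f \<in> L2" "integrable lborel f" and e: "e > 0"
  shows "integrable lborel (\<lambda>\<omega>. (cmod (fourier_integral f \<omega>))\<^sup>2 * (2 * pi * gauss2 (e *\<^sub>R \<omega>)))"
    and "complex_of_real (LINT \<omega>|lborel. (cmod (fourier_integral f \<omega>))\<^sup>2 * (2 * pi * gauss2 (e *\<^sub>R \<omega>)))
      = 4 * pi\<^sup>2 * (LINT z|lborel. complex_of_real (gauss2 z) * L2_inner f (\<lambda>u. f (u - e *\<^sub>R z)))"
proof -
  have [measurable]: "f \<in> borel_measurable borel" using f by auto
  have ig: "integrable lborel (\<lambda>\<omega>. gauss2 (e *\<^sub>R \<omega>))"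
    using integrable_plane_affine[OF integrable_gauss2, of e 0] e by simp
  show "integrable lborel (\<lambda>\<omega>. (cmod (fourier_integral f \<omega>))\<^sup>2 * (2 * pi * gauss2 (e *\<^sub>R \<omega>)))"
  proof (rule Bochner_Integration.integrable_bound)
    show "integrable lborel (\<lambda>\<omega>. (LINT u|lborel. cmod (f u))\<^sup>2 * (2 * pi * gauss2 (e *\<^sub>R \<omega>)))"
      using ig by simp
    show "AE \<omega> in lborel. norm ((cmod (fourier_integral f \<omega>))\<^sup>2 * (2 * pi * gauss2 (e *\<^sub>R \<omega>)))
        \<le> norm ((LINT u|lborel. cmod (f u))\<^sup>2 * (2 * pi * gauss2 (e *\<^sub>R \<omega>)))"
      using cmod_fourier_integral_le[of f] gauss2_nonneg
      by (intro AE_I2) (auto intro!: mult_right_mono power_mono simp: abs_mult)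
  qed measurable
  define h where "h p = f (fst p) * cnj (f (snd p))" for p
  have h: "integrable (lborel \<Otimes>\<^sub>M lborel) h"
    unfolding h_def using integrable_pair_mult[of f "\<lambda>v. cnj (f v)"] f by simp
  then have h': "integrable lborel h" by (simp add: lborel_prod)
  then have [measurable]: "h \<in> borel_measurable borel" by auto
  have sq: "complex_of_real ((cmod (fourier_integral f \<omega>))\<^sup>2)
      = (LINT p|lborel. h p * cis ((fst p - snd p) \<bullet> \<omega>))" for \<omega>
  proof -
    have "complex_of_real ((cmod (fourier_integral f \<omega>))\<^sup>2)
        = (LINT u|lborel. f u * cis (u \<bullet> \<omega>)) * (LINT v|lborel. cnj (f v * cis (v \<bullet> \<omega>)))"
      unfolding complex_norm_square fourier_integral_cis Bochner_Integration.integral_cnj ..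
    also have "\<dots> = (LINT p|(lborel \<Otimes>\<^sub>M lborel). (f (fst p) * cis (fst p \<bullet> \<omega>)) * cnj (f (snd p) * cis (snd p \<bullet> \<omega>)))"
      by (rule integral_pair_mult[symmetric]) (intro integrable_cnj integrable_cis f, measurable)+
    also have "\<dots> = (LINT p|lborel. h p * cis ((fst p - snd p) \<bullet> \<omega>))"
      by (simp add: lborel_prod h_def cis_cnj inner_diff_left cis_mult mult_ac)
    finally show ?thesis .
  qed
  define K where "K x = complex_of_real (4 * pi\<^sup>2 / e\<^sup>2 * gauss2 (x /\<^sub>R e))" for x
  define k where "k \<omega> p = complex_of_real (2 * pi * gauss2 (e *\<^sub>R \<omega>)) * h p * cis ((fst p - snd p) \<bullet> \<omega>)" for \<omega> p
  have [measurable]: "K \<in> borel_measurable borel" unfolding K_def by measurable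
  have ik: "integrable (lborel \<Otimes>\<^sub>M lborel) (case_prod k)"
  proof -
    have "integrable (lborel \<Otimes>\<^sub>M lborel) (\<lambda>q. complex_of_real (2 * pi * gauss2 (e *\<^sub>R fst q)) * h (snd q))"
      using ig h' by (intro integrable_pair_mult) auto
    note gh = integrable_cis[OF this, of "\<lambda>q. (fst (snd q) - snd (snd q)) \<bullet> fst q"]
    have "integrable (lborel \<Otimes>\<^sub>M lborel) (\<lambda>q. complex_of_real (2 * pi * gauss2 (e *\<^sub>R fst q)) * h (snd q)
        * cis ((fst (snd q) - snd (snd q)) \<bullet> fst q))"
    proof (rule gh)
      have "(\<lambda>q :: (real \<times> real) \<times> (real \<times> real) \<times> (real \<times> real). (fst (snd q) - snd (snd q)) \<bullet> fst q)
          \<in> borel_measurable borel"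
        by (intro borel_measurable_continuous_onI continuous_intros)
      then show "(\<lambda>q :: (real \<times> real) \<times> (real \<times> real) \<times> (real \<times> real). (fst (snd q) - snd (snd q)) \<bullet> fst q)
          \<in> borel_measurable (lborel \<Otimes>\<^sub>M lborel)"
        by (simp add: lborel_prod)
    qed
    then show ?thesis by (simp add: k_def case_prod_beta')
  qed
  have "complex_of_real (LINT \<omega>|lborel. (cmod (fourier_integral f \<omega>))\<^sup>2 * (2 * pi * gauss2 (e *\<^sub>R \<omega>)))
      = (LINT \<omega>|lborel. complex_of_real ((cmod (fourier_integral f \<omega>))\<^sup>2) * complex_of_real (2 * pi * gauss2 (e *\<^sub>R \<omega>)))"
    unfolding of_real_mult[symmetric] by (rule integral_complex_of_real[symmetric])
  also have "\<dots> = (LINT \<omega>|lborel. LINT p|lborel. k \<omega> p)"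
    unfolding sq k_def
    by (intro Bochner_Integration.integral_cong refl, subst integral_mult_left_zero[symmetric]) (simp add: mult_ac)
  also have "\<dots> = (LINT p|lborel. LINT \<omega>|lborel. k \<omega> p)"
    by (rule lborel_pair.Fubini_integral[OF ik, symmetric])
  also have "\<dots> = (LINT p|lborel. h p * K (fst p - snd p))"
  proof (intro Bochner_Integration.integral_cong refl)
    fix p
    have "(LINT \<omega>|lborel. k \<omega> p)
        = (LINT \<omega>|lborel. h p * (complex_of_real (2 * pi * gauss2 (e *\<^sub>R \<omega>)) * cis ((fst p - snd p) \<bullet> \<omega>)))"
      by (simp add: k_def mult_ac)
    also have "\<dots> = h p * K (fst p - snd p)"
      unfolding K_def gauss2_scaled_transform[OF e, symmetric] by (rule integral_mult_right_zero)
    finally show "(LINT \<omega>|lborel. k \<omega> p) = h p * K (fst p - snd p)" .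
  qed
  also have "\<dots> = (LINT p|(lborel \<Otimes>\<^sub>M lborel). h p * K (fst p - snd p))"
    by (simp add: lborel_prod)
  also have "\<dots> = (LINT u|lborel. LINT v|lborel. h (u, v) * K (u - v))"
  proof -
    define B where "B = 4 * pi\<^sup>2 / e\<^sup>2 / (2 * pi)"
    have KB: "cmod (K x) \<le> B" for x
    proof -
      have "gauss2 (x /\<^sub>R e) \<le> 1 / (2 * pi)"
        unfolding gauss2_eq by (intro divide_right_mono) auto
      then have "4 * pi\<^sup>2 / e\<^sup>2 * gauss2 (x /\<^sub>R e) \<le> 4 * pi\<^sup>2 / e\<^sup>2 * (1 / (2 * pi))"
        by (intro mult_left_mono) auto
      then show ?thesis
        unfolding K_def norm_of_real B_def using gauss2_nonneg[of "x /\<^sub>R e"] by simp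
    qed
    have "integrable (lborel \<Otimes>\<^sub>M lborel) (\<lambda>p. h p * K (fst p - snd p))"
    proof (rule Bochner_Integration.integrable_bound)
      show "integrable (lborel \<Otimes>\<^sub>M lborel) (\<lambda>p. B *\<^sub>R h p)" using h by simp
      have "B \<ge> 0" by (simp add: B_def)
      then show "AE p in lborel \<Otimes>\<^sub>M lborel. norm (h p * K (fst p - snd p)) \<le> norm (B *\<^sub>R h p)"
        using KB by (intro AE_I2) (auto simp: norm_mult mult.commute intro!: mult_right_mono)
      show "(\<lambda>p. h p * K (fst p - snd p)) \<in> borel_measurable (lborel \<Otimes>\<^sub>M lborel)"
      proof -
        have "(\<lambda>p :: (real \<times> real) \<times> (real \<times> real). fst p - snd p) \<in> borel_measurable borel"
          by (intro borel_measurable_continuous_onI continuous_intros)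
        then have "(\<lambda>p. K (fst p - snd p)) \<in> borel_measurable borel"
          by (rule measurable_compose) measurable
        then have "(\<lambda>p. h p * K (fst p - snd p)) \<in> borel_measurable borel"
          by (intro borel_measurable_times) simp_all
        then show ?thesis by (simp add: lborel_prod)
      qed
    qed
    from lborel_pair.integral_fst'[OF this] show ?thesis by simp
  qed
  also have "\<dots> = (LINT u|lborel. LINT z|lborel. f u * cnj (f (u - e *\<^sub>R z)) * complex_of_real (4 * pi\<^sup>2 * gauss2 z))"
  proof (rule Bochner_Integration.integral_cong[OF refl])
    fix u
    \<comment> \<open>The substitution \<open>v = u - e *\<^sub>R z\<close> contributes e^2, which
      cancels the 1 / e^2 in \<open>K\<close>.\<close>
    have "(LINT v|lborel. h (u, v) * K (u - v)) = e\<^sup>2 *\<^sub>R (LINT z|lborel. h (u, u - e *\<^sub>R z) * K (e *\<^sub>R z))"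
      using e by (subst integral_plane_affine[where c="- e" and t=u]) auto
    also have "\<dots> = (LINT z|lborel. e\<^sup>2 *\<^sub>R (h (u, u - e *\<^sub>R z) * K (e *\<^sub>R z)))"
      by simp
    also have "\<dots> = (LINT z|lborel. f u * cnj (f (u - e *\<^sub>R z)) * complex_of_real (4 * pi\<^sup>2 * gauss2 z))"
      using e by (intro Bochner_Integration.integral_cong refl) (simp add: K_def h_def scaleR_conv_of_real)
    finally show "(LINT v|lborel. h (u, v) * K (u - v))
        = (LINT z|lborel. f u * cnj (f (u - e *\<^sub>R z)) * complex_of_real (4 * pi\<^sup>2 * gauss2 z))" .
  qed
  also have "\<dots> = (LINT z|lborel. LINT u|lborel. f u * cnj (f (u - e *\<^sub>R z)) * complex_of_real (4 * pi\<^sup>2 * gauss2 z))"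
  proof (rule lborel_pair.Fubini_integral)
    show "integrable (lborel \<Otimes>\<^sub>M lborel) (\<lambda>(z, u). f u * cnj (f (u - e *\<^sub>R z)) * complex_of_real (4 * pi\<^sup>2 * gauss2 z))"
    proof (rule lborel_pair.Fubini_integrable)
      show "(\<lambda>(z, u). f u * cnj (f (u - e *\<^sub>R z)) * complex_of_real (4 * pi\<^sup>2 * gauss2 z)) \<in> borel_measurable (lborel \<Otimes>\<^sub>M lborel)"
        by measurable
      show "AE z in lborel. integrable lborel (\<lambda>u. case (z, u) of (z, u) \<Rightarrow> f u * cnj (f (u - e *\<^sub>R z)) * complex_of_real (4 * pi\<^sup>2 * gauss2 z))"
        using L2_mult_integrable[OF f(1) L2_shift[OF f(1)]] by (intro AE_I2) simp
      show "integrable lborel (\<lambda>z. LINT u|lborel. norm (case (z, u) of (z, u) \<Rightarrow> f u * cnj (f (u - e *\<^sub>R z)) * complex_of_real (4 * pi\<^sup>2 * gauss2 z)))"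
      proof (rule Bochner_Integration.integrable_bound)
        show "integrable lborel (\<lambda>z. (L2_norm f)\<^sup>2 * (4 * pi\<^sup>2 * gauss2 z))"
          using integrable_gauss2 by simp
        show "(\<lambda>z. LINT u|lborel. norm (case (z, u) of (z, u) \<Rightarrow> f u * cnj (f (u - e *\<^sub>R z)) * complex_of_real (4 * pi\<^sup>2 * gauss2 z))) \<in> borel_measurable lborel"
          by measurable
        show "AE z in lborel. norm (LINT u|lborel. norm (case (z, u) of (z, u) \<Rightarrow> f u * cnj (f (u - e *\<^sub>R z)) * complex_of_real (4 * pi\<^sup>2 * gauss2 z)))
            \<le> norm ((L2_norm f)\<^sup>2 * (4 * pi\<^sup>2 * gauss2 z))"
        proof (rule AE_I2)
          fix z
          \<comment> \<open>Passing to moduli lets the Cauchy-Schwarz inequality for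
            \<open>L2_inner\<close> bound the integral of |f(u)| |f(u - e z)| uniformly in
            \<open>z\<close>.\<close>
          define af where "af u = complex_of_real (cmod (f u))" for u
          have af: "af \<in> L2" "(\<lambda>u. af (u - e *\<^sub>R z)) \<in> L2"
            using f(1) L2_shift[OF f(1), of "e *\<^sub>R z"] unfolding af_def by (auto simp: L2_def)
          have naf: "L2_norm af = L2_norm f" "L2_norm (\<lambda>u. af (u - e *\<^sub>R z)) = L2_norm f"
            using L2_norm_shift[of f "e *\<^sub>R z"] by (auto simp: L2_norm_def af_def)
          have "complex_of_real (LINT u|lborel. cmod (f u) * cmod (f (u - e *\<^sub>R z))) = L2_inner af (\<lambda>u. af (u - e *\<^sub>R z))"
            unfolding L2_inner_def af_def by (simp flip: of_real_mult)
          then have "\<bar>LINT u|lborel. cmod (f u) * cmod (f (u - e *\<^sub>R z))\<bar> = cmod (L2_inner af (\<lambda>u. af (u - e *\<^sub>R z)))"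
            by (metis norm_of_real)
          also have "\<dots> \<le> (L2_norm f)\<^sup>2"
            using L2_Cauchy_Schwarz[OF af] by (simp add: naf power2_eq_square)
          finally have "\<bar>LINT u|lborel. cmod (f u) * cmod (f (u - e *\<^sub>R z))\<bar> * (4 * pi\<^sup>2 * gauss2 z) \<le> (L2_norm f)\<^sup>2 * (4 * pi\<^sup>2 * gauss2 z)"
            using gauss2_nonneg by (intro mult_right_mono) auto
          then show "norm (LINT u|lborel. norm (case (z, u) of (z, u) \<Rightarrow> f u * cnj (f (u - e *\<^sub>R z)) * complex_of_real (4 * pi\<^sup>2 * gauss2 z)))
            \<le> norm ((L2_norm f)\<^sup>2 * (4 * pi\<^sup>2 * gauss2 z))"
            using gauss2_nonneg[of z] by (simp add: norm_mult norm_power abs_mult)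
        qed
      qed
    qed
  qed
  also have "\<dots> = (LINT z|lborel. 4 * pi\<^sup>2 * (complex_of_real (gauss2 z) * L2_inner f (\<lambda>u. f (u - e *\<^sub>R z))))"
    unfolding L2_inner_def
    by (intro Bochner_Integration.integral_cong refl, subst integral_mult_left_zero) simp
  also have "\<dots> = 4 * pi\<^sup>2 * (LINT z|lborel. complex_of_real (gauss2 z) * L2_inner f (\<lambda>u. f (u - e *\<^sub>R z)))"
    by (rule integral_mult_right_zero)
  finally show "complex_of_real (LINT \<omega>|lborel. (cmod (fourier_integral f \<omega>))\<^sup>2 * (2 * pi * gauss2 (e *\<^sub>R \<omega>)))
      = 4 * pi\<^sup>2 * (LINT z|lborel. complex_of_real (gauss2 z) * L2_inner f (\<lambda>u. f (u - e *\<^sub>R z)))" .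
qed

text \<open>Let \<open>e\<close> tend to 0 in the Gaussian identity. On the right, continuity of
  translation and the unit mass of \<open>gauss2\<close> produce the squared norm of
  \<open>f\<close>. On the left the damping increases to 1, so monotone convergence yields the norm
  of the transform together with its finiteness.\<close>

theorem plancherel_integrable:
  assumes f: "f \<in> L2" "integrable lborel f"
  shows "fourier_integral f \<in> L2" "(L2_norm (fourier_integral f))\<^sup>2 = 4 * pi\<^sup>2 * (L2_norm f)\<^sup>2"
proof -
  have [measurable]: "f \<in> borel_measurable borel" using f by auto
  define e where "e n = 1 / real (Suc n)" for n
  have e: "e n > 0" "e \<longlonglongrightarrow> 0" "e (Suc n) \<le> e n" for n
    using LIMSEQ_inverse_real_of_nat by (auto simp: e_def[abs_def] frac_le inverse_eq_divide)
  define J where "J n = (LINT \<omega>|lborel. (cmod (fourier_integral f \<omega>))\<^sup>2 * (2 * pi * gauss2 (e n *\<^sub>R \<omega>)))" for n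
  have gE: "2 * pi * gauss2 (e n *\<^sub>R \<omega>) = exp (- ((e n)\<^sup>2 * (norm \<omega>)\<^sup>2) / 2)" for n \<omega>
    by (simp add: gauss2_eq power_mult_distrib)
  have lim: "(\<lambda>n. LINT z|lborel. complex_of_real (gauss2 z) * L2_inner f (\<lambda>u. f (u - e n *\<^sub>R z)))
      \<longlonglongrightarrow> (LINT z|lborel. complex_of_real (gauss2 z) * complex_of_real ((L2_norm f)\<^sup>2))"
  proof (rule integral_dominated_convergence[where w="\<lambda>z. gauss2 z * (L2_norm f)\<^sup>2"])
    show "integrable lborel (\<lambda>z. gauss2 z * (L2_norm f)\<^sup>2)"
      using integrable_gauss2 by simp
    show "AE z in lborel. norm (complex_of_real (gauss2 z) * L2_inner f (\<lambda>u. f (u - e n *\<^sub>R z))) \<le> gauss2 z * (L2_norm f)\<^sup>2" for n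
    proof (rule AE_I2)
      fix z
      have "cmod (L2_inner f (\<lambda>u. f (u - e n *\<^sub>R z))) \<le> (L2_norm f)\<^sup>2"
        using L2_Cauchy_Schwarz[OF f(1) L2_shift[OF f(1)], of "e n *\<^sub>R z"]
        by (simp add: L2_norm_shift power2_eq_square)
      then show "norm (complex_of_real (gauss2 z) * L2_inner f (\<lambda>u. f (u - e n *\<^sub>R z))) \<le> gauss2 z * (L2_norm f)\<^sup>2"
        using gauss2_nonneg[of z] by (simp add: norm_mult mult_left_mono)
    qed
    show "AE z in lborel. (\<lambda>n. complex_of_real (gauss2 z) * L2_inner f (\<lambda>u. f (u - e n *\<^sub>R z)))
        \<longlonglongrightarrow> complex_of_real (gauss2 z) * complex_of_real ((L2_norm f)\<^sup>2)"
    proof (rule AE_I2)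
      fix z :: "real \<times> real"
      have "(\<lambda>n. e n *\<^sub>R z) \<longlonglongrightarrow> 0 *\<^sub>R z" by (intro tendsto_intros e)
      then have "(\<lambda>n. L2_norm (\<lambda>u. f (u - e n *\<^sub>R z) - f u)) \<longlonglongrightarrow> 0"
        using L2_shift_continuous[OF f(1)] by simp
      from tendsto_cnj[OF tendsto_L2_inner[OF L2_shift[OF f(1)] f(1) f(1) this]]
      have "(\<lambda>n. L2_inner f (\<lambda>u. f (u - e n *\<^sub>R z))) \<longlonglongrightarrow> complex_of_real ((L2_norm f)\<^sup>2)"
        by (simp add: L2_inner_self flip: L2_inner_commute)
      then show "(\<lambda>n. complex_of_real (gauss2 z) * L2_inner f (\<lambda>u. f (u - e n *\<^sub>R z)))
        \<longlonglongrightarrow> complex_of_real (gauss2 z) * complex_of_real ((L2_norm f)\<^sup>2)"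
        by (intro tendsto_intros)
    qed
    show "(\<lambda>z. complex_of_real (gauss2 z) * L2_inner f (\<lambda>u. f (u - e n *\<^sub>R z))) \<in> borel_measurable lborel" for n
      unfolding L2_inner_def by measurable
  qed measurable
  have "(LINT z|lborel. complex_of_real (gauss2 z) * complex_of_real ((L2_norm f)\<^sup>2)) = complex_of_real ((L2_norm f)\<^sup>2)"
    by (subst integral_mult_left_zero) (simp add: integral_gauss2)
  from tendsto_mult_left[OF lim[unfolded this], of "4 * pi\<^sup>2"]
  have "(\<lambda>n. complex_of_real (J n)) \<longlonglongrightarrow> complex_of_real (4 * pi\<^sup>2 * (L2_norm f)\<^sup>2)"
    unfolding J_def plancherel_gauss(2)[OF f e(1)] by simp
  then have J: "J \<longlonglongrightarrow> 4 * pi\<^sup>2 * (L2_norm f)\<^sup>2"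
    using tendsto_of_real_iff by blast
  have "(\<lambda>n. \<integral>\<^sup>+\<omega>. ennreal ((cmod (fourier_integral f \<omega>))\<^sup>2 * (2 * pi * gauss2 (e n *\<^sub>R \<omega>))) \<partial>lborel)
      \<longlonglongrightarrow> L2_mass (fourier_integral f)"
    unfolding L2_mass_def
  proof (rule nn_integral_LIMSEQ)
    show "incseq (\<lambda>n \<omega>. ennreal ((cmod (fourier_integral f \<omega>))\<^sup>2 * (2 * pi * gauss2 (e n *\<^sub>R \<omega>))))"
    proof (rule incseq_SucI, rule le_funI)
      fix n and \<omega> :: "real \<times> real"
      have "(e (Suc n))\<^sup>2 * (norm \<omega>)\<^sup>2 \<le> (e n)\<^sup>2 * (norm \<omega>)\<^sup>2"
        using e(1)[of "Suc n"] e(3)[of n] by (intro mult_right_mono power_mono) auto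
      then show "ennreal ((cmod (fourier_integral f \<omega>))\<^sup>2 * (2 * pi * gauss2 (e n *\<^sub>R \<omega>)))
          \<le> ennreal ((cmod (fourier_integral f \<omega>))\<^sup>2 * (2 * pi * gauss2 (e (Suc n) *\<^sub>R \<omega>)))"
        unfolding gE by (intro ennreal_leI mult_left_mono) auto
    qed
    show "(\<lambda>n. ennreal ((cmod (fourier_integral f \<omega>))\<^sup>2 * (2 * pi * gauss2 (e n *\<^sub>R \<omega>))))
        \<longlonglongrightarrow> ennreal ((cmod (fourier_integral f \<omega>))\<^sup>2)" for \<omega>
    proof -
      have "(\<lambda>n. (cmod (fourier_integral f \<omega>))\<^sup>2 * exp (- ((e n)\<^sup>2 * (norm \<omega>)\<^sup>2) / 2))
          \<longlonglongrightarrow> (cmod (fourier_integral f \<omega>))\<^sup>2 * exp (- (0\<^sup>2 * (norm \<omega>)\<^sup>2) / 2)"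
        by (intro tendsto_intros e) simp
      then show ?thesis unfolding gE by (intro tendsto_ennrealI) simp
    qed
  qed measurable
  moreover have "(\<integral>\<^sup>+\<omega>. ennreal ((cmod (fourier_integral f \<omega>))\<^sup>2 * (2 * pi * gauss2 (e n *\<^sub>R \<omega>))) \<partial>lborel) = ennreal (J n)" for n
    unfolding J_def using plancherel_gauss(1)[OF f e(1)] gauss2_nonneg by (intro nn_integral_eq_integral) auto
  ultimately have "(\<lambda>n. ennreal (J n)) \<longlonglongrightarrow> L2_mass (fourier_integral f)" by simp
  then have mass: "L2_mass (fourier_integral f) = ennreal (4 * pi\<^sup>2 * (L2_norm f)\<^sup>2)"
    using LIMSEQ_unique tendsto_ennrealI[OF J] by blast
  show L2: "fourier_integral f \<in> L2"
    by (rule L2I) (auto simp: mass)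
  show "(L2_norm (fourier_integral f))\<^sup>2 = 4 * pi\<^sup>2 * (L2_norm f)\<^sup>2"
    using mass by (simp add: L2_mass_eq[OF L2] ennreal_inj)
qed

subsection \<open>The Fourier transform of square-integrable functions\<close>

lemma L2_norm_cong_cmod: "(\<And>u. cmod (f u) = cmod (g u)) \<Longrightarrow> L2_norm f = L2_norm g"
  by (simp add: L2_norm_def)

lemma L2_norm_scale: "L2_norm (\<lambda>u. c * f u) = cmod c * L2_norm f"
  by (simp add: L2_norm_def norm_mult power_mult_distrib real_sqrt_mult)

lemma L2_norm_zero: "L2_norm (\<lambda>u. 0) = 0"
  by (simp add: L2_norm_def)

lemma fourier_integral_add:
  assumes "integrable lborel f" "integrable lborel g"
  shows "fourier_integral (\<lambda>u. f u + g u) \<omega> = fourier_integral f \<omega> + fourier_integral g \<omega>"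
  unfolding fourier_integral_cis
  by (subst Bochner_Integration.integral_add[symmetric])
     (use assms in \<open>auto intro!: integrable_cis simp: algebra_simps\<close>)

lemma fourier_integral_scale: "fourier_integral (\<lambda>u. c * f u) \<omega> = c * fourier_integral f \<omega>"
  unfolding fourier_integral_cis by (simp add: mult.assoc)

lemma fourier_integral_affine:
  assumes [measurable]: "f \<in> borel_measurable borel" and c: "c > 0"
  shows "fourier_integral (\<lambda>u. f (c *\<^sub>R u - v)) \<omega>
    = complex_of_real (1 / c\<^sup>2) * cis (v \<bullet> \<omega> / c) * fourier_integral f (\<omega> /\<^sub>R c)"
proof -
  have "(LINT y|lborel. f y * cis ((y + v) \<bullet> (\<omega> /\<^sub>R c)))
      = c\<^sup>2 *\<^sub>R (LINT u|lborel. f (c *\<^sub>R u - v) * cis (u \<bullet> \<omega>))"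
    using c by (subst integral_plane_affine[where c=c and t="- v"]) (auto simp: mult.assoc[symmetric])
  also have "(LINT y|lborel. f y * cis ((y + v) \<bullet> (\<omega> /\<^sub>R c)))
      = (LINT y|lborel. cis (v \<bullet> \<omega> / c) * (f y * cis (y \<bullet> (\<omega> /\<^sub>R c))))"
    by (simp add: inner_add_left cis_mult divide_inverse distrib_left mult_ac add_ac)
  also have "\<dots> = cis (v \<bullet> \<omega> / c) * fourier_integral f (\<omega> /\<^sub>R c)"
    unfolding fourier_integral_cis by (rule integral_mult_right_zero)
  finally show ?thesis
    unfolding fourier_integral_cis using c by (simp add: scaleR_conv_of_real field_simps)
qed

text \<open>Membership is carried along with the limit because \<open>L2_norm\<close> of a
  non-member says nothing; this lets the closure rules below compose.\<close>

definition L2_seq_tendsto :: "(nat \<Rightarrow> plane_fun) \<Rightarrow> plane_fun \<Rightarrow> bool" where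
  "L2_seq_tendsto F f \<longleftrightarrow> (\<forall>n. F n \<in> L2) \<and> f \<in> L2 \<and> (\<lambda>n. L2_norm (\<lambda>u. F n u - f u)) \<longlonglongrightarrow> 0"

lemma L2_seq_tendsto_norm: "L2_seq_tendsto F f \<Longrightarrow> (\<lambda>n. L2_norm (F n)) \<longlonglongrightarrow> L2_norm f"
  unfolding L2_seq_tendsto_def by (blast intro: tendsto_L2_norm)

lemma L2_seq_tendsto_add:
  assumes "L2_seq_tendsto F f" "L2_seq_tendsto G g"
  shows "L2_seq_tendsto (\<lambda>n u. F n u + G n u) (\<lambda>u. f u + g u)"
  unfolding L2_seq_tendsto_def
proof (intro conjI allI)
  have F: "F n \<in> L2" "G n \<in> L2" "f \<in> L2" "g \<in> L2" for n
    using assms by (auto simp: L2_seq_tendsto_def)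
  show "(\<lambda>u. F n u + G n u) \<in> L2" "(\<lambda>u. f u + g u) \<in> L2" for n
    by (intro L2_add F)+
  show "(\<lambda>n. L2_norm (\<lambda>u. (F n u + G n u) - (f u + g u))) \<longlonglongrightarrow> 0"
  proof (rule Lim_null_comparison)
    show "\<forall>\<^sub>F n in sequentially. norm (L2_norm (\<lambda>u. (F n u + G n u) - (f u + g u)))
        \<le> L2_norm (\<lambda>u. F n u - f u) + L2_norm (\<lambda>u. G n u - g u)"
    proof (rule always_eventually, rule allI)
      fix n
      show "norm (L2_norm (\<lambda>u. (F n u + G n u) - (f u + g u)))
        \<le> L2_norm (\<lambda>u. F n u - f u) + L2_norm (\<lambda>u. G n u - g u)"
        using L2_norm_triangle[OF L2_diff[OF F(1,3)] L2_diff[OF F(2,4)], of n n]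
        by (simp add: algebra_simps)
    qed
    show "(\<lambda>n. L2_norm (\<lambda>u. F n u - f u) + L2_norm (\<lambda>u. G n u - g u)) \<longlonglongrightarrow> 0"
      using assms by (intro tendsto_add_zero) (auto simp: L2_seq_tendsto_def)
  qed
qed

lemma L2_seq_tendsto_scale:
  assumes "L2_seq_tendsto F f"
  shows "L2_seq_tendsto (\<lambda>n u. c * F n u) (\<lambda>u. c * f u)"
  using assms tendsto_mult_left[of "\<lambda>n. L2_norm (\<lambda>u. F n u - f u)" 0 sequentially "cmod c"]
  unfolding L2_seq_tendsto_def
  by (auto simp: L2_scale right_diff_distrib[symmetric] L2_norm_scale)

lemma L2_seq_tendsto_affine:
  assumes "L2_seq_tendsto F f" "c \<noteq> 0"
  shows "L2_seq_tendsto (\<lambda>n u. F n (t + c *\<^sub>R u)) (\<lambda>u. f (t + c *\<^sub>R u))"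
proof -
  have F: "F n \<in> L2" "f \<in> L2" for n
    using assms by (auto simp: L2_seq_tendsto_def)
  have "L2_norm (\<lambda>u. F n (t + c *\<^sub>R u) - f (t + c *\<^sub>R u)) = (1 / \<bar>c\<bar>) * L2_norm (\<lambda>u. F n u - f u)" for n
    using L2_norm_affine[of "\<lambda>u. F n u - f u" c t] assms(2) L2_measurable[OF L2_diff[OF F]] by simp
  then show ?thesis
    using assms tendsto_mult_left[of "\<lambda>n. L2_norm (\<lambda>u. F n u - f u)" 0 sequentially "1 / \<bar>c\<bar>"]
    unfolding L2_seq_tendsto_def by (auto simp: L2_affine)
qed

lemma L2_unimodular:
  assumes "f \<in> L2" "h \<in> borel_measurable borel"
  shows "(\<lambda>u. cis (h u) * f u) \<in> L2"
  using assms by (intro L2_bounded_mult) auto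

lemma L2_seq_tendsto_unimodular:
  assumes "L2_seq_tendsto F f" "h \<in> borel_measurable borel"
  shows "L2_seq_tendsto (\<lambda>n u. cis (h u) * F n u) (\<lambda>u. cis (h u) * f u)"
proof -
  have "L2_norm (\<lambda>u. cis (h u) * F n u - cis (h u) * f u) = L2_norm (\<lambda>u. F n u - f u)" for n
    by (rule L2_norm_cong_cmod) (simp add: right_diff_distrib[symmetric] norm_mult)
  then show ?thesis using assms unfolding L2_seq_tendsto_def by (auto intro: L2_unimodular)
qed

text \<open>Convergence of extended integrals and of norms are interchangeable for members of
  \<open>L2\<close>, and the transforms of the approximants are members by Plancherel's
  theorem.\<close>

lemma has_fourier_L2_alt:
  "has_fourier_L2 f g \<longleftrightarrow> (\<exists>F. (\<forall>n. F n \<in> L2 \<and> integrable lborel (F n)) \<and>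
      L2_seq_tendsto F f \<and> L2_seq_tendsto (\<lambda>n. fourier_integral (F n)) g)"
proof -
  have "tendsto_L2 F f \<and> tendsto_L2 (\<lambda>n. fourier_integral (F n)) g \<longleftrightarrow>
      L2_seq_tendsto F f \<and> L2_seq_tendsto (\<lambda>n. fourier_integral (F n)) g"
    if "\<forall>n. F n \<in> L2 \<and> integrable lborel (F n)" "f \<in> L2" "g \<in> L2" for F
    using that tendsto_L2_iff[of F f] tendsto_L2_iff[of "\<lambda>n. fourier_integral (F n)" g]
    by (simp add: L2_seq_tendsto_def plancherel_integrable(1))
  moreover have "f \<in> L2" "g \<in> L2" if "L2_seq_tendsto F f" "L2_seq_tendsto (\<lambda>n. fourier_integral (F n)) g" for F
    using that by (auto simp: L2_seq_tendsto_def)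
  ultimately show ?thesis unfolding has_fourier_L2_def by blast
qed

lemma has_fourier_L2_L2: "has_fourier_L2 f g \<Longrightarrow> f \<in> L2" "has_fourier_L2 f g \<Longrightarrow> g \<in> L2"
  by (auto simp: has_fourier_L2_def)

lemma has_fourier_L2_integrable:
  assumes "f \<in> L2" "integrable lborel f"
  shows "has_fourier_L2 f (fourier_integral f)"
  unfolding has_fourier_L2_alt
  by (rule exI[of _ "\<lambda>n. f"]) (use assms plancherel_integrable(1) in \<open>auto simp: L2_seq_tendsto_def L2_norm_zero\<close>)

theorem plancherel_L2:
  assumes "has_fourier_L2 f g"
  shows "(L2_norm g)\<^sup>2 = 4 * pi\<^sup>2 * (L2_norm f)\<^sup>2"
proof -
  obtain F where F: "\<And>n. F n \<in> L2" "\<And>n. integrable lborel (F n)" "L2_seq_tendsto F f"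
      "L2_seq_tendsto (\<lambda>n. fourier_integral (F n)) g"
    using assms unfolding has_fourier_L2_alt by blast
  have "(\<lambda>n. (L2_norm (fourier_integral (F n)))\<^sup>2) \<longlonglongrightarrow> (L2_norm g)\<^sup>2"
    by (intro tendsto_power L2_seq_tendsto_norm F)
  moreover have "(\<lambda>n. 4 * pi\<^sup>2 * (L2_norm (F n))\<^sup>2) \<longlonglongrightarrow> 4 * pi\<^sup>2 * (L2_norm f)\<^sup>2"
    by (intro tendsto_intros L2_seq_tendsto_norm F)
  ultimately show ?thesis
    unfolding plancherel_integrable(2)[OF F(1,2)] by (rule LIMSEQ_unique)
qed

lemma has_fourier_L2_add:
  assumes "has_fourier_L2 f g" "has_fourier_L2 f' g'"
  shows "has_fourier_L2 (\<lambda>u. f u + f' u) (\<lambda>\<omega>. g \<omega> + g' \<omega>)"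
proof -
  obtain F F' where F: "\<And>n. F n \<in> L2" "\<And>n. integrable lborel (F n)" "L2_seq_tendsto F f"
      "L2_seq_tendsto (\<lambda>n. fourier_integral (F n)) g"
    and F': "\<And>n. F' n \<in> L2" "\<And>n. integrable lborel (F' n)" "L2_seq_tendsto F' f'"
      "L2_seq_tendsto (\<lambda>n. fourier_integral (F' n)) g'"
    using assms unfolding has_fourier_L2_alt by blast
  have eq: "fourier_integral (\<lambda>u. F n u + F' n u) = (\<lambda>\<omega>. fourier_integral (F n) \<omega> + fourier_integral (F' n) \<omega>)" for n
    using fourier_integral_add[OF F(2) F'(2)] by blast
  show ?thesis
    unfolding has_fourier_L2_alt
  proof (intro exI[of _ "\<lambda>n u. F n u + F' n u"] conjI allI)
    show "L2_seq_tendsto (\<lambda>n. fourier_integral (\<lambda>u. F n u + F' n u)) (\<lambda>\<omega>. g \<omega> + g' \<omega>)"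
      unfolding eq by (intro L2_seq_tendsto_add F F')
  qed (intro L2_add L2_seq_tendsto_add Bochner_Integration.integrable_add F F')+
qed

lemma has_fourier_L2_scale:
  assumes "has_fourier_L2 f g"
  shows "has_fourier_L2 (\<lambda>u. c * f u) (\<lambda>\<omega>. c * g \<omega>)"
proof -
  obtain F where F: "\<And>n. F n \<in> L2" "\<And>n. integrable lborel (F n)" "L2_seq_tendsto F f"
      "L2_seq_tendsto (\<lambda>n. fourier_integral (F n)) g"
    using assms unfolding has_fourier_L2_alt by blast
  have eq: "fourier_integral (\<lambda>u. c * F n u) = (\<lambda>\<omega>. c * fourier_integral (F n) \<omega>)" for n
    using fourier_integral_scale by blast
  show ?thesis
    unfolding has_fourier_L2_alt
  proof (intro exI[of _ "\<lambda>n u. c * F n u"] conjI allI)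
    show "L2_seq_tendsto (\<lambda>n. fourier_integral (\<lambda>u. c * F n u)) (\<lambda>\<omega>. c * g \<omega>)"
      unfolding eq by (intro L2_seq_tendsto_scale F)
  qed (intro L2_scale L2_seq_tendsto_scale integrable_mult_right F)+
qed

lemma has_fourier_L2_zero: "has_fourier_L2 (\<lambda>u. 0) (\<lambda>\<omega>. 0)"
  using has_fourier_L2_integrable[OF L2_zero] by (simp add: fourier_integral_def[abs_def])

lemma has_fourier_L2_sum:
  assumes "finite K" "\<And>k. k \<in> K \<Longrightarrow> has_fourier_L2 (f k) (g k)"
  shows "has_fourier_L2 (\<lambda>u. \<Sum>k\<in>K. f k u) (\<lambda>\<omega>. \<Sum>k\<in>K. g k \<omega>)"
  using assms
  by (induction K rule: finite_induct) (auto simp: has_fourier_L2_zero intro!: has_fourier_L2_add)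

lemma has_fourier_L2_affine:
  assumes "has_fourier_L2 f g" and c: "c > 0"
  shows "has_fourier_L2 (\<lambda>u. f (c *\<^sub>R u - v))
    (\<lambda>\<omega>. complex_of_real (1 / c\<^sup>2) * (cis (v \<bullet> \<omega> / c) * g (\<omega> /\<^sub>R c)))"
proof -
  obtain F where F: "\<And>n. F n \<in> L2" "\<And>n. integrable lborel (F n)" "L2_seq_tendsto F f"
      "L2_seq_tendsto (\<lambda>n. fourier_integral (F n)) g"
    using assms unfolding has_fourier_L2_alt by blast
  have eq: "fourier_integral (\<lambda>u. F n (c *\<^sub>R u - v)) =
      (\<lambda>\<omega>. complex_of_real (1 / c\<^sup>2) * (cis (v \<bullet> \<omega> / c) * fourier_integral (F n) (\<omega> /\<^sub>R c)))" for n
    by (rule ext) (simp only: fourier_integral_affine[OF L2_measurable[OF F(1)] c] mult.assoc)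
  have T: "L2_seq_tendsto (\<lambda>n u. F n (c *\<^sub>R u - v)) (\<lambda>u. f (c *\<^sub>R u - v))"
    using L2_seq_tendsto_affine[OF F(3), of c "- v"] c by simp
  show ?thesis
    unfolding has_fourier_L2_alt
  proof (intro exI[of _ "\<lambda>n u. F n (c *\<^sub>R u - v)"] conjI allI)
    show "(\<lambda>u. F n (c *\<^sub>R u - v)) \<in> L2" for n
      using T by (simp add: L2_seq_tendsto_def)
    show "integrable lborel (\<lambda>u. F n (c *\<^sub>R u - v))" for n
      using integrable_plane_affine[OF F(2)[of n], of c "- v"] c by simp
    have "L2_seq_tendsto (\<lambda>n \<omega>. fourier_integral (F n) (\<omega> /\<^sub>R c)) (\<lambda>\<omega>. g (\<omega> /\<^sub>R c))"
      using L2_seq_tendsto_affine[OF F(4), of "inverse c" 0] c by simp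
    then show "L2_seq_tendsto (\<lambda>n. fourier_integral (\<lambda>u. F n (c *\<^sub>R u - v)))
       (\<lambda>\<omega>. complex_of_real (1 / c\<^sup>2) * (cis (v \<bullet> \<omega> / c) * g (\<omega> /\<^sub>R c)))"
      unfolding eq by (intro L2_seq_tendsto_scale L2_seq_tendsto_unimodular) measurable
  qed (rule T)
qed

lemma has_fourier_L2_shift:
  assumes "has_fourier_L2 f g"
  shows "has_fourier_L2 (\<lambda>u. f (u - v)) (\<lambda>\<omega>. cis (v \<bullet> \<omega>) * g \<omega>)"
  using has_fourier_L2_affine[OF assms, of 1 v] by simp

text \<open>Polarization: compare the cross terms in Plancherel's identity for
  \<open>f + c f'\<close>; \<open>c = 1\<close> yields the real part and \<open>c = \<i>\<close> the
  imaginary part.\<close>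

theorem parseval_L2:
  assumes f: "has_fourier_L2 f g" and f': "has_fourier_L2 f' g'"
  shows "L2_inner g g' = 4 * pi\<^sup>2 * L2_inner f f'"
proof -
  note L2 = has_fourier_L2_L2[OF f] has_fourier_L2_L2[OF f']
  have Re: "Re (cnj c * L2_inner g g') = 4 * pi\<^sup>2 * Re (cnj c * L2_inner f f')" for c
  proof -
    note cf = has_fourier_L2_scale[OF f', of c]
    have "(L2_norm (\<lambda>\<omega>. g \<omega> + c * g' \<omega>))\<^sup>2 = 4 * pi\<^sup>2 * (L2_norm (\<lambda>u. f u + c * f' u))\<^sup>2"
      by (intro plancherel_L2 has_fourier_L2_add f cf)
    then have "(L2_norm g)\<^sup>2 + (L2_norm (\<lambda>u. c * g' u))\<^sup>2 + 2 * Re (cnj c * L2_inner g g')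
        = 4 * pi\<^sup>2 * ((L2_norm f)\<^sup>2 + (L2_norm (\<lambda>u. c * f' u))\<^sup>2 + 2 * Re (cnj c * L2_inner f f'))"
      using L2_norm_add_sq[OF L2(1) has_fourier_L2_L2(1)[OF cf]] L2_norm_add_sq[OF L2(2) has_fourier_L2_L2(2)[OF cf]]
      by (simp add: L2_inner_scale_right)
    then show ?thesis
      unfolding plancherel_L2[OF f] plancherel_L2[OF cf] by (simp add: distrib_left)
  qed
  show ?thesis
    using Re[of 1] Re[of \<i>] by (intro complex_eqI) auto
qed

text \<open>The difference has transform 0 and hence norm 0. In this way a product formula on the
  frequency side becomes a refinement equation almost everywhere.\<close>

lemma has_fourier_L2_unique:
  assumes "has_fourier_L2 f g" "has_fourier_L2 f' g"
  shows "AE u in lborel. f u = f' u"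
proof -
  have h: "has_fourier_L2 (\<lambda>u. f u + (-1) * f' u) (\<lambda>\<omega>. g \<omega> + (-1) * g \<omega>)"
    by (intro has_fourier_L2_add has_fourier_L2_scale assms)
  have "(L2_norm (\<lambda>u. f u + (-1) * f' u))\<^sup>2 = 0"
    using plancherel_L2[OF h] by (simp add: L2_norm_zero)
  then have "AE u in lborel. f u + (-1) * f' u = 0"
    using L2_norm_zero_iff[OF has_fourier_L2_L2(1)[OF h]] by simp
  then show ?thesis by (rule AE_mp) auto
qed

section \<open>Periodization and dilation\<close>

text \<open>Links two notions of sum: integrals over the counting measure admit infinite values and
  give Fatou and Tonelli, while \<open>infsum\<close> and \<open>has_sum\<close> are the language of
  the frame property.\<close>

lemma
  fixes f :: "'a \<Rightarrow> real"
  assumes nonneg: "\<And>k. f k \<ge> 0"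
  shows nn_integral_count_space_infsum:
      "f summable_on UNIV \<Longrightarrow> (\<integral>\<^sup>+k. ennreal (f k) \<partial>count_space UNIV) = ennreal (infsum f UNIV)"
    and summable_on_if_nn_integral_finite:
      "(\<integral>\<^sup>+k. ennreal (f k) \<partial>count_space UNIV) < \<infinity> \<Longrightarrow> f summable_on UNIV"
proof -
  have abs: "f summable_on UNIV \<longleftrightarrow> integrable (count_space UNIV) f"
    using abs_summable_equivalent[of f UNIV] summable_on_iff_abs_summable_on_real[of f UNIV]
    unfolding Infinite_Set_Sum.abs_summable_on_def by simp
  show "(\<integral>\<^sup>+k. ennreal (f k) \<partial>count_space UNIV) = ennreal (infsum f UNIV)" if "f summable_on UNIV"
  proof -
    have i: "integrable (count_space UNIV) f" using that abs by simp
    then have "infsum f UNIV = infsetsum f UNIV"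
      using infsetsum_infsum[of f UNIV] by (simp add: Infinite_Set_Sum.abs_summable_on_def)
    then show ?thesis
      using nn_integral_eq_integral[OF i] nonneg by (simp add: infsetsum_def)
  qed
  show "f summable_on UNIV" if "(\<integral>\<^sup>+k. ennreal (f k) \<partial>count_space UNIV) < \<infinity>"
    unfolding abs integrable_iff_bounded using that nonneg by simp
qed

text \<open>Half-open, so that the integer translates tile the plane exactly. The corner is 0 for
  averaging over shifts and -1/2 where the origin has to be an interior point of the tile.\<close>

definition unit_square :: "real \<Rightarrow> (real \<times> real) set" where
  "unit_square c = {c..<c + 1} \<times> {c..<c + 1}"

lemma measurable_unit_square [measurable]: "unit_square c \<in> sets borel"
  unfolding unit_square_def borel_prod[symmetric] by measurable

lemma emeasure_unit_square: "emeasure lborel (unit_square c) = 1"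
  unfolding unit_square_def lborel_prod[symmetric]
  by (subst lborel.emeasure_pair_measure_Times) auto

lemma unit_square_tiling: "\<exists>!k. x - lattice_point k \<in> unit_square c"
proof -
  have 1: "(c \<le> t - real_of_int m \<and> t - real_of_int m < c + 1) \<longleftrightarrow> m = \<lfloor>t - c\<rfloor>" for t m
    by linarith
  have "x - lattice_point k \<in> unit_square c \<longleftrightarrow> k = (\<lfloor>fst x - c\<rfloor>, \<lfloor>snd x - c\<rfloor>)" for k
    using 1[of "fst x" "fst k"] 1[of "snd x" "snd k"]
    by (cases x; cases k) (auto simp: lattice_point_def unit_square_def)
  then show ?thesis by simp
qed

text \<open>The indicators of all translated tiles sum to 1; insert that sum and exchange it with
  the integral by Tonelli.\<close>

lemma nn_integral_fold:
  fixes F :: "real \<times> real \<Rightarrow> ennreal"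
  assumes [measurable]: "F \<in> borel_measurable borel"
  shows "(\<integral>\<^sup>+x. F x \<partial>lborel) =
    (\<integral>\<^sup>+k. \<integral>\<^sup>+x. F (x + lattice_point k) * indicator (unit_square c) x \<partial>lborel \<partial>count_space UNIV)"
proof -
  have one: "(\<integral>\<^sup>+k. indicator (unit_square c) (x - lattice_point k) \<partial>count_space UNIV) = (1::ennreal)" for x
  proof -
    obtain k0 where k0: "\<And>k. x - lattice_point k \<in> unit_square c \<longleftrightarrow> k = k0"
      using unit_square_tiling[of x c] by metis
    have "(\<integral>\<^sup>+k. indicator (unit_square c) (x - lattice_point k) \<partial>count_space UNIV)
        = (\<Sum>k\<in>{k0}. indicator (unit_square c) (x - lattice_point k) :: ennreal)"
      by (rule nn_integral_count_space') (auto simp: k0 indicator_def)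
    then show ?thesis using k0 by simp
  qed
  have "(\<integral>\<^sup>+x. F x \<partial>lborel)
      = (\<integral>\<^sup>+x. \<integral>\<^sup>+k. F x * indicator (unit_square c) (x - lattice_point k) \<partial>count_space UNIV \<partial>lborel)"
    by (simp add: nn_integral_cmult one)
  also have "\<dots> = (\<integral>\<^sup>+k. \<integral>\<^sup>+x. F x * indicator (unit_square c) (x - lattice_point k) \<partial>lborel \<partial>count_space UNIV)"
    by (rule nn_integral_count_space_nn_integral) simp_all
  also have "\<dots> = (\<integral>\<^sup>+k. \<integral>\<^sup>+x. F (x + lattice_point k) * indicator (unit_square c) x \<partial>lborel \<partial>count_space UNIV)"
  proof (rule nn_integral_cong)
    fix k
    show "(\<integral>\<^sup>+x. F x * indicator (unit_square c) (x - lattice_point k) \<partial>lborel)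
        = (\<integral>\<^sup>+x. F (x + lattice_point k) * indicator (unit_square c) x \<partial>lborel)"
      by (subst nn_integral_plane_affine[where c=1 and t="lattice_point k"]) (auto simp: add.commute)
  qed
  finally show ?thesis .
qed

text \<open>Unitary on L2, as \<open>2 powi (- j)\<close> is the square root of the Jacobian.
  Positive \<open>j\<close> spreads \<open>f\<close> out, which by \<open>dilate_inner\<close>
  amounts to testing \<open>f\<close> itself on a grid of mesh \<open>2 powi (- j)\<close>.\<close>

definition dilate :: "int \<Rightarrow> plane_fun \<Rightarrow> plane_fun" where
  "dilate j f u = complex_of_real (2 powi (- j)) * f ((2 powi (- j)) *\<^sub>R u)"

lemma dilate_L2: "f \<in> L2 \<Longrightarrow> dilate j f \<in> L2"
  using L2_scale[OF L2_affine[of f "2 powi (- j)" 0]] unfolding dilate_def[abs_def] by simp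

lemma dilate_norm:
  assumes "f \<in> L2"
  shows "L2_norm (dilate j f) = L2_norm f"
  unfolding dilate_def[abs_def] L2_norm_scale norm_of_real
  using L2_norm_affine[of f "2 powi (- j)" 0] assms by (simp add: L2_measurable)

lemma dilate_diff: "dilate j (\<lambda>u. f u - g u) = (\<lambda>u. dilate j f u - dilate j g u)"
  by (auto simp: dilate_def algebra_simps)

lemma dilate_dilate: "dilate i (dilate j f) = dilate (i + j) f"
proof
  fix u
  define a b where "a = (2::real) powi (- i)" and "b = (2::real) powi (- j)"
  have "(2::real) powi (- (i + j)) = b * a"
    unfolding a_def b_def using power_int_add[of "2::real" "- j" "- i"] by (simp add: algebra_simps)
  then show "dilate i (dilate j f) u = dilate (i + j) f u"
    unfolding dilate_def a_def[symmetric] b_def[symmetric] by (simp add: mult_ac)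
qed

lemma dilate_0: "dilate 0 f = f"
  by (auto simp: dilate_def)

lemma dilate_inner:
  assumes "f \<in> L2" "g \<in> L2"
  shows "L2_inner (dilate j f) g = L2_inner f (dilate (- j) g)"
proof -
  have [measurable]: "f \<in> borel_measurable borel" "g \<in> borel_measurable borel" using assms by auto
  define c where "c = (2::real) powi j"
  have c: "c > 0" by (simp add: c_def)
  have d: "dilate j f u = complex_of_real (inverse c) * f (inverse c *\<^sub>R u)"
      "dilate (- j) g u = complex_of_real c * g (c *\<^sub>R u)" for u
    by (auto simp: dilate_def c_def power_int_minus)
  have "L2_inner (dilate j f) g = c\<^sup>2 *\<^sub>R (LINT u|lborel. complex_of_real (inverse c) * f u * cnj (g (c *\<^sub>R u)))"
    unfolding L2_inner_def d using c by (subst integral_plane_affine[where c=c and t=0]) auto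
  also have "\<dots> = (LINT u|lborel. c\<^sup>2 *\<^sub>R (complex_of_real (inverse c) * f u * cnj (g (c *\<^sub>R u))))"
    by simp
  also have "\<dots> = L2_inner f (dilate (- j) g)"
    unfolding L2_inner_def d using c
    by (intro Bochner_Integration.integral_cong refl) (simp add: scaleR_conv_of_real power2_eq_square)
  finally show ?thesis .
qed

lemma translate_L2: "f \<in> L2 \<Longrightarrow> translate f k \<in> L2"
  unfolding translate_def[abs_def] by (rule L2_shift)

section \<open>Energies of lattice coefficients\<close>

text \<open>Valued in \<open>ennreal\<close> because finiteness is a theorem,
  \<open>energy_bessel\<close>, whose proof already compares energies.\<close>

definition lattice_energy :: "plane_fun \<Rightarrow> plane_fun \<Rightarrow> ennreal" where
  "lattice_energy \<phi> f = (\<integral>\<^sup>+k. ennreal ((cmod (L2_inner f (translate \<phi> k)))\<^sup>2) \<partial>count_space UNIV)"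

text \<open>Each coefficient is continuous in \<open>f\<close>; Fatou's lemma for the counting
  measure sums the limits.\<close>

lemma lattice_energy_lsc:
  assumes F: "L2_seq_tendsto F f" and phi: "\<phi> \<in> L2"
    and le: "\<And>n. lattice_energy \<phi> (F n) \<le> c"
  shows "lattice_energy \<phi> f \<le> c"
proof -
  have "(\<lambda>n. ennreal ((cmod (L2_inner (F n) (translate \<phi> k)))\<^sup>2)) \<longlonglongrightarrow> ennreal ((cmod (L2_inner f (translate \<phi> k)))\<^sup>2)" for k
    using F unfolding L2_seq_tendsto_def
    by (intro tendsto_ennrealI tendsto_intros tendsto_L2_inner translate_L2 phi) auto
  then have "lattice_energy \<phi> f = (\<integral>\<^sup>+k. liminf (\<lambda>n. ennreal ((cmod (L2_inner (F n) (translate \<phi> k)))\<^sup>2)) \<partial>count_space UNIV)"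
    unfolding lattice_energy_def by (intro nn_integral_cong lim_imp_Liminf[symmetric]) auto
  also have "\<dots> \<le> liminf (\<lambda>n. lattice_energy \<phi> (F n))"
    unfolding lattice_energy_def by (rule nn_integral_liminf) simp
  also have "\<dots> \<le> c"
    using le by (intro Liminf_le) (auto simp: always_eventually)
  finally show ?thesis .
qed

text \<open>The square has measure 1, so the integral is a mean value, and a function can neither
  exceed its mean by \<open>e\<close> everywhere nor fall short of it by \<open>e\<close>
  everywhere.\<close>

lemma nn_integral_unit_square_witness:
  fixes G :: "real \<times> real \<Rightarrow> ennreal"
  assumes a: "a \<ge> 0" "e > 0"
    and eq: "(\<integral>\<^sup>+x. G x * indicator (unit_square c) x \<partial>lborel) = ennreal a"
  shows "\<exists>x\<in>unit_square c. G x \<le> ennreal (a + e)" "\<exists>x\<in>unit_square c. ennreal (a - e) \<le> G x"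
proof -
  have const: "(\<integral>\<^sup>+x. b * indicator (unit_square c) x \<partial>lborel) = b" for b
    by (simp add: nn_integral_cmult_indicator emeasure_unit_square)
  show "\<exists>x\<in>unit_square c. G x \<le> ennreal (a + e)"
  proof (rule ccontr)
    assume "\<not> ?thesis"
    then have "(\<integral>\<^sup>+x. ennreal (a + e) * indicator (unit_square c) x \<partial>lborel) \<le> ennreal a"
      unfolding eq[symmetric] by (intro nn_integral_mono) (auto split: split_indicator)
    then show False unfolding const using a by simp
  qed
  show "\<exists>x\<in>unit_square c. ennreal (a - e) \<le> G x"
  proof (rule ccontr)
    assume n: "\<not> ?thesis"
    have ne: "unit_square c \<noteq> {}" by (auto simp: unit_square_def)
    have "ennreal a \<le> (\<integral>\<^sup>+x. ennreal (a - e) * indicator (unit_square c) x \<partial>lborel)"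
      using n unfolding eq[symmetric] by (intro nn_integral_mono) (auto split: split_indicator)
    then have le: "ennreal a \<le> ennreal (a - e)" unfolding const .
    \<comment> \<open>For \<open>a < e\<close> the bound \<open>ennreal (a - e)\<close> collapses to
      0, and any point of the square satisfies it.\<close>
    then have "a - e < 0 \<or> a \<le> a - e" using a by (simp add: ennreal_le_iff2)
    then have "ennreal (a - e) = 0" using a by (auto simp: ennreal_neg)
    then show False using n ne by auto
  qed
qed

section \<open>Energies under dilation\<close>

text \<open>Separates the limit analysis from the filters: refinement is visible here only through
  \<open>energy_mono\<close>, stated for extended values so that it can be supplied before a Bessel
  bound exists.\<close>

locale refinable_energy =
  fixes \<phi> \<Phi> :: plane_fun
  assumes FT: "has_fourier_L2 \<phi> \<Phi>"
    and Phi_le: "\<And>\<omega>. cmod (\<Phi> \<omega>) \<le> 1"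
    and Phi_lim: "\<And>\<omega>. (\<lambda>n. \<Phi> (\<omega> /\<^sub>R 2 ^ n)) \<longlonglongrightarrow> 1"
    and energy_mono: "\<And>g. g \<in> L2 \<Longrightarrow> lattice_energy \<phi> g \<le> lattice_energy \<phi> (dilate 1 g)"
begin

lemma phi_L2: "\<phi> \<in> L2" and Phi_L2: "\<Phi> \<in> L2"
  using FT by (auto dest: has_fourier_L2_L2)

lemma measurable_phi [measurable]: "\<phi> \<in> borel_measurable borel" "\<Phi> \<in> borel_measurable borel"
  using phi_L2 Phi_L2 by auto

section \<open>Averaged energies and the Bessel bound\<close>

lemma energy_mono_nat: "g \<in> L2 \<Longrightarrow> lattice_energy \<phi> g \<le> lattice_energy \<phi> (dilate (int n) g)"
proof (induction n)
  case (Suc n)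
  have "lattice_energy \<phi> g \<le> lattice_energy \<phi> (dilate (int n) g)" by (rule Suc.IH[OF Suc.prems])
  also have "\<dots> \<le> lattice_energy \<phi> (dilate 1 (dilate (int n) g))" by (intro energy_mono dilate_L2 Suc.prems)
  finally show ?case by (simp add: dilate_dilate)
qed (simp add: dilate_0)

text \<open>Up to a reflection, the coefficient at \<open>s\<close> is the Fourier transform of
  \<open>fourier_integral f \<cdot> cnj \<Phi>\<close>, to which Plancherel's theorem applies again.\<close>

lemma correlation_energy:
  assumes f: "f \<in> L2" "integrable lborel f"
  shows "(\<integral>\<^sup>+s. ennreal ((cmod (L2_inner f (\<lambda>u. \<phi> (u - s))))\<^sup>2) \<partial>lborel)
    = ennreal ((L2_norm (\<lambda>\<omega>. fourier_integral f \<omega> * cnj (\<Phi> \<omega>)))\<^sup>2 / (4 * pi\<^sup>2))"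
proof -
  have [measurable]: "f \<in> borel_measurable borel" using f by auto
  define H where "H \<omega> = fourier_integral f \<omega> * cnj (\<Phi> \<omega>)" for \<omega>
  have "(\<lambda>\<omega>. cnj (\<Phi> \<omega>) * fourier_integral f \<omega>) \<in> L2"
    by (rule L2_bounded_mult) (use plancherel_integrable(1)[OF f] Phi_le in auto)
  then have H: "H \<in> L2" by (simp add: H_def[abs_def] mult.commute)
  have iH: "integrable lborel H"
    unfolding H_def by (rule L2_mult_integrable[OF plancherel_integrable(1)[OF f] Phi_L2])
  have [measurable]: "fourier_integral H \<in> borel_measurable borel"
    using plancherel_integrable(1)[OF H iH] by auto
  have eq: "(cmod (L2_inner f (\<lambda>u. \<phi> (u - s))))\<^sup>2 = (cmod (fourier_integral H (- s)))\<^sup>2 / (4 * pi\<^sup>2)\<^sup>2" for s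
  proof -
    have "4 * pi\<^sup>2 * L2_inner f (\<lambda>u. \<phi> (u - s)) = L2_inner (fourier_integral f) (\<lambda>\<omega>. cis (s \<bullet> \<omega>) * \<Phi> \<omega>)"
      by (rule parseval_L2[OF has_fourier_L2_integrable[OF f] has_fourier_L2_shift[OF FT], symmetric])
    also have "\<dots> = fourier_integral H (- s)"
      unfolding L2_inner_def fourier_integral_cis H_def
      by (intro Bochner_Integration.integral_cong refl) (simp add: cis_cnj inner_commute mult_ac)
    finally have "cmod (fourier_integral H (- s)) = cmod (4 * pi\<^sup>2 * L2_inner f (\<lambda>u. \<phi> (u - s)))" by simp
    also have "\<dots> = 4 * pi\<^sup>2 * cmod (L2_inner f (\<lambda>u. \<phi> (u - s)))"
      by (simp add: norm_mult norm_power)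
    finally show ?thesis by (simp add: power_mult_distrib)
  qed
  have "(\<integral>\<^sup>+s. ennreal ((cmod (L2_inner f (\<lambda>u. \<phi> (u - s))))\<^sup>2) \<partial>lborel)
      = ennreal (1 / (4 * pi\<^sup>2)\<^sup>2) * (\<integral>\<^sup>+s. ennreal ((cmod (fourier_integral H (- s)))\<^sup>2) \<partial>lborel)"
    unfolding eq by (subst nn_integral_cmult[symmetric]) (simp_all add: ennreal_mult[symmetric])
  also have "(\<integral>\<^sup>+s. ennreal ((cmod (fourier_integral H (- s)))\<^sup>2) \<partial>lborel) = L2_mass (fourier_integral H)"
    unfolding L2_mass_def
    by (subst (2) nn_integral_plane_affine[where c="-1" and t=0]) simp_all
  also have "\<dots> = ennreal (4 * pi\<^sup>2 * (L2_norm H)\<^sup>2)"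
    using plancherel_integrable[OF H iH] by (simp add: L2_mass_eq)
  \<comment> \<open>Parseval's identity contributes the inverse square of 4 pi^2, the second use of
    Plancherel one factor 4 pi^2.\<close>
  also have "ennreal (1 / (4 * pi\<^sup>2)\<^sup>2) * ennreal (4 * pi\<^sup>2 * (L2_norm H)\<^sup>2) = ennreal ((L2_norm H)\<^sup>2 / (4 * pi\<^sup>2))"
    by (subst ennreal_mult[symmetric]) (auto simp: power2_eq_square field_simps)
  finally show ?thesis unfolding H_def .
qed

text \<open>Shifting \<open>f\<close> by \<open>x\<close> moves the sampling points of its
  correlation with \<open>\<phi>\<close> from the lattice to a translate of it. Summing over the
  lattice and integrating over one tile is then a single integral over the plane.\<close>

lemma average_energy:
  assumes f: "f \<in> L2" "integrable lborel f"
  shows "(\<integral>\<^sup>+x. lattice_energy \<phi> (\<lambda>u. f (u + x)) * indicator (unit_square 0) x \<partial>lborel)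
    = ennreal ((L2_norm (\<lambda>\<omega>. fourier_integral f \<omega> * cnj (\<Phi> \<omega>)))\<^sup>2 / (4 * pi\<^sup>2))"
proof -
  have [measurable]: "f \<in> borel_measurable borel" using f by auto
  define F where "F s = ennreal ((cmod (L2_inner f (\<lambda>u. \<phi> (u - s))))\<^sup>2)" for s
  have [measurable]: "F \<in> borel_measurable borel" unfolding F_def L2_inner_def by measurable
  have F_eq: "F (x + lattice_point k) = ennreal ((cmod (L2_inner (\<lambda>u. f (u + x)) (translate \<phi> k)))\<^sup>2)" for x k
  proof -
    have "L2_inner f (\<lambda>u. \<phi> (u - (x + lattice_point k))) = L2_inner (\<lambda>u. f (u + x)) (translate \<phi> k)"
      unfolding L2_inner_def translate_def
      using integral_shift[of "\<lambda>u. f u * cnj (\<phi> (u - (x + lattice_point k)))" "- x"]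
      by (simp add: algebra_simps)
    then show ?thesis by (simp add: F_def)
  qed
  have "(\<integral>\<^sup>+x. lattice_energy \<phi> (\<lambda>u. f (u + x)) * indicator (unit_square 0) x \<partial>lborel)
      = (\<integral>\<^sup>+x. \<integral>\<^sup>+k. F (x + lattice_point k) * indicator (unit_square 0) x \<partial>count_space UNIV \<partial>lborel)"
    unfolding lattice_energy_def F_eq by (simp add: nn_integral_multc)
  also have "\<dots> = (\<integral>\<^sup>+k. \<integral>\<^sup>+x. F (x + lattice_point k) * indicator (unit_square 0) x \<partial>lborel \<partial>count_space UNIV)"
    by (rule nn_integral_count_space_nn_integral) simp_all
  also have "\<dots> = (\<integral>\<^sup>+s. F s \<partial>lborel)"
    by (rule nn_integral_fold[symmetric]) simp
  finally show ?thesis using correlation_energy[OF f] unfolding F_def by simp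
qed

text \<open>The average just computed, for \<open>dilate (int n) f\<close>, written in the undilated
  frequency variable. There \<open>n\<close> enters only through the factor with
  \<open>\<Phi>\<close>, which tends to 1.\<close>

definition mean_energy :: "plane_fun \<Rightarrow> nat \<Rightarrow> real" where
  "mean_energy f n = (L2_norm (\<lambda>\<omega>. fourier_integral f \<omega> * cnj (\<Phi> (\<omega> /\<^sub>R 2 ^ n))))\<^sup>2 / (4 * pi\<^sup>2)"

lemma mean_energy_dilate:
  assumes f: "f \<in> L2" "integrable lborel f"
  shows "(L2_norm (\<lambda>\<omega>. fourier_integral (dilate (int n) f) \<omega> * cnj (\<Phi> \<omega>)))\<^sup>2 / (4 * pi\<^sup>2) = mean_energy f n"
proof -
  have [measurable]: "f \<in> borel_measurable borel" using f by auto
  define c where "c = (2::real) powi (- int n)"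
  have c: "c > 0" "inverse (2 ^ n) = c" by (auto simp: c_def power_int_minus)
  have "dilate (int n) f = (\<lambda>u. complex_of_real c * f (c *\<^sub>R u - 0))"
    by (auto simp: dilate_def c_def)
  then have d: "fourier_integral (dilate (int n) f) \<omega> = complex_of_real (1 / c) * fourier_integral f (\<omega> /\<^sub>R c)" for \<omega>
    using fourier_integral_affine[of f c 0 \<omega>] c
    by (simp add: fourier_integral_scale power2_eq_square)
  have "L2_norm (\<lambda>\<omega>. fourier_integral (dilate (int n) f) \<omega> * cnj (\<Phi> \<omega>))
      = c * L2_norm (\<lambda>\<omega>. complex_of_real (1 / c) * (fourier_integral f \<omega> * cnj (\<Phi> (c *\<^sub>R \<omega>))))"
    unfolding d using c by (subst L2_norm_affine[where c=c and t=0]) (auto simp: mult.assoc)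
  also have "\<dots> = L2_norm (\<lambda>\<omega>. fourier_integral f \<omega> * cnj (\<Phi> (\<omega> /\<^sub>R 2 ^ n)))"
    unfolding L2_norm_scale c(2) using c by (simp add: norm_divide)
  finally show ?thesis by (simp add: mean_energy_def)
qed

lemma
  assumes f: "f \<in> L2" "integrable lborel f"
  shows mean_energy_le: "mean_energy f n \<le> (L2_norm f)\<^sup>2"
    and mean_energy_lim: "mean_energy f \<longlonglongrightarrow> (L2_norm f)\<^sup>2"
proof -
  have [measurable]: "f \<in> borel_measurable borel" using f by auto
  note fh = plancherel_integrable[OF f]
  define G where "G n \<omega> = fourier_integral f \<omega> * cnj (\<Phi> (\<omega> /\<^sub>R 2 ^ n))" for n \<omega>
  have le: "cmod (G n \<omega>) \<le> 1 * cmod (fourier_integral f \<omega>)" for n \<omega>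
    using Phi_le[of "\<omega> /\<^sub>R 2 ^ n"] by (simp add: G_def norm_mult mult_left_le)
  have lim: "(\<lambda>n. G n \<omega>) \<longlonglongrightarrow> fourier_integral f \<omega>" for \<omega>
    using tendsto_mult_left[OF tendsto_cnj[OF Phi_lim[of \<omega>]], of "fourier_integral f \<omega>"] by (simp add: G_def)
  have Gm: "G n \<in> borel_measurable borel" for n unfolding G_def by measurable
  note G = L2_dominated_convergence[OF Gm fh(1) le lim]
  have "(L2_norm (G n))\<^sup>2 \<le> (L2_norm (fourier_integral f))\<^sup>2"
    unfolding L2_norm_sq using le
    by (intro integral_mono L2_integrable G fh power_mono) auto
  then show "mean_energy f n \<le> (L2_norm f)\<^sup>2"
    unfolding mean_energy_def G_def[symmetric] fh(2) by (simp add: field_simps)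
  have "(\<lambda>n. (L2_norm (G n))\<^sup>2 / (4 * pi\<^sup>2)) \<longlonglongrightarrow> (L2_norm (fourier_integral f))\<^sup>2 / (4 * pi\<^sup>2)"
    by (intro tendsto_intros tendsto_L2_norm G fh) auto
  then show "mean_energy f \<longlonglongrightarrow> (L2_norm f)\<^sup>2"
    unfolding fh(2) mean_energy_def[abs_def] G_def by simp
qed

text \<open>\<open>w n\<close> is a shift whose energy is at most slightly above the mean,
  \<open>v n\<close> one whose energy is at most slightly below. Both come from a point of the unit
  square scaled by 2^(-n), since the shift is moved inside \<open>n\<close> dilations; hence both
  are null sequences.\<close>

lemma shifted_energy_witness:
  assumes f: "f \<in> L2" "integrable lborel f" and e: "\<And>n. e n > 0"
  obtains w v where "w \<longlonglongrightarrow> 0" "v \<longlonglongrightarrow> 0"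
    "\<And>n. lattice_energy \<phi> (dilate (int n) (\<lambda>u. f (u - w n))) \<le> ennreal (mean_energy f n + e n)"
    "\<And>n. ennreal (mean_energy f n - e n) \<le> lattice_energy \<phi> (dilate (int n) (\<lambda>u. f (u - v n)))"
proof -
  have [measurable]: "f \<in> borel_measurable borel" using f by auto
  define x0 where "x0 n x = - (inverse (2 ^ n) *\<^sub>R x)" for n :: nat and x :: "real \<times> real"
  have eq: "(\<lambda>u. dilate (int n) f (u + x)) = dilate (int n) (\<lambda>u. f (u - x0 n x))" for n x
    by (rule ext) (simp add: dilate_def x0_def power_int_minus scaleR_add_right)
  have av: "(\<integral>\<^sup>+x. lattice_energy \<phi> (dilate (int n) (\<lambda>u. f (u - x0 n x))) * indicator (unit_square 0) x \<partial>lborel) = ennreal (mean_energy f n)" for n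
  proof -
    have "integrable lborel (dilate (int n) f)"
      unfolding dilate_def using integrable_plane_affine[OF f(2), of "2 powi - int n" 0] by simp
    from average_energy[OF dilate_L2[OF f(1)] this] show ?thesis
      by (simp add: eq mean_energy_dilate[OF f])
  qed
  have a0: "mean_energy f n \<ge> 0" for n by (simp add: mean_energy_def)
  have "\<forall>n. \<exists>x. x \<in> unit_square 0 \<and>
      lattice_energy \<phi> (dilate (int n) (\<lambda>u. f (u - x0 n x))) \<le> ennreal (mean_energy f n + e n)"
    using nn_integral_unit_square_witness(1)[OF a0 e av] by blast
  from choice[OF this] obtain x where x: "\<And>n. x n \<in> unit_square 0"
      "\<And>n. lattice_energy \<phi> (dilate (int n) (\<lambda>u. f (u - x0 n (x n)))) \<le> ennreal (mean_energy f n + e n)"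
    by blast
  have "\<forall>n. \<exists>y. y \<in> unit_square 0 \<and>
      ennreal (mean_energy f n - e n) \<le> lattice_energy \<phi> (dilate (int n) (\<lambda>u. f (u - x0 n y)))"
    using nn_integral_unit_square_witness(2)[OF a0 e av] by blast
  from choice[OF this] obtain y where y: "\<And>n. y n \<in> unit_square 0"
      "\<And>n. ennreal (mean_energy f n - e n) \<le> lattice_energy \<phi> (dilate (int n) (\<lambda>u. f (u - x0 n (y n))))"
    by blast
  have lim0: "(\<lambda>n. x0 n (z n)) \<longlonglongrightarrow> 0" if z: "\<And>n. z n \<in> unit_square 0" for z
  proof (rule Lim_null_comparison)
    show "\<forall>\<^sub>F n in sequentially. norm (x0 n (z n)) \<le> 2 * (1 / 2) ^ n"
    proof (rule always_eventually, rule allI)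
      fix n
      have "norm (z n) \<le> norm (fst (z n)) + norm (snd (z n))"
        using norm_Pair_le[of "fst (z n)" "snd (z n)"] by simp
      also have "\<dots> \<le> 2" using z[of n] by (auto simp: unit_square_def)
      finally have "inverse (2 ^ n) * norm (z n) \<le> inverse (2 ^ n) * 2"
        by (intro mult_left_mono) auto
      then show "norm (x0 n (z n)) \<le> 2 * (1 / 2) ^ n"
        by (simp add: x0_def power_one_over inverse_eq_divide)
    qed
    show "(\<lambda>n. 2 * (1 / 2) ^ n :: real) \<longlonglongrightarrow> 0"
      using tendsto_mult_left[OF LIMSEQ_realpow_zero[of "1/2"], of 2] by simp
  qed
  show ?thesis
    by (rule that[of "\<lambda>n. x0 n (x n)" "\<lambda>n. x0 n (y n)"]) (intro lim0 x y)+
qed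

text \<open>The energy at scale 0 is at most that at scale \<open>n\<close>, which for the shift
  \<open>w n\<close> is at most the mean plus \<open>e\<close>, and the mean is at most the squared
  norm. Lower semicontinuity then removes the shift.\<close>

lemma energy_bessel_integrable:
  assumes f: "f \<in> L2" "integrable lborel f"
  shows "lattice_energy \<phi> f \<le> ennreal ((L2_norm f)\<^sup>2)"
proof (rule ennreal_le_epsilon)
  fix e :: real assume e: "e > 0"
  obtain w v where w: "w \<longlonglongrightarrow> 0" "v \<longlonglongrightarrow> 0"
      "\<And>n. lattice_energy \<phi> (dilate (int n) (\<lambda>u. f (u - w n))) \<le> ennreal (mean_energy f n + e)"
      "\<And>n. ennreal (mean_energy f n - e) \<le> lattice_energy \<phi> (dilate (int n) (\<lambda>u. f (u - v n)))"
    by (rule shifted_energy_witness[OF f, where e="\<lambda>n. e"], rule e, rule that)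
  have le: "lattice_energy \<phi> (\<lambda>u. f (u - w n)) \<le> ennreal ((L2_norm f)\<^sup>2) + ennreal e" for n
  proof -
    have "lattice_energy \<phi> (\<lambda>u. f (u - w n)) \<le> ennreal (mean_energy f n + e)"
      by (rule order_trans[OF energy_mono_nat[OF L2_shift[OF f(1)]] w(3)])
    also have "\<dots> \<le> ennreal ((L2_norm f)\<^sup>2 + e)"
      using mean_energy_le[OF f, of n] by (intro ennreal_leI) simp
    finally show ?thesis using e by simp
  qed
  have conv: "L2_seq_tendsto (\<lambda>n u. f (u - w n)) f"
    using f L2_shift_continuous[OF f(1) w(1)] by (simp add: L2_seq_tendsto_def L2_shift)
  show "lattice_energy \<phi> f \<le> ennreal ((L2_norm f)\<^sup>2) + ennreal e"
    by (rule lattice_energy_lsc[OF conv phi_L2 le])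
qed

lemma L2_seq_tendsto_bounded_part: "f \<in> L2 \<Longrightarrow> L2_seq_tendsto (bounded_part f) f"
  by (simp add: L2_seq_tendsto_def bounded_part_L2 bounded_part_tendsto)

theorem energy_bessel:
  assumes f: "f \<in> L2"
  shows "lattice_energy \<phi> f \<le> ennreal ((L2_norm f)\<^sup>2)"
proof (rule lattice_energy_lsc[OF L2_seq_tendsto_bounded_part[OF f] phi_L2])
  fix m
  have "lattice_energy \<phi> (bounded_part f m) \<le> ennreal ((L2_norm (bounded_part f m))\<^sup>2)"
    by (rule energy_bessel_integrable[OF bounded_part_L2[OF f] bounded_part_integrable[OF f]])
  also have "\<dots> \<le> ennreal ((L2_norm f)\<^sup>2)"
    unfolding L2_norm_sq
    by (intro ennreal_leI integral_mono L2_integrable f bounded_part_L2) (auto simp: bounded_part_def)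
  finally show "lattice_energy \<phi> (bounded_part f m) \<le> ennreal ((L2_norm f)\<^sup>2)" .
qed

section \<open>The lattice seminorm and its fine-scale limit\<close>

definition lattice_norm :: "plane_fun \<Rightarrow> real" where
  "lattice_norm f = sqrt (\<Sum>\<^sub>\<infinity>k. (cmod (L2_inner f (translate \<phi> k)))\<^sup>2)"

text \<open>\<open>infsum\<close> is 0 on a family that is not summable, so the Bessel bound has to
  precede any use of \<open>lattice_norm\<close>.\<close>

lemma coeff_summable:
  assumes f: "f \<in> L2"
  shows "(\<lambda>k. (cmod (L2_inner f (translate \<phi> k)))\<^sup>2) summable_on UNIV"
proof (rule summable_on_if_nn_integral_finite)
  show "(\<integral>\<^sup>+k. ennreal ((cmod (L2_inner f (translate \<phi> k)))\<^sup>2) \<partial>count_space UNIV) < \<infinity>"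
    using energy_bessel[OF f] unfolding lattice_energy_def by (rule order.strict_trans1) simp
qed simp

lemma lattice_norm_nonneg [simp]: "lattice_norm f \<ge> 0"
  unfolding lattice_norm_def by (intro real_sqrt_ge_zero infsum_nonneg) auto

lemma lattice_norm_sq: "(lattice_norm f)\<^sup>2 = (\<Sum>\<^sub>\<infinity>k. (cmod (L2_inner f (translate \<phi> k)))\<^sup>2)"
  unfolding lattice_norm_def by (intro real_sqrt_pow2 infsum_nonneg) auto

lemma lattice_energy_eq: "f \<in> L2 \<Longrightarrow> lattice_energy \<phi> f = ennreal ((lattice_norm f)\<^sup>2)"
  unfolding lattice_energy_def lattice_norm_sq
  by (rule nn_integral_count_space_infsum) (auto intro: coeff_summable)

lemma lattice_norm_le: "f \<in> L2 \<Longrightarrow> lattice_norm f \<le> L2_norm f"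
  using energy_bessel[of f] by (simp add: lattice_energy_eq power2_le_iff_abs_le)

text \<open>A seminorm bounded by the L2 norm is Lipschitz with constant 1. Minkowski's inequality
  is applied on finite index sets, whose partial sums exhaust the infinite sum.\<close>

lemma lattice_norm_diff:
  assumes f: "f \<in> L2" and g: "g \<in> L2"
  shows "lattice_norm f \<le> lattice_norm g + L2_norm (\<lambda>u. f u - g u)"
proof -
  have bound: "L2_set (\<lambda>k. cmod (L2_inner h (translate \<phi> k))) K \<le> lattice_norm h" if "finite K" "h \<in> L2" for h K
    unfolding L2_set_def lattice_norm_def
    by (intro real_sqrt_le_mono finite_sum_le_infsum coeff_summable that) auto
  define d where "d = (\<lambda>u. f u - g u)"
  have d: "d \<in> L2" unfolding d_def by (intro L2_diff f g)
  have "(\<Sum>\<^sub>\<infinity>k. (cmod (L2_inner f (translate \<phi> k)))\<^sup>2) \<le> (lattice_norm g + L2_norm d)\<^sup>2"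
  proof (rule infsum_le_finite_sums[OF coeff_summable[OF f]])
    fix K :: "(int \<times> int) set" assume K: "finite K"
    have "L2_set (\<lambda>k. cmod (L2_inner f (translate \<phi> k))) K
        \<le> L2_set (\<lambda>k. cmod (L2_inner g (translate \<phi> k)) + cmod (L2_inner d (translate \<phi> k))) K"
    proof (rule L2_set_mono)
      fix k
      have "L2_inner f (translate \<phi> k) = L2_inner g (translate \<phi> k) + L2_inner d (translate \<phi> k)"
        unfolding d_def by (simp add: L2_inner_diff_left f g translate_L2 phi_L2)
      then show "cmod (L2_inner f (translate \<phi> k)) \<le> cmod (L2_inner g (translate \<phi> k)) + cmod (L2_inner d (translate \<phi> k))"
        by (simp add: norm_triangle_ineq)
    qed auto
    also have "\<dots> \<le> L2_set (\<lambda>k. cmod (L2_inner g (translate \<phi> k))) K + L2_set (\<lambda>k. cmod (L2_inner d (translate \<phi> k))) K"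
      by (rule L2_set_triangle_ineq)
    also have "\<dots> \<le> lattice_norm g + L2_norm d"
      using bound[OF K g] bound[OF K d] lattice_norm_le[OF d] by linarith
    finally have "(L2_set (\<lambda>k. cmod (L2_inner f (translate \<phi> k))) K)\<^sup>2 \<le> (lattice_norm g + L2_norm d)\<^sup>2"
      by (intro power_mono) auto
    then show "(\<Sum>k\<in>K. (cmod (L2_inner f (translate \<phi> k)))\<^sup>2) \<le> (lattice_norm g + L2_norm d)\<^sup>2"
      by (simp add: L2_set_def sum_nonneg)
  qed
  then show ?thesis
    unfolding lattice_norm_sq[symmetric] d_def by (rule power2_le_imp_le) simp
qed

lemma lattice_norm_dilate_diff:
  assumes f: "f \<in> L2" and g: "g \<in> L2"
  shows "\<bar>lattice_norm (dilate j f) - lattice_norm (dilate j g)\<bar> \<le> L2_norm (\<lambda>u. f u - g u)"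
proof -
  have "L2_norm (\<lambda>u. dilate j f u - dilate j g u) = L2_norm (\<lambda>u. f u - g u)"
    using dilate_norm[OF L2_diff[OF f g], of j] by (simp add: dilate_diff)
  then show ?thesis
    using lattice_norm_diff[OF dilate_L2[OF f] dilate_L2[OF g], of j j]
      lattice_norm_diff[OF dilate_L2[OF g] dilate_L2[OF f], of j j]
    by (simp add: L2_norm_minus[of "dilate j g"])
qed

text \<open>The Bessel bound is the upper half. For the lower half, the energy at the shift
  \<open>v n\<close> is close to the mean, which tends to the squared norm; undoing the shift costs
  the L2 distance between \<open>f\<close> and its shift, at whatever scale.\<close>

lemma lattice_norm_fine_integrable:
  assumes f: "f \<in> L2" "integrable lborel f"
  shows "(\<lambda>n. lattice_norm (dilate (int n) f)) \<longlonglongrightarrow> L2_norm f"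
proof -
  define e where "e n = inverse (real (Suc n))" for n
  have e: "e n > 0" for n by (simp add: e_def)
  obtain w v where v: "w \<longlonglongrightarrow> 0" "v \<longlonglongrightarrow> 0"
      "\<And>n. lattice_energy \<phi> (dilate (int n) (\<lambda>u. f (u - w n))) \<le> ennreal (mean_energy f n + e n)"
      "\<And>n. ennreal (mean_energy f n - e n) \<le> lattice_energy \<phi> (dilate (int n) (\<lambda>u. f (u - v n)))"
    by (rule shifted_energy_witness[OF f, where e=e], rule e, rule that)
  define L where "L n = sqrt (mean_energy f n - e n) - L2_norm (\<lambda>u. f (u - v n) - f u)" for n
  have lower: "L n \<le> lattice_norm (dilate (int n) f)" for n
  proof -
    have fv: "(\<lambda>u. f (u - v n)) \<in> L2" by (rule L2_shift[OF f(1)])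
    have "mean_energy f n - e n \<le> (lattice_norm (dilate (int n) (\<lambda>u. f (u - v n))))\<^sup>2"
      using v(4)[of n] by (simp add: lattice_energy_eq[OF dilate_L2[OF fv]] ennreal_le_iff)
    then have "sqrt (mean_energy f n - e n) \<le> lattice_norm (dilate (int n) (\<lambda>u. f (u - v n)))"
      by (rule real_le_lsqrt[OF lattice_norm_nonneg])
    then show ?thesis
      using lattice_norm_dilate_diff[OF fv f(1), of "int n"] by (simp add: L_def)
  qed
  have upper: "lattice_norm (dilate (int n) f) \<le> L2_norm f" for n
    using lattice_norm_le[OF dilate_L2[OF f(1)]] by (simp add: dilate_norm[OF f(1)])
  have "L \<longlonglongrightarrow> sqrt ((L2_norm f)\<^sup>2 - 0) - 0"
    unfolding L_def[abs_def] e_def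
    by (intro tendsto_intros mean_energy_lim f L2_shift_continuous v LIMSEQ_inverse_real_of_nat)
  then have "L \<longlonglongrightarrow> L2_norm f" by simp
  then show ?thesis
    by (rule tendsto_sandwich[OF always_eventually[OF allI[OF lower]] always_eventually[OF allI[OF upper]] _ tendsto_const])
qed

text \<open>Dilations are isometries, so the truncation error is bounded alike at every scale and
  the limits in scale and in truncation can be exchanged. \<open>J\<close> is left free to serve
  both fine and coarse scales.\<close>

lemma lattice_norm_limit_bounded_part:
  assumes f: "f \<in> L2" and J: "\<And>m. (\<lambda>n. lattice_norm (dilate (J n) (bounded_part f m))) \<longlonglongrightarrow> l m"
    and l: "l \<longlonglongrightarrow> l0"
  shows "(\<lambda>n. lattice_norm (dilate (J n) f)) \<longlonglongrightarrow> l0"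
proof (rule metric_LIMSEQ_I)
  fix e :: real assume e: "e > 0"
  obtain m where m: "L2_norm (\<lambda>u. bounded_part f m u - f u) < e / 3" "\<bar>l m - l0\<bar> < e / 3"
  proof -
    obtain m1 where m1: "\<And>m. m \<ge> m1 \<Longrightarrow> L2_norm (\<lambda>u. bounded_part f m u - f u) < e / 3"
      using LIMSEQ_D[OF bounded_part_tendsto[OF f], of "e / 3"] e by auto
    obtain m2 where m2: "\<And>m. m \<ge> m2 \<Longrightarrow> \<bar>l m - l0\<bar> < e / 3"
      using LIMSEQ_D[OF l, of "e / 3"] e by auto
    show ?thesis using that[of "max m1 m2"] m1 m2 by simp
  qed
  obtain N where N: "\<And>n. n \<ge> N \<Longrightarrow> \<bar>lattice_norm (dilate (J n) (bounded_part f m)) - l m\<bar> < e / 3"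
    using LIMSEQ_D[OF J[of m], of "e / 3"] e by auto
  have "dist (lattice_norm (dilate (J n) f)) l0 < e" if "n \<ge> N" for n
    using N[OF that] m lattice_norm_dilate_diff[OF bounded_part_L2[OF f, of m] f, of "J n"]
    unfolding dist_real_def by linarith
  then show "\<exists>N. \<forall>n\<ge>N. dist (lattice_norm (dilate (J n) f)) l0 < e" by blast
qed

theorem lattice_norm_fine:
  assumes f: "f \<in> L2"
  shows "(\<lambda>n. lattice_norm (dilate (int n) f)) \<longlonglongrightarrow> L2_norm f"
  using lattice_norm_fine_integrable[OF bounded_part_L2[OF f] bounded_part_integrable[OF f]]
    tendsto_L2_norm[OF bounded_part_L2[OF f] f bounded_part_tendsto[OF f]]
  by (rule lattice_norm_limit_bounded_part[OF f])

end

section \<open>Paraunitary filter banks on the integer lattice\<close>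

definition parity :: "int \<times> int \<Rightarrow> int \<times> int" where
  "parity p = (fst p mod 2, snd p mod 2)"

definition half :: "int \<times> int \<Rightarrow> int \<times> int" where
  "half p = (fst p div 2, snd p div 2)"

abbreviation parities :: "(int \<times> int) set" where
  "parities \<equiv> {0, 1} \<times> {0, 1}"

lemma half_parity: "half p + half p + parity p = p"
  by (cases p) (simp add: half_def parity_def)

lemma parity_in: "parity p \<in> parities"
  by (auto simp: parity_def)

text \<open>This is the polyphase decomposition of the lattice.\<close>

lemma bij_parity: "bij_betw (\<lambda>(q, k). k + k + q) (parities \<times> UNIV) (UNIV :: (int \<times> int) set)"
proof (rule bij_betwI[where g="\<lambda>p. (parity p, half p)"])
  show "(\<lambda>p. (parity p, half p)) \<in> UNIV \<rightarrow> parities \<times> UNIV"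
    using parity_in by auto
  fix x :: "(int \<times> int) \<times> int \<times> int" assume "x \<in> parities \<times> UNIV"
  then show "(parity (case x of (q, k) \<Rightarrow> k + k + q), half (case x of (q, k) \<Rightarrow> k + k + q)) = x"
    by (auto simp: parity_def half_def)
qed (auto simp: half_parity)

lemma has_sum_finite_sum:
  fixes f :: "'a \<Rightarrow> 'b \<Rightarrow> 'c :: topological_comm_monoid_add"
  assumes "finite A" "\<And>a. a \<in> A \<Longrightarrow> (f a has_sum S a) B"
  shows "((\<lambda>x. \<Sum>a\<in>A. f a x) has_sum (\<Sum>a\<in>A. S a)) B"
  using assms by (induction A rule: finite_induct) (auto intro!: has_sum_add)

lemma nonneg_has_sum_Sigma:
  fixes f :: "'a \<times> 'b \<Rightarrow> real"
  assumes inner: "\<And>x. x \<in> A \<Longrightarrow> ((\<lambda>y. f (x, y)) has_sum g x) (B x)"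
    and outer: "(g has_sum S) A"
    and nonneg: "\<And>x y. x \<in> A \<Longrightarrow> y \<in> B x \<Longrightarrow> f (x, y) \<ge> 0"
  shows "(f has_sum S) (Sigma A B)"
proof -
  have "f summable_on Sigma A B"
    using inner has_sum_imp_summable[OF outer] nonneg by (intro summable_on_SigmaI[where g=g]) auto
  then show ?thesis using inner outer by (intro has_sum_SigmaI) auto
qed

text \<open>The condition says that analysis followed by its adjoint is the identity. Its left side
  is the matrix entry between indices \<open>n\<close> and \<open>n + d\<close> with
  \<open>n\<close> of parity \<open>q\<close>; the sum over even shifts turns into a sum over the
  taps \<open>p\<close> of that parity. Odd differences \<open>d\<close> occur as well.\<close>

locale paraunitary_filter_bank =
  fixes h :: "nat \<Rightarrow> int \<times> int \<Rightarrow> real" and K :: "(int \<times> int) set"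
  assumes finite_K: "finite K"
    and support: "\<And>i p. p \<notin> K \<Longrightarrow> h i p = 0"
    and paraunitary: "\<And>q d. q \<in> parities \<Longrightarrow>
      4 * (\<Sum>i<4. \<Sum>p | p \<in> K \<and> parity p = q. h i p * h i (p + d)) = (if d = 0 then 1 else 0)"
begin

text \<open>Filtering followed by downsampling by 2 in each direction. The factor 2 is what is left
  of the 4 in the refinement equation after a unitary dilation has absorbed a 2.\<close>

definition analysis :: "nat \<Rightarrow> (int \<times> int \<Rightarrow> complex) \<Rightarrow> int \<times> int \<Rightarrow> complex" where
  "analysis i s k = 2 * (\<Sum>p\<in>K. complex_of_real (h i p) * s (k + k + p))"

text \<open>Expand the squares. The correlation \<open>R p p'\<close> of \<open>s\<close> depends
  only on the parity of \<open>p\<close> and on \<open>p' - p\<close>, and grouping the taps by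
  these data makes the paraunitary sums appear. Only the difference 0 survives, and the energies of
  the four polyphase components add up to that of \<open>s\<close>.\<close>

theorem analysis_energy:
  fixes s :: "int \<times> int \<Rightarrow> complex"
  assumes s: "(\<lambda>n. (cmod (s n))\<^sup>2) summable_on UNIV"
  shows "((\<lambda>(i, k). (cmod (analysis i s k))\<^sup>2) has_sum (\<Sum>\<^sub>\<infinity>n. (cmod (s n))\<^sup>2)) ({..<4} \<times> UNIV)"
proof -
  define X where "X p p' k = s (k + k + p) * cnj (s (k + k + p'))" for p p' k
  define R where "R p p' = infsum (X p p') UNIV" for p p'
  have inj: "inj (\<lambda>k :: int \<times> int. k + k + p)" for p
    by (auto simp: inj_def)
  have s2: "(\<lambda>k. (cmod (s (k + k + p)))\<^sup>2) summable_on UNIV" for p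
    using summable_on_subset[OF s, of "range (\<lambda>k. k + k + p)"]
    unfolding summable_on_reindex[OF inj] o_def by simp
  have X: "(X p p' has_sum R p p') UNIV" for p p'
  proof -
    have "(\<lambda>k. norm (X p p' k)) summable_on UNIV"
    proof (rule summable_on_comparison_test)
      show "(\<lambda>k. (cmod (s (k + k + p)))\<^sup>2 + (cmod (s (k + k + p')))\<^sup>2) summable_on UNIV"
        by (intro summable_on_add s2)
      fix k
      have "0 \<le> (cmod (s (k + k + p)) - cmod (s (k + k + p')))\<^sup>2"
          "0 \<le> cmod (s (k + k + p)) * cmod (s (k + k + p'))" by auto
      then show "norm (X p p' k) \<le> (cmod (s (k + k + p)))\<^sup>2 + (cmod (s (k + k + p')))\<^sup>2"
        unfolding power2_diff X_def norm_mult complex_mod_cnj by linarith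
    qed auto
    then have "X p p' summable_on UNIV" by (rule abs_summable_summable)
    then show ?thesis unfolding R_def by (rule has_sum_infsum)
  qed
  have R_shift: "R (m + m + p) (m + m + p') = R p p'" for m p p'
  proof -
    have "R (m + m + p) (m + m + p') = (\<Sum>\<^sub>\<infinity>k. X p p' (k + m))"
      unfolding R_def X_def by (simp add: algebra_simps)
    also have "\<dots> = R p p'"
      unfolding R_def by (rule infsum_reindex_bij_betw) (rule bij_betwI[where g="\<lambda>k. k - m"], auto)
    finally show ?thesis .
  qed
  define T where "T i = 4 * (\<Sum>p\<in>K. \<Sum>p'\<in>K. complex_of_real (h i p * h i p') * R p p')" for i
  have T: "((\<lambda>k. complex_of_real ((cmod (analysis i s k))\<^sup>2)) has_sum T i) UNIV" for i
  proof -
    have "complex_of_real ((cmod (analysis i s k))\<^sup>2)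
        = 4 * (\<Sum>p\<in>K. \<Sum>p'\<in>K. complex_of_real (h i p * h i p') * X p p' k)" for k
    proof -
      have "complex_of_real ((cmod (analysis i s k))\<^sup>2)
          = 4 * ((\<Sum>p\<in>K. complex_of_real (h i p) * s (k + k + p)) * (\<Sum>p'\<in>K. cnj (complex_of_real (h i p') * s (k + k + p'))))"
        unfolding complex_norm_square analysis_def by simp
      also have "\<dots> = 4 * (\<Sum>p\<in>K. \<Sum>p'\<in>K. complex_of_real (h i p * h i p') * X p p' k)"
        unfolding sum_product X_def by (simp add: mult_ac)
      finally show ?thesis .
    qed
    moreover have "((\<lambda>k. 4 * (\<Sum>p\<in>K. \<Sum>p'\<in>K. complex_of_real (h i p * h i p') * X p p' k)) has_sum T i) UNIV"
      unfolding T_def by (intro has_sum_cmult_right has_sum_finite_sum finite_K X)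
    ultimately show ?thesis by simp
  qed
  define D where "D = (\<lambda>(p, p'). p' - p) ` (K \<times> K)"
  have D: "finite D" unfolding D_def using finite_K by auto
  \<comment> \<open>With no taps the condition at difference 0 would read 0 = 1.\<close>
  have "K \<noteq> {}"
    using paraunitary[of "(0, 0)" 0] by auto
  then have D0: "0 \<in> D" unfolding D_def by force
  have inner: "(\<Sum>p'\<in>K. complex_of_real (h i p * h i p') * R p p')
      = (\<Sum>d\<in>D. complex_of_real (h i p * h i (p + d)) * R (parity p) (parity p + d))" if p: "p \<in> K" for i p
  proof -
    have "(\<Sum>p'\<in>K. complex_of_real (h i p * h i p') * R p p')
        = (\<Sum>d\<in>(\<lambda>p'. p' - p) ` K. complex_of_real (h i p * h i (p + d)) * R p (p + d))"
      by (subst sum.reindex) (auto simp: inj_on_def)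
    also have "\<dots> = (\<Sum>d\<in>D. complex_of_real (h i p * h i (p + d)) * R p (p + d))"
    proof (rule sum.mono_neutral_left[OF D])
      show "(\<lambda>p'. p' - p) ` K \<subseteq> D" using p by (auto simp: D_def)
      show "\<forall>d\<in>D - (\<lambda>p'. p' - p) ` K. complex_of_real (h i p * h i (p + d)) * R p (p + d) = 0"
      proof
        fix d assume d: "d \<in> D - (\<lambda>p'. p' - p) ` K"
        then have "p + d \<notin> K" by (force simp: image_iff)
        then show "complex_of_real (h i p * h i (p + d)) * R p (p + d) = 0" by (simp add: support)
      qed
    qed
    moreover have "R p (p + d) = R (parity p) (parity p + d)" for d
      using R_shift[of "half p" "parity p" "parity p + d"] half_parity[of p]
      by (simp add: add.assoc[symmetric])
    ultimately show ?thesis by simp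
  qed
  have "(\<Sum>i<4. T i) = (\<Sum>i<4. 4 * (\<Sum>p\<in>K. \<Sum>d\<in>D. complex_of_real (h i p * h i (p + d)) * R (parity p) (parity p + d)))"
    unfolding T_def using inner by simp
  also have "\<dots> = (\<Sum>d\<in>D. \<Sum>p\<in>K. (\<Sum>i<4. 4 * complex_of_real (h i p * h i (p + d))) * R (parity p) (parity p + d))"
  proof -
    define F where "F i p d = 4 * complex_of_real (h i p * h i (p + d)) * R (parity p) (parity p + d)" for i p d
    have "(\<Sum>i<4. \<Sum>p\<in>K. \<Sum>d\<in>D. F i p d) = (\<Sum>p\<in>K. \<Sum>i<4. \<Sum>d\<in>D. F i p d)"
      by (rule sum.swap)
    also have "\<dots> = (\<Sum>p\<in>K. \<Sum>d\<in>D. \<Sum>i<4. F i p d)"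
      by (rule sum.cong[OF refl sum.swap])
    also have "\<dots> = (\<Sum>d\<in>D. \<Sum>p\<in>K. \<Sum>i<4. F i p d)"
      by (rule sum.swap)
    finally show ?thesis
      unfolding F_def by (simp only: sum_distrib_left sum_distrib_right mult.assoc)
  qed
  also have "\<dots> = (\<Sum>d\<in>D. \<Sum>q\<in>parities. (if d = 0 then 1 else 0) * R q (q + d))"
  proof (rule sum.cong[OF refl])
    fix d
    have "(\<Sum>p\<in>K. (\<Sum>i<4. 4 * complex_of_real (h i p * h i (p + d))) * R (parity p) (parity p + d))
        = (\<Sum>q\<in>parities. \<Sum>p | p \<in> K \<and> parity p = q. (\<Sum>i<4. 4 * complex_of_real (h i p * h i (p + d))) * R (parity p) (parity p + d))"
    proof (rule sum.group[symmetric, OF finite_K])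
      show "parity ` K \<subseteq> parities" by (rule image_subsetI) (rule parity_in)
    qed simp
    also have "\<dots> = (\<Sum>q\<in>parities. (if d = 0 then 1 else 0) * R q (q + d))"
    proof (rule sum.cong[OF refl])
      fix q assume q: "q \<in> parities"
      have "(\<Sum>p | p \<in> K \<and> parity p = q. (\<Sum>i<4. 4 * complex_of_real (h i p * h i (p + d))) * R (parity p) (parity p + d))
          = (\<Sum>p | p \<in> K \<and> parity p = q. (\<Sum>i<4. 4 * complex_of_real (h i p * h i (p + d)))) * R q (q + d)"
        unfolding sum_distrib_right by (intro sum.cong refl) auto
      also have "(\<Sum>p | p \<in> K \<and> parity p = q. (\<Sum>i<4. 4 * complex_of_real (h i p * h i (p + d))))
          = complex_of_real (4 * (\<Sum>i<4. \<Sum>p | p \<in> K \<and> parity p = q. h i p * h i (p + d)))"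
        by (subst sum.swap) (simp add: sum_distrib_left)
      also have "\<dots> = (if d = 0 then 1 else 0)"
        unfolding paraunitary[OF q] by simp
      finally show "(\<Sum>p | p \<in> K \<and> parity p = q. (\<Sum>i<4. 4 * complex_of_real (h i p * h i (p + d))) * R (parity p) (parity p + d))
          = (if d = 0 then 1 else 0) * R q (q + d)" .
    qed
    finally show "(\<Sum>p\<in>K. (\<Sum>i<4. 4 * complex_of_real (h i p * h i (p + d))) * R (parity p) (parity p + d))
        = (\<Sum>q\<in>parities. (if d = 0 then 1 else 0) * R q (q + d))" .
  qed
  also have "\<dots> = (\<Sum>d\<in>D. if d = 0 then (\<Sum>q\<in>parities. R q q) else 0)"
    by (intro sum.cong refl) auto
  also have "\<dots> = (\<Sum>q\<in>parities. R q q)"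
    using D D0 by simp
  also have "\<dots> = complex_of_real (\<Sum>\<^sub>\<infinity>n. (cmod (s n))\<^sup>2)"
  proof -
    define E where "E q = (\<Sum>\<^sub>\<infinity>k. (cmod (s (k + k + q)))\<^sup>2)" for q
    have E: "((\<lambda>k. (cmod (s (k + k + q)))\<^sup>2) has_sum E q) UNIV" for q
      unfolding E_def by (intro has_sum_infsum s2)
    have "((\<lambda>n. (cmod (s n))\<^sup>2) has_sum (\<Sum>\<^sub>\<infinity>n. (cmod (s n))\<^sup>2)) UNIV"
      by (rule has_sum_infsum[OF s])
    then have "((\<lambda>(q, k). (cmod (s (k + k + q)))\<^sup>2) has_sum (\<Sum>\<^sub>\<infinity>n. (cmod (s n))\<^sup>2)) (parities \<times> UNIV)"
      using has_sum_reindex_bij_betw[OF bij_parity, of "\<lambda>n. (cmod (s n))\<^sup>2" "\<Sum>\<^sub>\<infinity>n. (cmod (s n))\<^sup>2"]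
      by (simp add: case_prod_unfold)
    then have "(E has_sum (\<Sum>\<^sub>\<infinity>n. (cmod (s n))\<^sup>2)) parities"
      by (rule has_sum_SigmaD) (use E in auto)
    then have "(\<Sum>\<^sub>\<infinity>n. (cmod (s n))\<^sup>2) = (\<Sum>q\<in>parities. E q)"
      by (intro has_sum_unique[OF _ has_sum_finite]) auto
    moreover have "R q q = complex_of_real (E q)" for q
    proof -
      have "((\<lambda>k. complex_of_real ((cmod (s (k + k + q)))\<^sup>2)) has_sum complex_of_real (E q)) UNIV"
        by (rule has_sum_of_real[OF E])
      then have "(X q q has_sum complex_of_real (E q)) UNIV"
        unfolding X_def complex_norm_square .
      then show ?thesis using X[of q q] has_sum_unique by blast
    qed
    ultimately show ?thesis by simp
  qed
  finally have total: "(\<Sum>i<4. T i) = complex_of_real (\<Sum>\<^sub>\<infinity>n. (cmod (s n))\<^sup>2)" .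
  show ?thesis
  proof (rule nonneg_has_sum_Sigma)
    show "((\<lambda>y. case (i, y) of (i, k) \<Rightarrow> (cmod (analysis i s k))\<^sup>2) has_sum Re (T i)) UNIV" for i
      using has_sum_Re[OF T[of i]] by simp
    have "(\<Sum>i<4. Re (T i)) = (\<Sum>\<^sub>\<infinity>n. (cmod (s n))\<^sup>2)"
      using arg_cong[OF total, of Re] by simp
    then show "((\<lambda>i. Re (T i)) has_sum (\<Sum>\<^sub>\<infinity>n. (cmod (s n))\<^sup>2)) {..<4}"
      by (intro has_sum_finiteI) auto
  qed auto
qed

end

section \<open>The coarse-scale limit\<close>

context refinable_energy
begin

text \<open>\<open>dilate (- int n) f\<close> keeps its norm but lives on a ball of radius m / 2^n.
  By Cauchy-Schwarz its energy is at most the squared norm times the mass of \<open>\<phi>\<close>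
  in the lattice translates of that ball. Dominated convergence, in each tile and then over the
  lattice, sends this mass to 0.\<close>

lemma lattice_norm_coarse_compact:
  assumes f: "f \<in> L2" and supp: "\<And>u. norm u > m \<Longrightarrow> f u = 0"
  shows "(\<lambda>n. lattice_norm (dilate (- int n) f)) \<longlonglongrightarrow> 0"
proof -
  have [measurable]: "f \<in> borel_measurable borel" using f by auto
  define B where "B n = cball (0 :: real \<times> real) (m / 2 ^ n)" for n
  \<comment> \<open>Centring the tile at the origin places the small balls inside a single
    tile.\<close>
  define Q where "Q = unit_square (- (1 / 2))"
  define c where "c n k = (\<integral>\<^sup>+u. ennreal ((cmod (\<phi> (u - lattice_point k)))\<^sup>2) * indicator (B n \<inter> Q) u \<partial>lborel)" for n k
  define d where "d k = (\<integral>\<^sup>+u. ennreal ((cmod (\<phi> (u - lattice_point k)))\<^sup>2) * indicator Q u \<partial>lborel)" for k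
  have [measurable]: "B n \<in> sets borel" "Q \<in> sets borel" for n
    by (auto simp: B_def Q_def)
  have half_power: "m * (1 / 2) ^ n = m / 2 ^ n" for n
    by (simp add: power_one_over)
  have cd: "c n k \<le> d k" for n k
    unfolding c_def d_def by (intro nn_integral_mono) (auto split: split_indicator)
  have dsum: "(\<integral>\<^sup>+k. d k \<partial>count_space UNIV) = L2_mass \<phi>"
  proof -
    have "L2_mass \<phi> = (\<integral>\<^sup>+k. d (- k) \<partial>count_space UNIV)"
      unfolding L2_mass_def Q_def d_def
      by (subst nn_integral_fold[where c="- (1 / 2)"]) (auto simp: lattice_point_def minus_prod_def uminus_prod_def plus_prod_def)
    also have "\<dots> = (\<integral>\<^sup>+k. d k \<partial>count_space UNIV)"
      by (rule nn_integral_bij_count_space) (rule bij_uminus)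
    finally show ?thesis by simp
  qed
  have dfin: "(\<integral>\<^sup>+k. d k \<partial>count_space UNIV) < \<infinity>"
    unfolding dsum using L2_mass_finite[OF phi_L2] .
  have c0: "(\<lambda>n. c n k) \<longlonglongrightarrow> 0" for k
  proof -
    have "(\<lambda>n. c n k) \<longlonglongrightarrow> (\<integral>\<^sup>+u. (0 :: ennreal) \<partial>(lborel :: (real \<times> real) measure))"
      unfolding c_def
    proof (rule nn_integral_dominated_convergence[where w="\<lambda>u. ennreal ((cmod (\<phi> (u - lattice_point k)))\<^sup>2) * indicator Q u"])
      have "d k \<le> (\<integral>\<^sup>+k. d k \<partial>count_space UNIV)" by (rule nn_integral_ge_point) simp
      then show "(\<integral>\<^sup>+u. ennreal ((cmod (\<phi> (u - lattice_point k)))\<^sup>2) * indicator Q u \<partial>lborel) < \<infinity>"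
        using dfin unfolding d_def by (rule order.strict_trans1)
      show "AE u in lborel. (\<lambda>n. ennreal ((cmod (\<phi> (u - lattice_point k)))\<^sup>2) * indicator (B n \<inter> Q) u) \<longlonglongrightarrow> 0"
      \<comment> \<open>The origin can lie in every ball, so the pointwise limit is taken off this
        null set.\<close>
      proof (rule AE_mp[OF AE_lborel_singleton[of 0]], rule AE_I2, rule impI)
        fix u :: "real \<times> real" assume u: "u \<noteq> 0"
        have "(\<lambda>n. m * (1 / 2) ^ n) \<longlonglongrightarrow> m * 0"
          by (intro tendsto_mult_left LIMSEQ_realpow_zero) auto
        then have "\<forall>\<^sub>F n in sequentially. m * (1 / 2) ^ n < norm u"
          using u by (intro order_tendstoD(2)) auto
        then have "\<forall>\<^sub>F n in sequentially. ennreal ((cmod (\<phi> (u - lattice_point k)))\<^sup>2) * indicator (B n \<inter> Q) u = 0"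
        proof (rule eventually_mono)
          fix n assume "m * (1 / 2) ^ n < norm u"
          then have "u \<notin> B n" unfolding half_power by (simp add: B_def)
          then show "ennreal ((cmod (\<phi> (u - lattice_point k)))\<^sup>2) * indicator (B n \<inter> Q) u = 0" by simp
        qed
        then show "(\<lambda>n. ennreal ((cmod (\<phi> (u - lattice_point k)))\<^sup>2) * indicator (B n \<inter> Q) u) \<longlonglongrightarrow> 0"
          by (rule tendsto_eventually)
      qed
    qed (auto split: split_indicator)
    then show ?thesis by simp
  qed
  have csum: "(\<lambda>n. \<integral>\<^sup>+k. c n k \<partial>count_space UNIV) \<longlonglongrightarrow> 0"
  proof -
    have "(\<lambda>n. \<integral>\<^sup>+k. c n k \<partial>count_space UNIV) \<longlonglongrightarrow> (\<integral>\<^sup>+k. (0 :: ennreal) \<partial>count_space (UNIV :: (int \<times> int) set))"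
      by (rule nn_integral_dominated_convergence[where w=d]) (use cd dfin c0 in \<open>auto simp: AE_count_space\<close>)
    then show ?thesis by simp
  qed
  have "\<forall>\<^sub>F n in sequentially. m * (1 / 2) ^ n < 1 / 2"
  proof (rule order_tendstoD(2))
    show "(\<lambda>n. m * (1 / 2) ^ n) \<longlonglongrightarrow> m * 0"
      by (intro tendsto_mult_left LIMSEQ_realpow_zero) auto
  qed simp
  then have ev: "\<forall>\<^sub>F n in sequentially. ennreal ((lattice_norm (dilate (- int n) f))\<^sup>2)
      \<le> ennreal ((L2_norm f)\<^sup>2) * (\<integral>\<^sup>+k. c n k \<partial>count_space UNIV)"
  proof (rule eventually_mono)
    fix n assume small: "m * (1 / 2) ^ n < 1 / 2"
    define g where "g = dilate (- int n) f"
    have g: "g \<in> L2" "L2_norm g = L2_norm f"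
      unfolding g_def using f by (auto simp: dilate_L2 dilate_norm)
    have BQ: "B n \<subseteq> Q"
    proof
      fix u assume "u \<in> B n"
      then have "norm u < 1 / 2" using small unfolding half_power B_def mem_cball dist_0_norm by (rule order.strict_trans1)
      then have "\<bar>fst u\<bar> < 1 / 2" "\<bar>snd u\<bar> < 1 / 2"
        using norm_fst_le[of "fst u" "snd u"] norm_snd_le[of "snd u" "fst u"] by auto
      then show "u \<in> Q" by (cases u) (auto simp: Q_def unit_square_def)
    qed
    have g0: "g u = 0" if "u \<notin> B n" for u
    proof -
      have "norm ((2 ^ n) *\<^sub>R u) > m" using that by (simp add: B_def field_simps)
      then have "f ((2 ^ n) *\<^sub>R u) = 0" by (rule supp)
      then show ?thesis by (simp add: g_def dilate_def)
    qed
    have "ennreal ((cmod (L2_inner g (translate \<phi> k)))\<^sup>2) \<le> ennreal ((L2_norm f)\<^sup>2) * c n k" for k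
    proof -
      define h where "h u = complex_of_real (indicator (B n) u) * translate \<phi> k u" for u
      have h: "h \<in> L2"
        unfolding h_def using translate_L2[OF phi_L2]
        by (intro L2_bounded_mult) (auto split: split_indicator)
      have "L2_inner g (translate \<phi> k) = L2_inner g h"
        unfolding L2_inner_def h_def using g0
        by (intro Bochner_Integration.integral_cong refl) (auto split: split_indicator)
      then have "(cmod (L2_inner g (translate \<phi> k)))\<^sup>2 \<le> (L2_norm f * L2_norm h)\<^sup>2"
        using L2_Cauchy_Schwarz[OF g(1) h] g(2) by (auto intro!: power_mono)
      then have "ennreal ((cmod (L2_inner g (translate \<phi> k)))\<^sup>2) \<le> ennreal ((L2_norm f)\<^sup>2) * L2_mass h"
        using h by (simp add: L2_mass_eq ennreal_mult[symmetric] power_mult_distrib)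
      also have "L2_mass h = c n k"
        unfolding L2_mass_def h_def c_def translate_def using BQ
        by (intro nn_integral_cong) (auto split: split_indicator)
      finally show ?thesis .
    qed
    then have "lattice_energy \<phi> g \<le> (\<integral>\<^sup>+k. ennreal ((L2_norm f)\<^sup>2) * c n k \<partial>count_space UNIV)"
      unfolding lattice_energy_def by (intro nn_integral_mono)
    also have "\<dots> = ennreal ((L2_norm f)\<^sup>2) * (\<integral>\<^sup>+k. c n k \<partial>count_space UNIV)"
      by (rule nn_integral_cmult) simp
    finally show "ennreal ((lattice_norm (dilate (- int n) f))\<^sup>2)
      \<le> ennreal ((L2_norm f)\<^sup>2) * (\<integral>\<^sup>+k. c n k \<partial>count_space UNIV)"
      using g by (simp add: lattice_energy_eq g_def)
  qed
  have "(\<lambda>n. ennreal ((L2_norm f)\<^sup>2) * (\<integral>\<^sup>+k. c n k \<partial>count_space UNIV)) \<longlonglongrightarrow> ennreal ((L2_norm f)\<^sup>2) * 0"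
    by (intro ennreal_tendsto_cmult csum) auto
  then have lim: "(\<lambda>n. ennreal ((L2_norm f)\<^sup>2) * (\<integral>\<^sup>+k. c n k \<partial>count_space UNIV)) \<longlonglongrightarrow> ennreal 0" by simp
  have "(\<lambda>n. ennreal ((lattice_norm (dilate (- int n) f))\<^sup>2)) \<longlonglongrightarrow> ennreal 0"
    by (rule tendsto_sandwich[OF _ ev tendsto_const lim]) simp
  then have "(\<lambda>n. (lattice_norm (dilate (- int n) f))\<^sup>2) \<longlonglongrightarrow> 0"
    by (subst (asm) tendsto_ennreal_iff) auto
  then have "(\<lambda>n. sqrt ((lattice_norm (dilate (- int n) f))\<^sup>2)) \<longlonglongrightarrow> sqrt 0"
    by (rule tendsto_real_sqrt)
  then show ?thesis by simp
qed

theorem lattice_norm_coarse: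
  assumes f: "f \<in> L2"
  shows "(\<lambda>n. lattice_norm (dilate (- int n) f)) \<longlonglongrightarrow> 0"
proof (rule lattice_norm_limit_bounded_part[OF f _ tendsto_const])
  show "(\<lambda>n. lattice_norm (dilate (- int n) (bounded_part f m))) \<longlonglongrightarrow> 0" for m
    by (rule lattice_norm_coarse_compact[OF bounded_part_L2[OF f], of "real m"]) (auto simp: bounded_part_def)
qed

end

section \<open>The tight frame of a paraunitary filter bank\<close>

definition refine_with :: "(int \<times> int \<Rightarrow> real) \<Rightarrow> (int \<times> int) set \<Rightarrow> plane_fun \<Rightarrow> plane_fun" where
  "refine_with c K \<phi> u = (\<Sum>p\<in>K. complex_of_real (4 * c p) * \<phi> (2 *\<^sub>R u - lattice_point p))"

lemma refine_with_L2: "finite K \<Longrightarrow> \<phi> \<in> L2 \<Longrightarrow> refine_with c K \<phi> \<in> L2"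
  unfolding refine_with_def[abs_def]
  using L2_affine[of \<phi> 2 "- lattice_point p" for p] by (intro L2_sum L2_scale) auto

text \<open>The dilation is moved from the refined function to \<open>g\<close>: coefficients one
  scale up, filtered by \<open>c\<close> and downsampled, give those at scale 0. The refinement
  equation enters inside an inner product, where validity almost everywhere is enough.\<close>

lemma refine_with_coeff:
  assumes K: "finite K" and phi: "\<phi> \<in> L2" and psi: "\<psi> \<in> L2" "AE u in lborel. \<psi> u = refine_with c K \<phi> u"
    and g: "g \<in> L2"
  shows "L2_inner g (translate \<psi> k) =
    2 * (\<Sum>p\<in>K. complex_of_real (c p) * L2_inner (dilate 1 g) (translate \<phi> (k + k + p)))"
proof -
  have shift: "L2_inner g (translate h k) = L2_inner (\<lambda>u. g (u + lattice_point k)) h" if "h \<in> L2" for h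
  proof -
    have [measurable]: "g \<in> borel_measurable borel" "h \<in> borel_measurable borel" using g that by auto
    show ?thesis
      unfolding L2_inner_def translate_def
      using integral_shift[of "\<lambda>u. g u * cnj (h (u - lattice_point k))" "- lattice_point k"] by simp
  qed
  have gs: "(\<lambda>u. g (u + lattice_point k)) \<in> L2"
    using L2_shift[OF g, of "- lattice_point k"] by simp
  have "L2_inner g (translate \<psi> k) = L2_inner g (translate (refine_with c K \<phi>) k)"
    unfolding shift[OF psi(1)] shift[OF refine_with_L2[OF K phi]]
    by (rule L2_inner_cong_AE[OF psi(1) refine_with_L2[OF K phi] gs psi(2)])
  \<comment> \<open>The 4 splits into the 2 shown and the 2 inside \<open>dilate (- 1)\<close>;
    \<open>k + k\<close> is the point \<open>k\<close> in the indexing of the finer grid.\<close>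
  also have "translate (refine_with c K \<phi>) k = (\<lambda>u. \<Sum>p\<in>K. complex_of_real (2 * c p) * dilate (- 1) (translate \<phi> (k + k + p)) u)"
  proof
    fix u
    have "2 *\<^sub>R (u - lattice_point k) - lattice_point p = 2 *\<^sub>R u - lattice_point (k + k + p)" for p
      by (cases u; cases k; cases p) (simp add: lattice_point_def)
    then show "translate (refine_with c K \<phi>) k u = (\<Sum>p\<in>K. complex_of_real (2 * c p) * dilate (- 1) (translate \<phi> (k + k + p)) u)"
      unfolding translate_def refine_with_def dilate_def by (simp add: mult_ac)
  qed
  also have "L2_inner g \<dots> = (\<Sum>p\<in>K. complex_of_real (2 * c p) * L2_inner g (dilate (- 1) (translate \<phi> (k + k + p))))"
    by (subst L2_inner_sum_right) (auto simp: K g L2_inner_scale_right intro!: L2_scale dilate_L2 translate_L2 phi)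
  also have "\<dots> = 2 * (\<Sum>p\<in>K. complex_of_real (c p) * L2_inner (dilate 1 g) (translate \<phi> (k + k + p)))"
    by (simp add: dilate_inner[OF g translate_L2[OF phi]] sum_distrib_left mult.assoc)
  finally show ?thesis .
qed

text \<open>These windows are cofinal among the finite sets of integers, and for nonnegative terms
  their bounded sums control every finite partial sum. The half-open window is the one over which
  differences of consecutive values telescope to the two ends.\<close>

lemma has_sum_int_symmetric:
  fixes f :: "int \<Rightarrow> real"
  assumes nonneg: "\<And>j. f j \<ge> 0" and lim: "(\<lambda>N. sum f {- int N..<int N}) \<longlonglongrightarrow> L"
  shows "(f has_sum L) UNIV"
proof -
  have inc: "incseq (\<lambda>N. sum f {- int N..<int N})"
    using nonneg by (auto simp: incseq_def intro!: sum_mono2)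
  have fl: "filterlim (\<lambda>N. {- int N..<int N}) (finite_subsets_at_top UNIV) sequentially"
    unfolding filterlim_finite_subsets_at_top
  proof (intro allI impI)
    fix X :: "int set" assume X: "finite X \<and> X \<subseteq> UNIV"
    obtain b where b: "\<And>x. x \<in> X \<Longrightarrow> \<bar>x\<bar> \<le> b"
      using X finite_imageI[of X abs] by (metis Max_ge image_eqI)
    have "\<forall>\<^sub>F N in sequentially. nat (b + 1) \<le> N" by (rule eventually_ge_at_top)
    then show "\<forall>\<^sub>F N in sequentially. finite {- int N..<int N} \<and> X \<subseteq> {- int N..<int N} \<and> {- int N..<int N} \<subseteq> UNIV"
    proof (rule eventually_mono)
      fix N assume "nat (b + 1) \<le> N"
      then have "x \<in> {- int N..<int N}" if "x \<in> X" for x using b[OF that] by auto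
      then show "finite {- int N..<int N} \<and> X \<subseteq> {- int N..<int N} \<and> {- int N..<int N} \<subseteq> UNIV" by blast
    qed
  qed
  have "f summable_on UNIV"
  proof (rule nonneg_bdd_above_summable_on)
    show "bdd_above (sum f ` {F. F \<subseteq> UNIV \<and> finite F})"
    proof (rule bdd_aboveI2)
      fix F :: "int set" assume "F \<in> {F. F \<subseteq> UNIV \<and> finite F}"
      then have "\<forall>\<^sub>F N in sequentially. finite {- int N..<int N} \<and> F \<subseteq> {- int N..<int N} \<and> {- int N..<int N} \<subseteq> UNIV"
        using fl unfolding filterlim_finite_subsets_at_top by blast
      then obtain N where "F \<subseteq> {- int N..<int N}"
        by (auto simp: eventually_sequentially)
      then have "sum f F \<le> sum f {- int N..<int N}"
        using nonneg by (intro sum_mono2) auto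
      also have "\<dots> \<le> L" by (rule incseq_le[OF inc lim])
      finally show "sum f F \<le> L" .
    qed
  qed (use nonneg in auto)
  then have S: "(f has_sum infsum f UNIV) UNIV" by (rule has_sum_infsum)
  then have "(\<lambda>N. sum f {- int N..<int N}) \<longlonglongrightarrow> infsum f UNIV"
    unfolding has_sum_def by (rule filterlim_compose[OF _ fl])
  then have "infsum f UNIV = L" using lim LIMSEQ_unique by blast
  then show ?thesis using S by simp
qed

locale refinable_frame = paraunitary_filter_bank h K
  for h :: "nat \<Rightarrow> int \<times> int \<Rightarrow> real" and K :: "(int \<times> int) set" +
  fixes \<phi> \<Phi> :: plane_fun
  assumes FT: "has_fourier_L2 \<phi> \<Phi>"
    and Phi_le: "\<And>\<omega>. cmod (\<Phi> \<omega>) \<le> 1"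
    and Phi_lim: "\<And>\<omega>. (\<lambda>n. \<Phi> (\<omega> /\<^sub>R 2 ^ n)) \<longlonglongrightarrow> 1"
    and refinement: "AE u in lborel. \<phi> u = refine_with (h 0) K \<phi> u"
begin

lemma scaling_coeff:
  assumes "g \<in> L2"
  shows "L2_inner g (translate \<phi> k) = analysis 0 (\<lambda>n. L2_inner (dilate 1 g) (translate \<phi> n)) k"
  unfolding analysis_def using FT
  by (intro refine_with_coeff finite_K refinement assms) (auto dest: has_fourier_L2_L2)

text \<open>Keeps one of the four nonnegative channels of the energy identity.\<close>

lemma lowpass_energy_le:
  assumes s: "(\<lambda>n. (cmod (s n))\<^sup>2) summable_on UNIV"
  shows "(\<lambda>k. (cmod (analysis 0 s k))\<^sup>2) summable_on UNIV"
    and "(\<Sum>\<^sub>\<infinity>k. (cmod (analysis 0 s k))\<^sup>2) \<le> (\<Sum>\<^sub>\<infinity>n. (cmod (s n))\<^sup>2)"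
proof -
  define t where "t = (\<lambda>(i, k). (cmod (analysis i s k))\<^sup>2)"
  have t: "(t has_sum (\<Sum>\<^sub>\<infinity>n. (cmod (s n))\<^sup>2)) ({..<4} \<times> UNIV)"
    unfolding t_def by (rule analysis_energy[OF s])
  have bij: "bij_betw (\<lambda>k. (0, k)) UNIV ({0 :: nat} \<times> (UNIV :: (int \<times> int) set))"
    by (rule bij_betwI[where g=snd]) auto
  have sub: "t summable_on ({0} \<times> UNIV)"
    using has_sum_imp_summable[OF t] by (rule summable_on_subset) auto
  then show "(\<lambda>k. (cmod (analysis 0 s k))\<^sup>2) summable_on UNIV"
    using summable_on_reindex_bij_betw[OF bij, of t] by (simp add: t_def)
  have "(\<Sum>\<^sub>\<infinity>k. (cmod (analysis 0 s k))\<^sup>2) = infsum t ({0} \<times> UNIV)"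
    using infsum_reindex_bij_betw[OF bij, of t] by (simp add: t_def)
  also have "\<dots> \<le> (\<Sum>\<^sub>\<infinity>n. (cmod (s n))\<^sup>2)"
    by (rule has_sum_mono2[OF has_sum_infsum[OF sub] t]) (auto simp: t_def)
  finally show "(\<Sum>\<^sub>\<infinity>k. (cmod (analysis 0 s k))\<^sup>2) \<le> (\<Sum>\<^sub>\<infinity>n. (cmod (s n))\<^sup>2)" .
qed

text \<open>Monotonicity comes from the lowpass channel, with the infinite case split off. A Bessel
  bound cannot be invoked here, since it is a consequence of monotonicity.\<close>

sublocale refinable_energy \<phi> \<Phi>
proof
  fix g assume g: "g \<in> L2"
  define s where "s n = L2_inner (dilate 1 g) (translate \<phi> n)" for n
  show "lattice_energy \<phi> g \<le> lattice_energy \<phi> (dilate 1 g)"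
  proof (cases "lattice_energy \<phi> (dilate 1 g) < \<infinity>")
    case True
    then have s: "(\<lambda>n. (cmod (s n))\<^sup>2) summable_on UNIV"
      unfolding lattice_energy_def s_def by (intro summable_on_if_nn_integral_finite) auto
    have "lattice_energy \<phi> g = ennreal (\<Sum>\<^sub>\<infinity>k. (cmod (analysis 0 s k))\<^sup>2)"
      unfolding lattice_energy_def scaling_coeff[OF g] s_def[symmetric]
      by (rule nn_integral_count_space_infsum[OF _ lowpass_energy_le(1)[OF s]]) simp
    also have "\<dots> \<le> ennreal (\<Sum>\<^sub>\<infinity>n. (cmod (s n))\<^sup>2)"
      by (rule ennreal_leI[OF lowpass_energy_le(2)[OF s]])
    also have "\<dots> = lattice_energy \<phi> (dilate 1 g)"
      unfolding lattice_energy_def s_def[symmetric]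
      by (rule nn_integral_count_space_infsum[OF _ s, symmetric]) simp
    finally show ?thesis .
  qed (simp add: less_top[symmetric])
qed (fact FT Phi_le Phi_lim)+

text \<open>All four channels together carry the energy of \<open>dilate 1 g\<close>, and the
  lowpass channel carries that of \<open>g\<close>; the wavelet channels are the difference.\<close>

lemma wavelet_scale_energy:
  assumes g: "g \<in> L2" and psi: "\<And>i. i \<in> {1, 2, 3} \<Longrightarrow> \<psi> i \<in> L2"
    "\<And>i. i \<in> {1, 2, 3} \<Longrightarrow> AE u in lborel. \<psi> i u = refine_with (h i) K \<phi> u"
  shows "((\<lambda>(i, k). (cmod (L2_inner g (translate (\<psi> i) k)))\<^sup>2) has_sum
      ((lattice_norm (dilate 1 g))\<^sup>2 - (lattice_norm g)\<^sup>2)) ({1, 2, 3} \<times> UNIV)"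
proof -
  define s where "s n = L2_inner (dilate 1 g) (translate \<phi> n)" for n
  define t where "t = (\<lambda>(i, k). (cmod (analysis i s k))\<^sup>2)"
  have s: "(\<lambda>n. (cmod (s n))\<^sup>2) summable_on UNIV"
    unfolding s_def by (intro coeff_summable dilate_L2 g)
  have t: "(t has_sum (lattice_norm (dilate 1 g))\<^sup>2) ({..<4} \<times> UNIV)"
    using analysis_energy[OF s] unfolding t_def lattice_norm_sq s_def .
  have bij: "bij_betw (\<lambda>k. (0, k)) UNIV ({0 :: nat} \<times> (UNIV :: (int \<times> int) set))"
    by (rule bij_betwI[where g=snd]) auto
  have "((\<lambda>k. t (0, k)) has_sum (lattice_norm g)\<^sup>2) UNIV"
    unfolding t_def lattice_norm_sq scaling_coeff[OF g] s_def[symmetric] prod.case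
    by (rule has_sum_infsum[OF lowpass_energy_le(1)[OF s]])
  then have t0: "(t has_sum (lattice_norm g)\<^sup>2) ({0} \<times> UNIV)"
    using has_sum_reindex_bij_betw[OF bij, of t] by simp
  have "(t has_sum ((lattice_norm (dilate 1 g))\<^sup>2 - (lattice_norm g)\<^sup>2)) ({..<4} \<times> UNIV - {0} \<times> UNIV)"
    by (rule has_sum_Diff[OF t t0]) auto
  also have "({..<4} \<times> UNIV - {0} \<times> UNIV) = ({1, 2, 3 :: nat} \<times> (UNIV :: (int \<times> int) set))"
    by auto
  finally show ?thesis
  proof (rule has_sum_cong[THEN iffD1, rotated])
    fix x assume x: "x \<in> {1, 2, 3 :: nat} \<times> (UNIV :: (int \<times> int) set)"
    then have i: "fst x \<in> {1, 2, 3}" by auto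
    have "L2_inner g (translate (\<psi> (fst x)) (snd x)) = analysis (fst x) s (snd x)"
      unfolding analysis_def s_def
      by (intro refine_with_coeff finite_K psi i g phi_L2)
    then show "t x = (case x of (i, k) \<Rightarrow> (cmod (L2_inner g (translate (\<psi> i) k)))\<^sup>2)"
      by (simp add: t_def case_prod_unfold)
  qed
qed

theorem tight_frame:
  assumes psi: "\<And>i. i \<in> {1, 2, 3} \<Longrightarrow> \<psi> i \<in> L2"
    "\<And>i. i \<in> {1, 2, 3} \<Longrightarrow> AE u in lborel. \<psi> i u = refine_with (h i) K \<phi> u"
  shows "tight_frame_L2 ({1, 2, 3} \<times> UNIV \<times> UNIV) (wavelet_system \<psi>)"
proof -
  \<comment> \<open>A member at scale \<open>j\<close> is the inverse dilation of a translate, so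
    its coefficient on \<open>f\<close> is a scale-0 coefficient of
    \<open>dilate j f\<close>.\<close>
  have ws: "wavelet_system \<psi> (i, j, k) = dilate (- j) (translate (\<psi> i) k)" for i j k
    by (auto simp: wavelet_system_def dilate_def translate_def)
  have sum: "((\<lambda>n. (cmod (L2_inner f (wavelet_system \<psi> n)))\<^sup>2) has_sum (L2_norm f)\<^sup>2) ({1, 2, 3} \<times> UNIV \<times> UNIV)"
    if f: "f \<in> L2" for f
  proof -
    define a where "a j = (lattice_norm (dilate j f))\<^sup>2" for j
    define t where "t = (\<lambda>(j, i, k). (cmod (L2_inner (dilate j f) (translate (\<psi> i) k)))\<^sup>2)"
    have inner: "((\<lambda>y. t (j, y)) has_sum (a (j + 1) - a j)) ({1, 2, 3} \<times> UNIV)" for j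
      using wavelet_scale_energy[OF dilate_L2[OF f] psi, of j] unfolding t_def a_def
      by (simp add: dilate_dilate add.commute case_prod_unfold)
    have "a (j + 1) - a j \<ge> 0" for j
      using inner[of j] by (rule has_sum_nonneg) (auto simp: t_def)
    moreover have "(\<lambda>N. \<Sum>j = - int N..<int N. a (j + 1) - a j) \<longlonglongrightarrow> (L2_norm f)\<^sup>2"
    proof -
      have "(\<Sum>j = - int N..<int N. a (j + 1) - a j) = a (int N) - a (- int N)" for N
      proof (induction N)
        case (Suc N)
        have "{- int (Suc N)..<int (Suc N)} = insert (- 1 - int N) (insert (int N) {- int N..<int N})" by auto
        then show ?case using Suc.IH by (simp add: algebra_simps)
      qed simp
      moreover have "(\<lambda>N. a (int N) - a (- int N)) \<longlonglongrightarrow> (L2_norm f)\<^sup>2 - 0\<^sup>2"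
        unfolding a_def by (intro tendsto_intros lattice_norm_fine lattice_norm_coarse f)
      ultimately show ?thesis by simp
    qed
    ultimately have "((\<lambda>j. a (j + 1) - a j) has_sum (L2_norm f)\<^sup>2) UNIV"
      by (rule has_sum_int_symmetric)
    then have t: "(t has_sum (L2_norm f)\<^sup>2) (UNIV \<times> {1, 2, 3} \<times> UNIV)"
      by (rule nonneg_has_sum_Sigma[where B="\<lambda>_. {1, 2, 3} \<times> UNIV", OF inner]) (auto simp: t_def)
    have "bij_betw (\<lambda>(i, j, k). (j, i, k)) ({1, 2, 3 :: nat} \<times> (UNIV :: int set) \<times> (UNIV :: (int \<times> int) set)) (UNIV \<times> {1, 2, 3} \<times> UNIV)"
      by (rule bij_betwI[where g="\<lambda>(j, i, k). (i, j, k)"]) auto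
    from has_sum_reindex_bij_betw[OF this, of t] t
    have "((\<lambda>x. t (case x of (i, j, k) \<Rightarrow> (j, i, k))) has_sum (L2_norm f)\<^sup>2) ({1, 2, 3} \<times> UNIV \<times> UNIV)" by simp
    then show ?thesis
    proof (rule has_sum_cong[THEN iffD1, rotated])
      fix x assume x: "x \<in> {1, 2, 3 :: nat} \<times> (UNIV :: int set) \<times> (UNIV :: (int \<times> int) set)"
      obtain i j k where x_eq: "x = (i, j, k)" by (cases x)
      have "L2_inner f (wavelet_system \<psi> x) = L2_inner (dilate j f) (translate (\<psi> i) k)"
        unfolding x_eq ws using dilate_inner[OF f translate_L2[OF psi(1)]] x x_eq by auto
      then show "t (case x of (i, j, k) \<Rightarrow> (j, i, k)) = (cmod (L2_inner f (wavelet_system \<psi> x)))\<^sup>2"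
        by (simp add: t_def x_eq)
    qed
  qed
  show ?thesis
    unfolding tight_frame_L2_def
  \<comment> \<open>The energies rise from 0 to the squared norm itself, so the frame constant is
    1.\<close>
  proof (intro conjI ballI exI[of _ 1])
    fix n assume "n \<in> {1, 2, 3 :: nat} \<times> (UNIV :: int set) \<times> (UNIV :: (int \<times> int) set)"
    then show "wavelet_system \<psi> n \<in> L2"
      by (cases n) (auto simp: ws intro!: dilate_L2 translate_L2 psi(1))
  qed (use sum in \<open>auto simp: L2_norm_sq\<close>)
qed

end

section \<open>The infinite product of a refinement mask\<close>

text \<open>The outer quarters of the interval are moved inwards, the left one by \<open>T\<close>
  and the right one by \<open>- T\<close>. These shifts differ by the period, so both pieces become
  parts of the integral of \<open>h (x + T)\<close>.\<close>

lemma nn_integral_periodic_halve: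
  fixes h :: "real \<Rightarrow> ennreal"
  assumes [measurable]: "h \<in> borel_measurable borel" and per: "\<And>x. h (x + 2 * T) = h x" and T: "T > 0"
  shows "(\<integral>\<^sup>+x. h x * indicator {- T..<T} x \<partial>lborel)
    = (\<integral>\<^sup>+x. (h x + h (x + T)) * indicator {- (T / 2)..<T / 2} x \<partial>lborel)"
proof -
  have shift: "(\<integral>\<^sup>+x. f x \<partial>lborel) = (\<integral>\<^sup>+x. f (x + t) \<partial>lborel)" if "f \<in> borel_measurable borel" for f :: "real \<Rightarrow> ennreal" and t
    using nn_integral_real_affine[OF that, of 1 t] by (simp add: add.commute)
  have "(\<integral>\<^sup>+x. h x * indicator {- T..<T} x \<partial>lborel)
      = (\<integral>\<^sup>+x. h x * indicator {- T..<- (T / 2)} x + (h x * indicator {- (T / 2)..<T / 2} x + h x * indicator {T / 2..<T} x) \<partial>lborel)"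
    using T by (intro nn_integral_cong) (auto split: split_indicator)
  also have "\<dots> = (\<integral>\<^sup>+x. h x * indicator {- T..<- (T / 2)} x \<partial>lborel)
      + ((\<integral>\<^sup>+x. h x * indicator {- (T / 2)..<T / 2} x \<partial>lborel) + (\<integral>\<^sup>+x. h x * indicator {T / 2..<T} x \<partial>lborel))"
    by (simp add: nn_integral_add)
  also have "(\<integral>\<^sup>+x. h x * indicator {- T..<- (T / 2)} x \<partial>lborel) = (\<integral>\<^sup>+x. h (x + T) * indicator {0..<T / 2} x \<partial>lborel)"
  proof (subst shift[of _ "- T"], simp, rule nn_integral_cong)
    fix x
    have "h (x + T) = h (x + - T)" using per[of "x - T"] by (simp add: algebra_simps)
    then show "h (x + - T) * indicator {- T..<- (T / 2)} (x + - T) = h (x + T) * indicator {0..<T / 2} x"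
      by (auto split: split_indicator)
  qed
  also have "(\<integral>\<^sup>+x. h x * indicator {T / 2..<T} x \<partial>lborel) = (\<integral>\<^sup>+x. h (x + T) * indicator {- (T / 2)..<0} x \<partial>lborel)"
    by (subst shift[of _ T], simp, rule nn_integral_cong) (auto split: split_indicator)
  also have "(\<integral>\<^sup>+x. h (x + T) * indicator {0..<T / 2} x \<partial>lborel)
      + ((\<integral>\<^sup>+x. h x * indicator {- (T / 2)..<T / 2} x \<partial>lborel) + (\<integral>\<^sup>+x. h (x + T) * indicator {- (T / 2)..<0} x \<partial>lborel))
      = (\<integral>\<^sup>+x. h (x + T) * indicator {0..<T / 2} x + (h x * indicator {- (T / 2)..<T / 2} x + h (x + T) * indicator {- (T / 2)..<0} x) \<partial>lborel)"
    by (simp add: nn_integral_add)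
  also have "\<dots> = (\<integral>\<^sup>+x. (h x + h (x + T)) * indicator {- (T / 2)..<T / 2} x \<partial>lborel)"
    using T by (intro nn_integral_cong) (auto split: split_indicator simp: add.commute)
  finally show ?thesis .
qed

lemma abs_fst_snd_le_norm: "\<bar>fst z\<bar> \<le> norm z" "\<bar>snd z\<bar> \<le> norm z" for z :: "real \<times> real"
  using norm_fst_le[of "fst z" "snd z"] norm_snd_le[of "snd z" "fst z"] by auto

definition centered_square :: "real \<Rightarrow> (real \<times> real) set" where
  "centered_square T = {- T..<T} \<times> {- T..<T}"

lemma measurable_centered_square [measurable]: "centered_square T \<in> sets borel"
  unfolding centered_square_def borel_prod[symmetric] by measurable

lemma nn_integral_periodic_halve_plane:
  fixes F :: "real \<times> real \<Rightarrow> ennreal"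
  assumes [measurable]: "F \<in> borel_measurable borel" and T: "T > 0"
    and per: "\<And>x y. F (x + 2 * T, y) = F (x, y)" "\<And>x y. F (x, y + 2 * T) = F (x, y)"
  shows "(\<integral>\<^sup>+w. F w * indicator (centered_square T) w \<partial>lborel)
    = (\<integral>\<^sup>+w. (F w + F (w + (0, T)) + F (w + (T, 0)) + F (w + (T, T))) * indicator (centered_square (T / 2)) w \<partial>lborel)"
proof -
  have iter: "(\<integral>\<^sup>+w. G w * indicator (centered_square t) w \<partial>lborel)
      = (\<integral>\<^sup>+x. (\<integral>\<^sup>+y. G (x, y) * indicator {- t..<t} y \<partial>lborel) * indicator {- t..<t} x \<partial>lborel)"
    if [measurable]: "G \<in> borel_measurable borel" for G :: "real \<times> real \<Rightarrow> ennreal" and t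
  proof -
    have "(\<integral>\<^sup>+w. G w * indicator (centered_square t) w \<partial>lborel)
        = (\<integral>\<^sup>+w. G w * indicator (centered_square t) w \<partial>(lborel \<Otimes>\<^sub>M lborel))"
      by (simp add: lborel_prod)
    also have "\<dots> = (\<integral>\<^sup>+x. \<integral>\<^sup>+y. G (x, y) * indicator (centered_square t) (x, y) \<partial>lborel \<partial>lborel)"
      by (rule lborel.nn_integral_fst[symmetric]) (simp add: lborel_prod)
    also have "\<dots> = (\<integral>\<^sup>+x. (\<integral>\<^sup>+y. G (x, y) * indicator {- t..<t} y \<partial>lborel) * indicator {- t..<t} x \<partial>lborel)"
      by (intro nn_integral_cong, subst nn_integral_multc[symmetric])
         (auto simp: centered_square_def indicator_times mult_ac)
    finally show ?thesis .
  qed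
  define H where "H x = (\<integral>\<^sup>+y. (F (x, y) + F (x, y + T)) * indicator {- (T / 2)..<T / 2} y \<partial>lborel)" for x
  have [measurable]: "H \<in> borel_measurable borel" unfolding H_def by measurable
  have H: "(\<integral>\<^sup>+y. F (x, y) * indicator {- T..<T} y \<partial>lborel) = H x" for x
    unfolding H_def by (rule nn_integral_periodic_halve) (use per T in auto)
  have Hper: "H (x + 2 * T) = H x" for x
    unfolding H_def per(1) ..
  have "(\<integral>\<^sup>+w. F w * indicator (centered_square T) w \<partial>lborel)
      = (\<integral>\<^sup>+x. H x * indicator {- T..<T} x \<partial>lborel)"
    by (subst iter) (simp_all add: H)
  also have "\<dots> = (\<integral>\<^sup>+x. (H x + H (x + T)) * indicator {- (T / 2)..<T / 2} x \<partial>lborel)"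
    by (rule nn_integral_periodic_halve) (use Hper T in auto)
  also have "\<dots> = (\<integral>\<^sup>+w. (F w + F (w + (0, T)) + F (w + (T, 0)) + F (w + (T, T))) * indicator (centered_square (T / 2)) w \<partial>lborel)"
    unfolding H_def
    by (subst iter) (auto simp: nn_integral_add[symmetric] algebra_simps intro!: nn_integral_cong)
  finally show ?thesis .
qed

locale refinement_product =
  fixes M :: plane_fun and L :: real
  assumes measurable_M [measurable]: "M \<in> borel_measurable borel"
    and M_0: "M 0 = 1"
    and M_le: "\<And>\<omega>. cmod (M \<omega>) \<le> 1"
    and L_pos: "L > 0"
    and M_lipschitz: "\<And>\<omega> \<eta>. cmod (M \<omega> - M \<eta>) \<le> L * norm (\<omega> - \<eta>)"
    and M_period: "\<And>\<omega>. M (\<omega> + (2 * pi, 0)) = M \<omega>" "\<And>\<omega>. M (\<omega> + (0, 2 * pi)) = M \<omega>"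
    and M_qmf: "\<And>\<omega>. (cmod (M \<omega>))\<^sup>2 + (cmod (M (\<omega> + (0, pi))))\<^sup>2
        + (cmod (M (\<omega> + (pi, 0))))\<^sup>2 + (cmod (M (\<omega> + (pi, pi))))\<^sup>2 = 1"
begin

definition partial_product :: "nat \<Rightarrow> plane_fun" where
  "partial_product n \<omega> = (\<Prod>k<n. M (\<omega> /\<^sub>R 2 ^ Suc k))"

definition full_product :: plane_fun where
  "full_product \<omega> = (\<Prod>k. M (\<omega> /\<^sub>R 2 ^ Suc k))"

lemma measurable_partial_product [measurable]: "partial_product n \<in> borel_measurable borel"
  unfolding partial_product_def by measurable

lemma M_near_1: "cmod (M (\<omega> /\<^sub>R 2 ^ Suc k) - 1) \<le> L * norm \<omega> * (1 / 2) ^ Suc k"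
  using M_lipschitz[of "\<omega> /\<^sub>R 2 ^ Suc k" 0] by (simp add: M_0 power_one_over field_simps)

lemma half_powers: "(\<Sum>k<n. (1 / 2 :: real) ^ Suc k) \<le> 1"
proof -
  have "(\<Sum>k<n. (1 / 2 :: real) ^ Suc k) = 1 - (1 / 2) ^ n"
    by (induction n) auto
  then show ?thesis by simp
qed

text \<open>\<open>M\<close> is 1 at the origin and Lipschitz, so the factors differ from 1 by a
  geometric sequence and the product converges absolutely.\<close>

lemma partial_product_lim: "(\<lambda>n. partial_product n \<omega>) \<longlonglongrightarrow> full_product \<omega>"
proof -
  have "summable (\<lambda>k. norm (M (\<omega> /\<^sub>R 2 ^ Suc k) - 1))"
  proof (rule summable_comparison_test')
    show "summable (\<lambda>k. L * norm \<omega> * (1 / 2) ^ Suc k)"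
      by (intro summable_mult) (simp add: summable_Suc_iff)
    show "norm (norm (M (\<omega> /\<^sub>R 2 ^ Suc k) - 1)) \<le> L * norm \<omega> * (1 / 2) ^ Suc k" if "k \<ge> 0" for k
      using M_near_1[of k \<omega>] by simp
  qed
  then have "convergent_prod (\<lambda>k. M (\<omega> /\<^sub>R 2 ^ Suc k))"
    using abs_convergent_prod_conv_summable abs_convergent_prod_imp_convergent_prod by blast
  then have "(\<lambda>n. \<Prod>k\<le>n. M (\<omega> /\<^sub>R 2 ^ Suc k)) \<longlonglongrightarrow> full_product \<omega>"
    unfolding full_product_def by (rule convergent_prod_LIMSEQ)
  then have "(\<lambda>n. partial_product (Suc n) \<omega>) \<longlonglongrightarrow> full_product \<omega>"
    by (simp only: partial_product_def lessThan_Suc_atMost)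
  then show ?thesis by (rule LIMSEQ_imp_Suc)
qed

lemma partial_product_le: "cmod (partial_product n \<omega>) \<le> 1"
  unfolding partial_product_def prod_norm[symmetric] by (intro prod_le_1) (auto simp: M_le)

lemma full_product_le: "cmod (full_product \<omega>) \<le> 1"
  by (rule LIMSEQ_le_const2[OF tendsto_norm[OF partial_product_lim]]) (use partial_product_le in auto)

lemma full_product_refine: "full_product \<omega> = M (\<omega> /\<^sub>R 2) * full_product (\<omega> /\<^sub>R 2)"
proof -
  have "partial_product (Suc n) \<omega> = M (\<omega> /\<^sub>R 2) * partial_product n (\<omega> /\<^sub>R 2)" for n
    unfolding partial_product_def by (subst prod.lessThan_Suc_shift) (simp add: mult_ac)
  then have "(\<lambda>n. partial_product (Suc n) \<omega>) \<longlonglongrightarrow> M (\<omega> /\<^sub>R 2) * full_product (\<omega> /\<^sub>R 2)"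
    using tendsto_mult_left[OF partial_product_lim[of "\<omega> /\<^sub>R 2"], of "M (\<omega> /\<^sub>R 2)"] by simp
  then show ?thesis
    using LIMSEQ_unique LIMSEQ_Suc[OF partial_product_lim[of \<omega>]] by blast
qed

text \<open>Products of factors of modulus at most 1 differ by at most the sum of the differences of
  the factors, and the powers of 1/2 sum to at most 1.\<close>

lemma full_product_near_1: "cmod (full_product \<omega> - 1) \<le> L * norm \<omega>"
proof (rule LIMSEQ_le_const2[OF tendsto_norm[OF tendsto_diff[OF partial_product_lim tendsto_const]]])
  have "cmod (partial_product n \<omega> - 1) \<le> L * norm \<omega>" for n
  proof -
    have "cmod ((\<Prod>k<n. M (\<omega> /\<^sub>R 2 ^ Suc k)) - (\<Prod>k<n. 1)) \<le> (\<Sum>k<n. cmod (M (\<omega> /\<^sub>R 2 ^ Suc k) - 1))"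
      by (rule norm_prod_diff) (auto simp: M_le)
    also have "\<dots> \<le> (\<Sum>k<n. L * norm \<omega> * (1 / 2) ^ Suc k)"
      by (intro sum_mono M_near_1)
    also have "\<dots> = L * norm \<omega> * (\<Sum>k<n. (1 / 2) ^ Suc k)"
      by (simp only: sum_distrib_left)
    also have "\<dots> \<le> L * norm \<omega> * 1"
      using L_pos by (intro mult_left_mono half_powers) auto
    finally show ?thesis by (simp add: partial_product_def)
  qed
  then show "\<exists>N. \<forall>n\<ge>N. cmod (partial_product n \<omega> - 1) \<le> L * norm \<omega>" by blast
qed

lemma full_product_lim: "(\<lambda>n. full_product (\<omega> /\<^sub>R 2 ^ n)) \<longlonglongrightarrow> 1"
proof -
  have "(\<lambda>n. full_product (\<omega> /\<^sub>R 2 ^ n) - 1) \<longlonglongrightarrow> 0"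
  proof (rule Lim_null_comparison)
    show "\<forall>\<^sub>F n in sequentially. norm (full_product (\<omega> /\<^sub>R 2 ^ n) - 1) \<le> L * norm \<omega> * (1 / 2) ^ n"
    proof (rule always_eventually, rule allI)
      fix n
      show "norm (full_product (\<omega> /\<^sub>R 2 ^ n) - 1) \<le> L * norm \<omega> * (1 / 2) ^ n"
        using full_product_near_1[of "\<omega> /\<^sub>R 2 ^ n"] by (simp add: power_one_over field_simps)
    qed
    show "(\<lambda>n. L * norm \<omega> * (1 / 2) ^ n) \<longlonglongrightarrow> 0"
      using tendsto_mult_left[OF LIMSEQ_realpow_zero[of "1 / 2"], of "L * norm \<omega>"] by simp
  qed
  then show ?thesis by (rule Lim_null[THEN iffD2])
qed

lemma M_period_nat: "M (\<omega> + (real j * (2 * pi), 0)) = M \<omega>" "M (\<omega> + (0, real j * (2 * pi))) = M \<omega>"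
proof (induction j)
  case (Suc j)
  case 1
  have "M (\<omega> + (real (Suc j) * (2 * pi), 0)) = M ((\<omega> + (real j * (2 * pi), 0)) + (2 * pi, 0))"
    by (rule arg_cong[of _ _ M]) (cases \<omega>, simp add: algebra_simps)
  then show ?case using Suc(1) by (simp only: M_period(1))
next
  case (Suc j)
  case 2
  have "M (\<omega> + (0, real (Suc j) * (2 * pi))) = M ((\<omega> + (0, real j * (2 * pi))) + (0, 2 * pi))"
    by (rule arg_cong[of _ _ M]) (cases \<omega>, simp add: algebra_simps)
  then show ?case using Suc(2) by (simp only: M_period(2))
qed (auto simp: zero_prod_def[symmetric])

lemma partial_product_period:
  "partial_product n (\<omega> + (2 ^ n * (2 * pi), 0)) = partial_product n \<omega>"
  "partial_product n (\<omega> + (0, 2 ^ n * (2 * pi))) = partial_product n \<omega>"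
proof -
  have eq: "2 ^ n * (2 * pi) / 2 ^ Suc k = real (2 ^ (n - Suc k)) * (2 * pi)" if "k < n" for k
  proof -
    have "2 ^ n = (2 :: real) ^ (n - Suc k) * 2 ^ Suc k"
      using that by (simp only: power_add[symmetric]) simp
    then show ?thesis by simp
  qed
  have "M ((\<omega> + (2 ^ n * (2 * pi), 0)) /\<^sub>R 2 ^ Suc k) = M (\<omega> /\<^sub>R 2 ^ Suc k)" if "k < n" for k
    using M_period_nat(1)[of "\<omega> /\<^sub>R 2 ^ Suc k" "2 ^ (n - Suc k)"] unfolding eq[OF that, symmetric]
    by (simp only: scaleR_add_right scaleR_Pair) (simp add: field_simps)
  then show "partial_product n (\<omega> + (2 ^ n * (2 * pi), 0)) = partial_product n \<omega>"
    unfolding partial_product_def by (intro prod.cong) auto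
  have "M ((\<omega> + (0, 2 ^ n * (2 * pi))) /\<^sub>R 2 ^ Suc k) = M (\<omega> /\<^sub>R 2 ^ Suc k)" if "k < n" for k
    using M_period_nat(2)[of "\<omega> /\<^sub>R 2 ^ Suc k" "2 ^ (n - Suc k)"] unfolding eq[OF that, symmetric]
    by (simp only: scaleR_add_right scaleR_Pair) (simp add: field_simps)
  then show "partial_product n (\<omega> + (0, 2 ^ n * (2 * pi))) = partial_product n \<omega>"
    unfolding partial_product_def by (intro prod.cong) auto
qed

text \<open>In the step, fold the square with \<open>T = 2 ^ n * (2 * pi)\<close>. The first
  \<open>n\<close> factors have period \<open>T\<close> and are unaffected, the argument of the last
  factor moves by \<open>pi\<close>, and the quadrature identity sums its four squared moduli to
  1.\<close>

lemma partial_product_mass: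
  "(\<integral>\<^sup>+\<omega>. ennreal ((cmod (partial_product n \<omega>))\<^sup>2) * indicator (centered_square (2 ^ n * pi)) \<omega> \<partial>lborel)
    = ennreal (4 * pi\<^sup>2)"
proof (induction n)
  case 0
  have "emeasure lborel (centered_square pi) = ennreal (4 * pi\<^sup>2)"
    unfolding centered_square_def lborel_prod[symmetric]
    by (subst lborel.emeasure_pair_measure_Times) (auto simp: ennreal_mult[symmetric] power2_eq_square)
  then show ?case by (simp add: partial_product_def)
next
  case (Suc n)
  define T where "T = 2 ^ Suc n * pi"
  have T: "T > 0" "T / 2 = 2 ^ n * pi" "T = 2 ^ n * (2 * pi)" by (auto simp: T_def)
  define F where "F \<omega> = ennreal ((cmod (partial_product (Suc n) \<omega>))\<^sup>2)" for \<omega>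
  have [measurable]: "F \<in> borel_measurable borel" unfolding F_def by measurable
  have P2: "2 * T = 2 ^ Suc n * (2 * pi)" by (simp add: T_def)
  have per: "F (x + 2 * T, y) = F (x, y)" "F (x, y + 2 * T) = F (x, y)" for x y
    using partial_product_period[of "Suc n" "(x, y)"] unfolding F_def P2 by simp_all
  have step: "F (\<omega> + v) = ennreal ((cmod (partial_product n \<omega>))\<^sup>2 * (cmod (M (\<omega> /\<^sub>R 2 ^ Suc n + v /\<^sub>R 2 ^ Suc n)))\<^sup>2)"
    if "partial_product n (\<omega> + v) = partial_product n \<omega>" for \<omega> v
    using that unfolding F_def by (simp add: partial_product_def norm_mult power_mult_distrib scaleR_add_right)
  have TT: "T /\<^sub>R 2 ^ Suc n = pi" by (simp add: T_def)
  have pp: "partial_product n (\<omega> + (0, T)) = partial_product n \<omega>" "partial_product n (\<omega> + (T, 0)) = partial_product n \<omega>" for \<omega>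
    unfolding T(3) by (rule partial_product_period)+
  have pp2: "partial_product n (\<omega> + (T, T)) = partial_product n \<omega>" for \<omega>
    using pp(1)[of "\<omega> + (T, 0)"] pp(2)[of \<omega>] by (simp add: add.assoc)
  have sum: "F \<omega> + F (\<omega> + (0, T)) + F (\<omega> + (T, 0)) + F (\<omega> + (T, T)) = ennreal ((cmod (partial_product n \<omega>))\<^sup>2)" for \<omega>
  proof -
    have "F \<omega> + F (\<omega> + (0, T)) + F (\<omega> + (T, 0)) + F (\<omega> + (T, T))
        = ennreal ((cmod (partial_product n \<omega>))\<^sup>2 * ((cmod (M (\<omega> /\<^sub>R 2 ^ Suc n)))\<^sup>2
          + (cmod (M (\<omega> /\<^sub>R 2 ^ Suc n + (0, pi))))\<^sup>2 + (cmod (M (\<omega> /\<^sub>R 2 ^ Suc n + (pi, 0))))\<^sup>2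
          + (cmod (M (\<omega> /\<^sub>R 2 ^ Suc n + (pi, pi))))\<^sup>2))"
      using step[of \<omega> 0] step[OF pp(1)] step[OF pp(2)] step[OF pp2]
      unfolding scaleR_Pair TT by (simp add: ennreal_plus[symmetric] distrib_left del: ennreal_plus)
    then show ?thesis unfolding M_qmf by simp
  qed
  have "(\<integral>\<^sup>+\<omega>. F \<omega> * indicator (centered_square T) \<omega> \<partial>lborel)
      = (\<integral>\<^sup>+w. (F w + F (w + (0, T)) + F (w + (T, 0)) + F (w + (T, T))) * indicator (centered_square (T / 2)) w \<partial>lborel)"
    by (rule nn_integral_periodic_halve_plane[OF _ T(1) per]) measurable
  then show ?case unfolding sum T(2) Suc.IH by (simp add: F_def T_def)
qed

text \<open>The mass of the truncated products near \<open>2 ^ n *\<^sub>R \<theta>\<close> stays bounded below while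
  these points run off to infinity, so it is lost in the limit.\<close>

theorem full_product_mass_less:
  assumes \<theta>: "\<theta> \<noteq> 0" "\<bar>fst \<theta>\<bar> < pi" "\<bar>snd \<theta>\<bar> < pi"
    and cycle: "\<And>j. cmod (M (2 ^ j *\<^sub>R \<theta>)) = 1"
  shows "L2_mass full_product < ennreal (4 * pi\<^sup>2)"
proof -
  \<comment> \<open>The first bound keeps the product of nearly unimodular factors at least 1/2; the
    other two keep the balls inside the squares of integration.\<close>
  define \<delta> where "\<delta> = min (1 / (2 * L)) (min (pi - \<bar>fst \<theta>\<bar>) (pi - \<bar>snd \<theta>\<bar>))"
  have \<delta>: "\<delta> > 0" "L * \<delta> \<le> 1 / 2" "\<bar>fst \<theta>\<bar> + \<delta> \<le> pi" "\<bar>snd \<theta>\<bar> + \<delta> \<le> pi"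
  proof -
    show "\<delta> > 0" unfolding \<delta>_def using \<theta> L_pos by auto
    have "L * \<delta> \<le> L * (1 / (2 * L))" using L_pos by (intro mult_left_mono) (auto simp: \<delta>_def)
    then show "L * \<delta> \<le> 1 / 2" using L_pos by simp
  qed (auto simp: \<delta>_def)
  define D where "D n = centered_square (2 ^ n * pi)" for n :: nat
  define B where "B n = ball (2 ^ n *\<^sub>R \<theta>) \<delta>" for n :: nat
  have [measurable]: "D n \<in> sets borel" "B n \<in> sets borel" for n
    by (auto simp: D_def B_def)
  define v where "v = measure lborel (ball (0 :: real \<times> real) \<delta>)"
  have vfin: "emeasure lborel (B n) = ennreal v" for n
  proof -
    have fin: "emeasure lborel (B n) < \<infinity>"
      unfolding B_def using emeasure_lborel_ball_finite[of "2 ^ n *\<^sub>R \<theta>" \<delta>] by (simp add: less_top)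
    have "measure lborel (B n) = v"
      unfolding B_def v_def using content_ball_conv_unit_ball[of \<delta> "2 ^ n *\<^sub>R \<theta>"] content_ball_conv_unit_ball[of \<delta> "0 :: real \<times> real"] \<delta>(1)
      by simp
    then show ?thesis using fin by (simp add: emeasure_eq_ennreal_measure less_top)
  qed
  have v: "v > 0" unfolding v_def using content_ball_pos[OF \<delta>(1)] .
  have BD: "B n \<subseteq> D n" for n
  proof
    fix \<omega> assume "\<omega> \<in> B n"
    then have d: "norm (\<omega> - 2 ^ n *\<^sub>R \<theta>) < \<delta>" by (simp add: B_def dist_norm norm_minus_commute)
    have "\<bar>fst \<omega> - 2 ^ n * fst \<theta>\<bar> < \<delta>" "\<bar>snd \<omega> - 2 ^ n * snd \<theta>\<bar> < \<delta>"
      using d abs_fst_snd_le_norm[of "\<omega> - 2 ^ n *\<^sub>R \<theta>"] by auto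
    moreover have "2 ^ n * \<bar>fst \<theta>\<bar> + \<delta> \<le> 2 ^ n * pi" "2 ^ n * \<bar>snd \<theta>\<bar> + \<delta> \<le> 2 ^ n * pi"
    proof -
      have "\<delta> \<le> 2 ^ n * \<delta>" using \<delta>(1) by simp
      moreover have "2 ^ n * (\<bar>fst \<theta>\<bar> + \<delta>) \<le> 2 ^ n * pi" "2 ^ n * (\<bar>snd \<theta>\<bar> + \<delta>) \<le> 2 ^ n * pi"
        using \<delta>(3,4) by auto
      ultimately show "2 ^ n * \<bar>fst \<theta>\<bar> + \<delta> \<le> 2 ^ n * pi" "2 ^ n * \<bar>snd \<theta>\<bar> + \<delta> \<le> 2 ^ n * pi"
        by (simp_all add: distrib_left)
    qed
    moreover have "\<bar>2 ^ n * fst \<theta>\<bar> = 2 ^ n * \<bar>fst \<theta>\<bar>" "\<bar>2 ^ n * snd \<theta>\<bar> = 2 ^ n * \<bar>snd \<theta>\<bar>"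
      by (auto simp: abs_mult)
    ultimately have "\<bar>fst \<omega>\<bar> < 2 ^ n * pi" "\<bar>snd \<omega>\<bar> < 2 ^ n * pi" by linarith+
    then show "\<omega> \<in> D n" by (cases \<omega>) (auto simp: D_def centered_square_def)
  qed
  have lower: "1 / 4 \<le> (cmod (partial_product n \<omega>))\<^sup>2" if "\<omega> \<in> B n" for n \<omega>
  proof -
    define \<eta> where "\<eta> = \<omega> - 2 ^ n *\<^sub>R \<theta>"
    have \<eta>: "norm \<eta> < \<delta>" using that by (simp add: B_def \<eta>_def dist_norm norm_minus_commute)
    define f where "f k = L * \<delta> * (1 / 2) ^ Suc k" for k
    have f: "f k \<in> {0..1}" for k
    proof -
      have "L * \<delta> * (1 / 2) ^ Suc k \<le> 1 * 1"
        using \<delta> L_pos by (intro mult_mono power_le_one) auto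
      then show ?thesis using \<delta> L_pos by (auto simp: f_def)
    qed
    \<comment> \<open>Factor \<open>k\<close> is evaluated within
      \<open>\<delta> / 2 ^ Suc k\<close> of the orbit point
      \<open>2 ^ (n - Suc k) *\<^sub>R \<theta>\<close>, where \<open>M\<close> is
      unimodular.\<close>
    have Mk: "1 - f k \<le> cmod (M (\<omega> /\<^sub>R 2 ^ Suc k))" if k: "k < n" for k
    proof -
      define c where "c = (2 :: real) ^ Suc k"
      have c: "c > 0" by (simp add: c_def)
      have "2 ^ n = 2 ^ (n - Suc k) * c"
        unfolding c_def using k by (simp only: power_add[symmetric]) simp
      then have "\<omega> /\<^sub>R c - 2 ^ (n - Suc k) *\<^sub>R \<theta> = \<eta> /\<^sub>R c"
        using c by (simp add: \<eta>_def scaleR_diff_right)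
      then have "\<omega> /\<^sub>R 2 ^ Suc k - 2 ^ (n - Suc k) *\<^sub>R \<theta> = \<eta> /\<^sub>R 2 ^ Suc k"
        unfolding c_def .
      then have "cmod (M (\<omega> /\<^sub>R 2 ^ Suc k) - M (2 ^ (n - Suc k) *\<^sub>R \<theta>)) \<le> L * norm (\<eta> /\<^sub>R 2 ^ Suc k)"
        using M_lipschitz[of "\<omega> /\<^sub>R 2 ^ Suc k" "2 ^ (n - Suc k) *\<^sub>R \<theta>"] by (simp only:)
      also have "\<dots> \<le> L * (\<delta> / 2 ^ Suc k)"
        using \<eta> L_pos by (intro mult_left_mono) (auto simp: field_simps)
      also have "\<dots> = f k" by (simp add: f_def power_one_over)
      finally show ?thesis
        using norm_triangle_ineq2[of "M (2 ^ (n - Suc k) *\<^sub>R \<theta>)" "M (\<omega> /\<^sub>R 2 ^ Suc k)"] cycle[of "n - Suc k"]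
        by (simp add: norm_minus_commute)
    qed
    have "L * \<delta> * (\<Sum>k<n. (1 / 2) ^ Suc k) \<le> L * \<delta> * 1"
      using \<delta> L_pos by (intro mult_left_mono half_powers) auto
    then have "1 / 2 \<le> 1 - sum f {..<n}"
      using \<delta>(2) unfolding f_def sum_distrib_left[symmetric] by linarith
    also have "\<dots> \<le> (\<Prod>k<n. 1 - f k)"
      by (rule Weierstrass_prod_ineq) (rule f)
    also have "\<dots> \<le> (\<Prod>k<n. cmod (M (\<omega> /\<^sub>R 2 ^ Suc k)))"
      using f Mk by (intro prod_mono) auto
    also have "\<dots> = cmod (partial_product n \<omega>)"
      by (simp add: partial_product_def prod_norm)
    finally have "(1 / 2)\<^sup>2 \<le> (cmod (partial_product n \<omega>))\<^sup>2" by (intro power_mono) auto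
    then show ?thesis by (simp add: power2_eq_square)
  qed
  \<comment> \<open>Removing the ball costs at least \<open>v / 4\<close> for every \<open>n\<close>
    yet leaves the pointwise limit unchanged, so Fatou's lemma preserves the deficit.\<close>
  define g where "g n \<omega> = ennreal ((cmod (partial_product n \<omega>))\<^sup>2) * indicator (D n - B n) \<omega>" for n \<omega>
  have [measurable]: "g n \<in> borel_measurable borel" for n unfolding g_def by measurable
  have g_mass: "(\<integral>\<^sup>+\<omega>. g n \<omega> \<partial>lborel) \<le> ennreal (4 * pi\<^sup>2 - v / 4)" for n
  proof -
    have "ennreal (v / 4) = (\<integral>\<^sup>+\<omega>. ennreal (1 / 4) * indicator (B n) \<omega> \<partial>lborel)"
      using v by (simp add: nn_integral_cmult_indicator vfin ennreal_mult[symmetric])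
    also have "\<dots> \<le> (\<integral>\<^sup>+\<omega>. ennreal ((cmod (partial_product n \<omega>))\<^sup>2) * indicator (B n) \<omega> \<partial>lborel)"
      using lower by (intro nn_integral_mono) (auto split: split_indicator intro!: ennreal_leI)
    finally have "(\<integral>\<^sup>+\<omega>. g n \<omega> \<partial>lborel) + ennreal (v / 4)
        \<le> (\<integral>\<^sup>+\<omega>. g n \<omega> \<partial>lborel) + (\<integral>\<^sup>+\<omega>. ennreal ((cmod (partial_product n \<omega>))\<^sup>2) * indicator (B n) \<omega> \<partial>lborel)"
      by (rule add_left_mono)
    also have "\<dots> = (\<integral>\<^sup>+\<omega>. ennreal ((cmod (partial_product n \<omega>))\<^sup>2) * indicator (D n) \<omega> \<partial>lborel)"
      unfolding g_def using BD[of n]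
      by (subst nn_integral_add[symmetric]) (auto intro!: nn_integral_cong split: split_indicator)
    also have "\<dots> = ennreal (4 * pi\<^sup>2)"
      unfolding D_def by (rule partial_product_mass)
    finally have le: "(\<integral>\<^sup>+\<omega>. g n \<omega> \<partial>lborel) + ennreal (v / 4) \<le> ennreal (4 * pi\<^sup>2)" .
    then show ?thesis
      using v by (cases "\<integral>\<^sup>+\<omega>. g n \<omega> \<partial>lborel")
        (auto simp: ennreal_plus[symmetric] top_unique simp del: ennreal_plus intro!: ennreal_leI)
  qed
  have g_lim: "(\<lambda>n. g n \<omega>) \<longlonglongrightarrow> ennreal ((cmod (full_product \<omega>))\<^sup>2)" for \<omega>
  proof (rule Lim_transform_eventually)
    show "(\<lambda>n. ennreal ((cmod (partial_product n \<omega>))\<^sup>2)) \<longlonglongrightarrow> ennreal ((cmod (full_product \<omega>))\<^sup>2)"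
      by (intro tendsto_ennrealI tendsto_intros partial_product_lim)
    \<comment> \<open>Past this threshold the ball has moved beyond \<open>\<omega>\<close> and the
      square has grown to contain it; the minimum secures both.\<close>
    define b where "b = (norm \<omega> + \<delta>) / min (norm \<theta>) pi"
    have mp: "min (norm \<theta>) pi > 0" using \<theta> by simp
    obtain N where N: "b < 2 ^ N" using real_arch_pow[of 2 b] by auto
    have "\<forall>\<^sub>F n in sequentially. N \<le> n" by (rule eventually_ge_at_top)
    then show "\<forall>\<^sub>F n in sequentially. ennreal ((cmod (partial_product n \<omega>))\<^sup>2) = g n \<omega>"
    proof (rule eventually_mono)
      fix n assume "N \<le> n"
      then have "(2::real) ^ N \<le> 2 ^ n" by (intro power_increasing) auto
      then have "b < 2 ^ n" using N by linarith
      then have big: "norm \<omega> + \<delta> < 2 ^ n * min (norm \<theta>) pi"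
        unfolding b_def using mp by (simp add: field_simps)
      moreover have "2 ^ n * min (norm \<theta>) pi \<le> 2 ^ n * norm \<theta>" "2 ^ n * min (norm \<theta>) pi \<le> 2 ^ n * pi" by auto
      ultimately have *: "norm \<omega> + \<delta> < 2 ^ n * norm \<theta>" "norm \<omega> < 2 ^ n * pi" using \<delta>(1) by linarith+
      have "\<omega> \<notin> B n"
        using *(1) norm_triangle_ineq2[of "2 ^ n *\<^sub>R \<theta>" \<omega>] by (simp add: B_def dist_norm)
      moreover have "\<omega> \<in> D n"
        using *(2) abs_fst_snd_le_norm[of \<omega>]
        by (cases \<omega>) (auto simp: D_def centered_square_def)
      ultimately show "ennreal ((cmod (partial_product n \<omega>))\<^sup>2) = g n \<omega>" by (simp add: g_def)
    qed
  qed
  have "L2_mass full_product = (\<integral>\<^sup>+\<omega>. liminf (\<lambda>n. g n \<omega>) \<partial>lborel)"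
    unfolding L2_mass_def using g_lim by (intro nn_integral_cong lim_imp_Liminf[symmetric]) auto
  also have "\<dots> \<le> liminf (\<lambda>n. \<integral>\<^sup>+\<omega>. g n \<omega> \<partial>lborel)"
    by (rule nn_integral_liminf) simp
  also have "\<dots> \<le> ennreal (4 * pi\<^sup>2 - v / 4)"
    using g_mass by (intro Liminf_le) (auto simp: always_eventually)
  also have "\<dots> < ennreal (4 * pi\<^sup>2)"
    using v by (intro ennreal_lessI) auto
  finally show ?thesis .
qed

end

section \<open>The coefficients of the mask\<close>

definition mask_box :: "(int \<times> int) set" where
  "mask_box = {0..5} \<times> {0..5}"

text \<open>Indexed by the exponents of x and y in this order, so the matrix row is the second
  component. The extension by zero lets autocorrelations run over all shifts.\<close>

definition mask_coeff :: "(nat \<Rightarrow> real) \<Rightarrow> (nat \<Rightarrow> real) \<Rightarrow> int \<times> int \<Rightarrow> real" where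
  "mask_coeff a b p = (if p \<in> mask_box then mask_matrix a b ! nat (snd p) ! nat (fst p) else 0)"

lemma finite_mask_box [simp]: "finite mask_box"
  by (simp add: mask_box_def)

lemma mask_coeff_support: "p \<notin> mask_box \<Longrightarrow> mask_coeff a b p = 0"
  by (simp add: mask_coeff_def)

text \<open>The matrix is invariant under a half-turn, which is the symmetry (iii) read off the
  coefficients.\<close>

lemma mask_coeff_reflect: "mask_coeff a b ((5, 5) - p) = mask_coeff a b p"
proof (cases "p \<in> mask_box")
  case True
  then have "fst p \<in> {0, 1, 2, 3, 4, 5}" "snd p \<in> {0, 1, 2, 3, 4, 5}"
    by (auto simp: mask_box_def)
  moreover have "(5, 5) - p \<in> mask_box" using True by (cases p) (auto simp: mask_box_def)
  ultimately show ?thesis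
    using True by (cases p) (auto simp: mask_coeff_def mask_matrix_def)
next
  case False
  then have "(5, 5) - p \<notin> mask_box" by (cases p) (auto simp: mask_box_def)
  then show ?thesis using False by (simp add: mask_coeff_support)
qed

lemma refinement_mask_eq:
  "refinement_mask a b x y =
    (\<Sum>p\<in>mask_box. complex_of_real (mask_coeff a b p) * (x ^ nat (fst p) * y ^ nat (snd p)))"
proof -
  have box: "mask_box = (\<lambda>(r, c). (int c, int r)) ` ({..<6} \<times> {..<6})"
  proof -
    have "{0..5} = int ` {..<6}"
      using image_int_atLeastLessThan[of 0 6] by (auto simp: atLeast0LessThan)
    then show ?thesis unfolding mask_box_def by (auto simp: image_iff)
  qed
  have "(\<Sum>p\<in>mask_box. complex_of_real (mask_coeff a b p) * (x ^ nat (fst p) * y ^ nat (snd p)))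
      = (\<Sum>(r, c)\<in>{..<6} \<times> {..<6}. complex_of_real (mask_coeff a b (int c, int r)) * (x ^ c * y ^ r))"
    unfolding box by (subst sum.reindex) (auto simp: inj_on_def case_prod_unfold)
  also have "\<dots> = refinement_mask a b x y"
    unfolding refinement_mask_def sum.cartesian_product
    by (intro sum.cong refl) (auto simp: mask_coeff_def mask_box_def mult_ac)
  finally show ?thesis by simp
qed

definition trig_poly :: "(int \<times> int \<Rightarrow> real) \<Rightarrow> (int \<times> int) set \<Rightarrow> plane_fun" where
  "trig_poly c K \<omega> = (\<Sum>p\<in>K. complex_of_real (c p) * cis (lattice_point p \<bullet> \<omega>))"

lemma lattice_inner: "lattice_point p \<bullet> \<omega> = real_of_int (fst p) * fst \<omega> + real_of_int (snd p) * snd \<omega>"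
  by (simp add: lattice_point_def inner_prod_def)

lemma refinement_mask_torus:
  "refinement_mask a b (cis s) (cis t) = trig_poly (mask_coeff a b) mask_box (s, t)"
  unfolding refinement_mask_eq trig_poly_def
proof (rule sum.cong[OF refl])
  fix p assume "p \<in> mask_box"
  then have "real (nat (fst p)) = real_of_int (fst p)" "real (nat (snd p)) = real_of_int (snd p)"
    by (auto simp: mask_box_def)
  then show "complex_of_real (mask_coeff a b p) * (cis s ^ nat (fst p) * cis t ^ nat (snd p))
      = complex_of_real (mask_coeff a b p) * cis (lattice_point p \<bullet> (s, t))"
    unfolding Complex.DeMoivre cis_mult by (simp add: lattice_inner)
qed

section \<open>Orthogonality relations for roots of unity\<close>

lemma cis_root_sum:
  assumes N: "N > 0"
  shows "(\<Sum>j<N. cis (2 * pi * real_of_int n * real j / real N)) = (if int N dvd n then of_nat N else 0)"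
proof -
  define z where "z = cis (2 * pi * real_of_int n / real N)"
  have zj: "cis (2 * pi * real_of_int n * real j / real N) = z ^ j" for j
    unfolding z_def Complex.DeMoivre by (simp add: mult_ac)
  have "z ^ N = cis (2 * pi * real_of_int n)"
    unfolding z_def Complex.DeMoivre using N by simp
  then have zN: "z ^ N = 1" by (simp add: cis_multiple_2pi)
  show ?thesis
  proof (cases "int N dvd n")
    case True
    then obtain k where "n = int N * k" by (elim dvdE)
    then have "2 * pi * real_of_int n / real N = 2 * pi * real_of_int k" using N by simp
    then have "z = 1" by (simp add: z_def cis_multiple_2pi)
    then show ?thesis using True by (simp add: zj)
  next
    case False
    have "z \<noteq> 1"
    proof
      assume "z = 1"
      then have "cos (2 * pi * real_of_int n / real N) = 1" by (simp add: z_def cis.ctr complex_eq_iff)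
      then obtain k where "2 * pi * real_of_int n / real N = real_of_int k * 2 * pi"
        by (auto simp: cos_one_2pi_int)
      then have "real_of_int n = real_of_int (int N * k)" using N by (simp add: field_simps)
      then have "n = int N * k" by linarith
      then show False using False by simp
    qed
    then have "(\<Sum>j<N. z ^ j) = 0" using zN by (simp add: geometric_sum)
    then show ?thesis using False by (simp add: zj)
  qed
qed

lemma cis_root_sum_small:
  assumes "N > 0" "\<bar>n\<bar> < int N"
  shows "(\<Sum>j<N. cis (2 * pi * real_of_int n * real j / real N)) = (if n = 0 then of_nat N else 0)"
proof -
  have "\<not> int N dvd n" if "n \<noteq> 0"
    using dvd_imp_le_int[OF that, of "int N"] assms(2) by auto
  then show ?thesis using cis_root_sum[OF assms(1), of n] by auto
qed

lemma cmod_sq_trig_poly: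
  assumes "finite K"
  shows "complex_of_real ((cmod (trig_poly c K \<omega>))\<^sup>2)
    = (\<Sum>p\<in>K. \<Sum>p'\<in>K. complex_of_real (c p * c p') * cis (lattice_point (p - p') \<bullet> \<omega>))"
proof -
  have "complex_of_real ((cmod (trig_poly c K \<omega>))\<^sup>2)
      = (\<Sum>p\<in>K. complex_of_real (c p) * cis (lattice_point p \<bullet> \<omega>)) * (\<Sum>p'\<in>K. complex_of_real (c p') * cis (- (lattice_point p' \<bullet> \<omega>)))"
    unfolding complex_norm_square trig_poly_def by (simp add: cis_cnj)
  also have "\<dots> = (\<Sum>p\<in>K. \<Sum>p'\<in>K. complex_of_real (c p * c p') * cis (lattice_point (p - p') \<bullet> \<omega>))"
    unfolding sum_product
  proof (intro sum.cong refl)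
    fix p p'
    have "cis (lattice_point p \<bullet> \<omega>) * cis (- (lattice_point p' \<bullet> \<omega>)) = cis (lattice_point (p - p') \<bullet> \<omega>)"
      by (simp add: cis_mult lattice_inner algebra_simps)
    then show "complex_of_real (c p) * cis (lattice_point p \<bullet> \<omega>) * (complex_of_real (c p') * cis (- (lattice_point p' \<bullet> \<omega>)))
        = complex_of_real (c p * c p') * cis (lattice_point (p - p') \<bullet> \<omega>)"
      by (simp add: mult_ac)
  qed
  finally show ?thesis .
qed

locale qmf_mask =
  fixes a b :: "nat \<Rightarrow> real"
  assumes mask_1: "refinement_mask a b 1 1 = 1"
    and mask_qmf: "\<And>x y :: complex. cmod x = 1 \<Longrightarrow> cmod y = 1 \<Longrightarrow>
      (cmod (refinement_mask a b x y))\<^sup>2 + (cmod (refinement_mask a b (- x) y))\<^sup>2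
        + (cmod (refinement_mask a b x (- y)))\<^sup>2 + (cmod (refinement_mask a b (- x) (- y)))\<^sup>2 = 1"
begin

abbreviation "c \<equiv> mask_coeff a b"

text \<open>Averaging \<open>(cmod m)\<^sup>2\<close> against a character of even frequency over the grid of tenth roots
  of unity isolates one coefficient; tenth roots suffice because the mask has degree 5.\<close>

lemma autocorrelation_small:
  assumes d: "\<bar>d1\<bar> \<le> 2" "\<bar>d2\<bar> \<le> 2"
  shows "(\<Sum>p\<in>mask_box. c p * c (p + (2 * d1, 2 * d2))) = (if (d1, d2) = (0, 0) then 1 / 4 else 0)"
proof -
  define e where "e n j = cis (2 * pi * real_of_int n * real j / 10)" for n :: int and j :: nat
  define F where "F j l = complex_of_real ((cmod (refinement_mask a b (cis (2 * pi * real j / 10)) (cis (2 * pi * real l / 10))))\<^sup>2)" for j l :: nat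
  define S where "S = (\<Sum>j<10. \<Sum>l<10. F j l * (e (- 2 * d1) j * e (- 2 * d2) l))"
  have e_mult: "e n j * e n' j = e (n + n') j" for n n' j
    by (simp add: e_def cis_mult add_divide_distrib distrib_left distrib_right)
  have e10: "(\<Sum>j<10. e n j) = (if n = 0 then 10 else 0)" if "\<bar>n\<bar> < 10" for n
    using cis_root_sum_small[of 10 n] that by (simp add: e_def)
  have eF: "e n j * e n' l = cis (real_of_int n * (2 * pi * real j / 10) + real_of_int n' * (2 * pi * real l / 10))" for n n' j l
    unfolding e_def cis_mult by (rule arg_cong[of _ _ cis]) (simp add: field_simps)
  have F: "F j l = (\<Sum>p\<in>mask_box. \<Sum>p'\<in>mask_box. complex_of_real (c p * c p') * (e (fst p - fst p') j * e (snd p - snd p') l))" for j l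
    unfolding F_def refinement_mask_torus cmod_sq_trig_poly[OF finite_mask_box]
    unfolding lattice_inner eF by simp
  have "S = (\<Sum>j<10. \<Sum>l<10. \<Sum>p\<in>mask_box. \<Sum>p'\<in>mask_box. complex_of_real (c p * c p') *
        (e (fst p - fst p' - 2 * d1) j * e (snd p - snd p' - 2 * d2) l))"
    unfolding S_def F sum_distrib_right
  proof (intro sum.cong refl)
    fix j l p p'
    have eq: "e (fst p - fst p') j * e (- 2 * d1) j = e (fst p - fst p' - 2 * d1) j"
      "e (snd p - snd p') l * e (- 2 * d2) l = e (snd p - snd p' - 2 * d2) l"
      unfolding e_mult by simp_all
    show "complex_of_real (c p * c p') * (e (fst p - fst p') j * e (snd p - snd p') l) * (e (- 2 * d1) j * e (- 2 * d2) l)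
        = complex_of_real (c p * c p') * (e (fst p - fst p' - 2 * d1) j * e (snd p - snd p' - 2 * d2) l)"
      unfolding eq[symmetric] by (simp only: mult_ac)
  qed
  also have "\<dots> = (\<Sum>p\<in>mask_box. \<Sum>p'\<in>mask_box. complex_of_real (c p * c p') *
        ((\<Sum>j<10. e (fst p - fst p' - 2 * d1) j) * (\<Sum>l<10. e (snd p - snd p' - 2 * d2) l)))"
  proof -
    define G where "G j l p p' = complex_of_real (c p * c p') *
        (e (fst p - fst p' - 2 * d1) j * e (snd p - snd p' - 2 * d2) l)" for j l p p'
    have "(\<Sum>j<10. \<Sum>l<10. \<Sum>p\<in>mask_box. \<Sum>p'\<in>mask_box. G j l p p')
        = (\<Sum>j<10. \<Sum>p\<in>mask_box. \<Sum>l<10. \<Sum>p'\<in>mask_box. G j l p p')"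
      by (rule sum.cong[OF refl sum.swap])
    also have "\<dots> = (\<Sum>j<10. \<Sum>p\<in>mask_box. \<Sum>p'\<in>mask_box. \<Sum>l<10. G j l p p')"
      by (rule sum.cong[OF refl], rule sum.cong[OF refl sum.swap])
    also have "\<dots> = (\<Sum>p\<in>mask_box. \<Sum>j<10. \<Sum>p'\<in>mask_box. \<Sum>l<10. G j l p p')"
      by (rule sum.swap)
    also have "\<dots> = (\<Sum>p\<in>mask_box. \<Sum>p'\<in>mask_box. \<Sum>j<10. \<Sum>l<10. G j l p p')"
      by (rule sum.cong[OF refl sum.swap])
    finally show ?thesis unfolding G_def unfolding sum_product unfolding sum_distrib_left .
  qed
  also have "\<dots> = (\<Sum>p\<in>mask_box. \<Sum>p'\<in>mask_box. if p = p' + (2 * d1, 2 * d2) then 100 * complex_of_real (c p * c p') else 0)"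
  proof (intro sum.cong refl)
    fix p p' assume pp: "p \<in> mask_box" "p' \<in> mask_box"
    \<comment> \<open>Exponents differ by at most 5 and the character contributes at most 4, so 0 is
      the only multiple of 10 that can occur.\<close>
    then have "\<bar>fst p - fst p' - 2 * d1\<bar> < 10" "\<bar>snd p - snd p' - 2 * d2\<bar> < 10"
      using d by (auto simp: mask_box_def)
    then show "complex_of_real (c p * c p') * ((\<Sum>j<10. e (fst p - fst p' - 2 * d1) j) * (\<Sum>l<10. e (snd p - snd p' - 2 * d2) l))
        = (if p = p' + (2 * d1, 2 * d2) then 100 * complex_of_real (c p * c p') else 0)"
      by (cases p; cases p') (auto simp: e10)
  qed
  also have "\<dots> = (\<Sum>p'\<in>mask_box. \<Sum>p\<in>mask_box. if p = p' + (2 * d1, 2 * d2) then 100 * complex_of_real (c p * c p') else 0)"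
    by (rule sum.swap)
  also have "\<dots> = (\<Sum>p'\<in>mask_box. 100 * complex_of_real (c p' * c (p' + (2 * d1, 2 * d2))))"
    by (intro sum.cong refl) (auto simp: sum.delta mask_coeff_support mult_ac)
  also have "\<dots> = complex_of_real (100 * (\<Sum>p\<in>mask_box. c p * c (p + (2 * d1, 2 * d2))))"
    by (simp add: sum_distrib_left)
  finally have S1: "S = complex_of_real (100 * (\<Sum>p\<in>mask_box. c p * c (p + (2 * d1, 2 * d2))))" .
  \<comment> \<open>Indices \<open>j\<close> and \<open>j + 5\<close> belong to opposite roots,
    where a character of even frequency takes equal values; pairing them in both variables assembles
    the quadrature identity.\<close>
  have split: "(\<Sum>j<10. f j) = (\<Sum>j<5. f j + f (j + 5))" for f :: "nat \<Rightarrow> complex"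
    by (simp add: eval_nat_numeral)
  have e5: "e (- 2 * n) (j + 5) = e (- 2 * n) j" for n j
  proof -
    have "2 * pi * real_of_int (- 2 * n) * real (j + 5) / 10
        = 2 * pi * real_of_int (- 2 * n) * real j / 10 + 2 * pi * real_of_int (- n)"
      by (simp add: field_simps)
    then have "e (- 2 * n) (j + 5) = e (- 2 * n) j * cis (2 * pi * real_of_int (- n))"
      unfolding e_def cis_mult by simp
    then show ?thesis using cis_multiple_2pi[of "real_of_int (- n)"] by simp
  qed
  have cis5: "cis (2 * pi * real (j + 5) / 10) = - cis (2 * pi * real j / 10)" for j
  proof -
    have "2 * pi * real (j + 5) / 10 = 2 * pi * real j / 10 + pi" by (simp add: field_simps)
    then show ?thesis unfolding cis_mult[symmetric, of _ pi] by (simp only: cis_mult[symmetric] cis_pi) simp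
  qed
  have F1: "F j l + F j (l + 5) + (F (j + 5) l + F (j + 5) (l + 5)) = 1" for j l
  proof -
    have "F j l + F j (l + 5) + (F (j + 5) l + F (j + 5) (l + 5)) = complex_of_real 1"
      unfolding F_def cis5 of_real_add[symmetric]
      by (subst mask_qmf[of "cis (2 * pi * real j / 10)" "cis (2 * pi * real l / 10)", symmetric]) (simp_all add: add_ac)
    then show ?thesis by simp
  qed
  have "S = (\<Sum>j<5. \<Sum>l<5. e (- 2 * d1) j * e (- 2 * d2) l)"
  proof -
    have "S = (\<Sum>j<5. \<Sum>l<5. (F j l + F j (l + 5) + (F (j + 5) l + F (j + 5) (l + 5))) * (e (- 2 * d1) j * e (- 2 * d2) l))"
      unfolding S_def split e5 sum.distrib[symmetric]
      by (intro sum.cong refl) (simp add: algebra_simps)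
    then show ?thesis unfolding F1 by simp
  qed
  also have "\<dots> = (\<Sum>j<5. e (- 2 * d1) j) * (\<Sum>l<5. e (- 2 * d2) l)"
    by (simp add: sum_product)
  also have "\<dots> = (if (d1, d2) = (0, 0) then 25 else 0)"
  proof -
    have "(\<Sum>j<5. e (- 2 * n) j) = (if n = 0 then 5 else 0)" if "\<bar>n\<bar> \<le> 2" for n
      using cis_root_sum_small[of 5 "- n"] that by (simp add: e_def mult_ac)
    then show ?thesis using d by auto
  qed
  finally have "complex_of_real (100 * (\<Sum>p\<in>mask_box. c p * c (p + (2 * d1, 2 * d2)))) = complex_of_real (if (d1, d2) = (0, 0) then 25 else 0)"
    using S1 by simp
  then have "100 * (\<Sum>p\<in>mask_box. c p * c (p + (2 * d1, 2 * d2))) = (if (d1, d2) = (0, 0) then 25 else 0)"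
    using of_real_eq_iff by blast
  then show ?thesis by (auto split: if_splits)
qed

text \<open>An even shift larger than 4 in some coordinate is at least 6 and moves the box off
  itself, so the small shifts are the only ones with content.\<close>

lemma autocorrelation:
  assumes "even (fst d)" "even (snd d)"
  shows "(\<Sum>p\<in>mask_box. c p * c (p + d)) = (if d = 0 then 1 / 4 else 0)"
proof -
  obtain d1 d2 where d: "d = (2 * d1, 2 * d2)"
    using assms by (cases d) (auto elim!: evenE)
  show ?thesis
  proof (cases "\<bar>d1\<bar> \<le> 2 \<and> \<bar>d2\<bar> \<le> 2")
    case True
    then show ?thesis using autocorrelation_small[of d1 d2] by (auto simp: d zero_prod_def)
  next
    case False
    then have "p + d \<notin> mask_box" if "p \<in> mask_box" for p
      using that by (auto simp: d mask_box_def)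
    then have "(\<Sum>p\<in>mask_box. c p * c (p + d)) = 0"
      by (intro sum.neutral) (auto simp: mask_coeff_support)
    then show ?thesis using False by (auto simp: d zero_prod_def)
  qed
qed

text \<open>The share of the autocorrelation that comes from one coset of the even lattice.\<close>

definition class_sum :: "int \<times> int \<Rightarrow> int \<times> int \<Rightarrow> real" where
  "class_sum q d = (\<Sum>p | p \<in> mask_box \<and> parity p = q. c p * c (p + d))"

lemma class_sum_alt:
  "class_sum q d = (\<Sum>p | p \<in> mask_box \<and> p + d \<in> mask_box \<and> parity p = q. c p * c (p + d))"
  unfolding class_sum_def by (rule sum.mono_neutral_right) (auto, metis mask_coeff_support)

text \<open>The involution \<open>(5, 5) - p - d\<close> swaps the two factors of a product, by the
  reflection symmetry of \<open>c\<close>. Since 5 is odd, it turns parity \<open>q\<close> into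
  that of \<open>(1, 1) - q - d\<close>.\<close>

lemma class_sum_reflect:
  assumes q: "q \<in> parities"
  shows "class_sum q d = class_sum (parity ((1, 1) - q - d)) d"
  unfolding class_sum_alt
proof (rule sum.reindex_bij_witness[where i="\<lambda>p. (5, 5) - p - d" and j="\<lambda>p. (5, 5) - p - d"])
  fix p assume p: "p \<in> {p. p \<in> mask_box \<and> p + d \<in> mask_box \<and> parity p = q}"
  then show "(5, 5) - p - d \<in> {p. p \<in> mask_box \<and> p + d \<in> mask_box \<and> parity p = parity ((1, 1) - q - d)}"
    by (cases p; cases d) (auto simp: mask_box_def parity_def, presburger+)
  show "c ((5, 5) - p - d) * c ((5, 5) - p - d + d) = c p * c (p + d)"
    using mask_coeff_reflect[of a b p] mask_coeff_reflect[of a b "p + d"]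
    by (simp add: diff_diff_eq add.commute)
next
  fix p assume p: "p \<in> {p. p \<in> mask_box \<and> p + d \<in> mask_box \<and> parity p = parity ((1, 1) - q - d)}"
  then show "(5, 5) - p - d \<in> {p. p \<in> mask_box \<and> p + d \<in> mask_box \<and> parity p = q}"
    using q by (cases p; cases d; cases q) (auto simp: mask_box_def parity_def, presburger+)
qed (auto simp: algebra_simps)

lemma sum_class_sum: "(\<Sum>q\<in>parities. class_sum q d) = (\<Sum>p\<in>mask_box. c p * c (p + d))"
  unfolding class_sum_def
proof (rule sum.group)
  show "parity ` mask_box \<subseteq> parities" by (rule image_subsetI) (rule parity_in)
qed auto

end

section \<open>The four filters of the mask as a paraunitary bank\<close>

definition parity_sign :: "int \<Rightarrow> real" where
  "parity_sign n = (if even n then 1 else - 1)"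

lemma parity_sign_mult: "parity_sign m * parity_sign n = parity_sign (m + n)"
  by (auto simp: parity_sign_def)

text \<open>One step wider in x than \<open>mask_box\<close>: the factor x in m_2 and m_3 shifts
  their coefficients by \<open>(1, 0)\<close>, and the four filters share one support.\<close>

definition bank_box :: "(int \<times> int) set" where
  "bank_box = {0..6} \<times> {0..5}"

text \<open>The coefficients of m, m_1, m_2, m_3. Signs belong to the index before the shift by
  \<open>(1, 0)\<close>, hence \<open>fst p - 1\<close> in the last case.\<close>

definition filter_coeff :: "(int \<times> int \<Rightarrow> real) \<Rightarrow> nat \<Rightarrow> int \<times> int \<Rightarrow> real" where
  "filter_coeff c i p =
    (if i = 0 then c p
     else if i = 1 then parity_sign (fst p) * c p
     else if i = 2 then parity_sign (snd p) * c (p - (1, 0))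
     else parity_sign (fst p - 1 + snd p) * c (p - (1, 0)))"

context qmf_mask
begin

lemma class_sum_bank: "(\<Sum>p | p \<in> bank_box \<and> parity p = q. c p * c (p + d)) = class_sum q d"
  unfolding class_sum_def
  by (rule sum.mono_neutral_right) (auto simp: bank_box_def mask_box_def mask_coeff_def)

lemma class_sum_bank_shift:
  assumes "q \<in> parities"
  shows "(\<Sum>p | p \<in> bank_box \<and> parity p = q. c (p - (1, 0)) * c (p - (1, 0) + d)) = class_sum (parity (q - (1, 0))) d"
proof -
  have "(\<Sum>p | p \<in> bank_box \<and> parity p = q. c (p - (1, 0)) * c (p - (1, 0) + d))
      = (\<Sum>p | p - (1, 0) \<in> mask_box \<and> parity p = q. c (p - (1, 0)) * c (p - (1, 0) + d))"
    by (rule sum.mono_neutral_right) (auto simp: bank_box_def mask_box_def mask_coeff_def)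
  also have "\<dots> = class_sum (parity (q - (1, 0))) d"
    unfolding class_sum_def
  proof (rule sum.reindex_bij_witness[where i="\<lambda>p. p + (1, 0)" and j="\<lambda>p. p - (1, 0)"])
    fix p assume "p \<in> {p. p - (1, 0) \<in> mask_box \<and> parity p = q}"
    then show "p - (1, 0) \<in> {p. p \<in> mask_box \<and> parity p = parity (q - (1, 0))}"
      by (cases p) (auto simp: parity_def, presburger)
  next
    fix p assume "p \<in> {p. p \<in> mask_box \<and> parity p = parity (q - (1, 0))}"
    then show "p + (1, 0) \<in> {p. p - (1, 0) \<in> mask_box \<and> parity p = q}"
      using assms by (cases p; cases q) (auto simp: parity_def, presburger+)
  qed auto
  finally show ?thesis .
qed

text \<open>Summing the filters leaves \<open>(1 + parity_sign d1) * (class_sum q d + parity_sign d2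
  * class_sum q' d)\<close>, where \<open>q'\<close> is the neighbouring coset in the x direction.
  An odd \<open>d1\<close> kills the first factor. For even \<open>d1\<close> and odd
  \<open>d2\<close>, reflection equates the two class sums, which cancel. If both are even,
  reflection pairs the four class sums, so the two present make up half the autocorrelation, which
  is 1/8 at \<open>d = 0\<close>.\<close>

sublocale paraunitary_filter_bank "filter_coeff c" bank_box
proof
  show "finite bank_box" by (simp add: bank_box_def)
  show "filter_coeff c i p = 0" if "p \<notin> bank_box" for i p
    using that by (cases p) (auto simp: filter_coeff_def mask_coeff_def mask_box_def bank_box_def)
  fix q d :: "int \<times> int" assume q: "q \<in> parities"
  obtain d1 d2 where d: "d = (d1, d2)" by (cases d)
  define q' where "q' = parity (q - (1, 0))"
  have "(\<Sum>i<4. \<Sum>p | p \<in> bank_box \<and> parity p = q. filter_coeff c i p * filter_coeff c i (p + d))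
      = (\<Sum>p | p \<in> bank_box \<and> parity p = q. c p * c (p + d))
      + (\<Sum>p | p \<in> bank_box \<and> parity p = q. parity_sign d1 * (c p * c (p + d)))
      + (\<Sum>p | p \<in> bank_box \<and> parity p = q. parity_sign d2 * (c (p - (1, 0)) * c (p - (1, 0) + d)))
      + (\<Sum>p | p \<in> bank_box \<and> parity p = q. parity_sign (d1 + d2) * (c (p - (1, 0)) * c (p - (1, 0) + d)))"
  proof -
    have "filter_coeff c 1 p * filter_coeff c 1 (p + d) = parity_sign d1 * (c p * c (p + d))"
      "filter_coeff c 2 p * filter_coeff c 2 (p + d) = parity_sign d2 * (c (p - (1, 0)) * c (p - (1, 0) + d))"
      "filter_coeff c 3 p * filter_coeff c 3 (p + d) = parity_sign (d1 + d2) * (c (p - (1, 0)) * c (p - (1, 0) + d))" for p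
    proof -
      have sg: "parity_sign m * x * (parity_sign (m + n) * y) = parity_sign n * (x * y)" for m n x y
        by (auto simp: parity_sign_def)
      have dd: "fst d = d1" "snd d = d2" by (auto simp: d)
      have shift: "p + d - (1, 0) = p - (1, 0) + d" by (simp add: algebra_simps)
      have exponent: "fst p + d1 - 1 + (snd p + d2) = (fst p - 1 + snd p) + (d1 + d2)" by simp
      show "filter_coeff c 1 p * filter_coeff c 1 (p + d) = parity_sign d1 * (c p * c (p + d))"
        using sg[of "fst p" "c p" d1 "c (p + d)"] by (simp add: filter_coeff_def dd)
      show "filter_coeff c 2 p * filter_coeff c 2 (p + d) = parity_sign d2 * (c (p - (1, 0)) * c (p - (1, 0) + d))"
        using sg[of "snd p" "c (p - (1, 0))" d2 "c (p - (1, 0) + d)"] by (simp add: filter_coeff_def dd shift)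
      show "filter_coeff c 3 p * filter_coeff c 3 (p + d) = parity_sign (d1 + d2) * (c (p - (1, 0)) * c (p - (1, 0) + d))"
        using sg[of "fst p - 1 + snd p" "c (p - (1, 0))" "d1 + d2" "c (p - (1, 0) + d)"]
        unfolding filter_coeff_def shift fst_add snd_add dd exponent by simp
    qed
    moreover have "filter_coeff c 0 = c" by (auto simp: filter_coeff_def)
    moreover have "{..<4} = {0, 1, 2, 3 :: nat}" by auto
    ultimately show ?thesis by (simp add: add.assoc)
  qed
  also have "\<dots> = (1 + parity_sign d1) * (class_sum q d + parity_sign d2 * class_sum q' d)"
    unfolding sum_distrib_left[symmetric] class_sum_bank class_sum_bank_shift[OF q] q'_def parity_sign_mult[symmetric]
    by (simp add: algebra_simps)
  finally have total: "4 * (\<Sum>i<4. \<Sum>p | p \<in> bank_box \<and> parity p = q. filter_coeff c i p * filter_coeff c i (p + d))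
      = 4 * (1 + parity_sign d1) * (class_sum q d + parity_sign d2 * class_sum q' d)" by simp
  show "4 * (\<Sum>i<4. \<Sum>p | p \<in> bank_box \<and> parity p = q. filter_coeff c i p * filter_coeff c i (p + d)) = (if d = 0 then 1 else 0)"
  proof (cases "even d1")
    case False
    then have "d \<noteq> 0" by (auto simp: d zero_prod_def)
    then show ?thesis unfolding total using False by (simp add: parity_sign_def)
  next
    case d1: True
    have q'_in: "q' \<in> parities" unfolding q'_def by (rule parity_in)
    have refl: "class_sum q d = class_sum (parity ((1, 1) - q - d)) d"
      "class_sum q' d = class_sum (parity ((1, 1) - q' - d)) d"
      by (rule class_sum_reflect[OF q], rule class_sum_reflect[OF q'_in])
    show ?thesis
    proof (cases "even d2")
      case False
      have "parity ((1, 1) - q - d) = q'"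
        using d1 False q by (auto simp: q'_def parity_def d, presburger+)
      then have "class_sum q d = class_sum q' d" using refl by simp
      moreover have "d \<noteq> 0" using False by (auto simp: d zero_prod_def)
      ultimately show ?thesis unfolding total using False by (simp add: parity_sign_def)
    next
      case True
      have "(\<Sum>q\<in>parities. class_sum q d) = (if d = 0 then 1 / 4 else 0)"
        unfolding sum_class_sum by (rule autocorrelation) (use d1 True d in auto)
      moreover have "(\<Sum>q\<in>parities. class_sum q d) = class_sum (0, 0) d + class_sum (0, 1) d + (class_sum (1, 0) d + class_sum (1, 1) d)"
        unfolding sum.cartesian_product[symmetric] by simp
      moreover have "class_sum (0, 0) d = class_sum (1, 1) d" "class_sum (0, 1) d = class_sum (1, 0) d"
        using class_sum_reflect[of "(0, 0)" d] class_sum_reflect[of "(0, 1)" d] d1 True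
        by (auto simp: d parity_def mod2_eq_if)
      moreover have "class_sum q d + class_sum q' d = class_sum (0, 0) d + class_sum (1, 0) d"
        using q calculation(3,4) by (auto simp: q'_def parity_def)
      ultimately have "class_sum q d + class_sum q' d = (if d = 0 then 1 / 8 else 0)" by (auto split: if_splits)
      then show ?thesis unfolding total using d1 True by (simp add: parity_sign_def)
    qed
  qed
qed

end

section \<open>Masks on the torus and the refinement they induce\<close>

lemma cis_int_pi: "cis (real_of_int n * pi) = complex_of_real (parity_sign n)"
proof (cases "even n")
  case True
  then obtain k where "n = 2 * k" by (elim evenE)
  then have "real_of_int n * pi = 2 * pi * real_of_int k" by simp
  then have "cis (real_of_int n * pi) = cis (2 * pi * real_of_int k)" by (simp only:)
  also have "\<dots> = 1" by (rule cis_multiple_2pi) simp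
  finally show ?thesis using True by (simp add: parity_sign_def)
next
  case False
  then obtain k where "n = 2 * k + 1" by (elim oddE)
  then have "real_of_int n * pi = 2 * pi * real_of_int k + pi" by (simp add: algebra_simps)
  then have "cis (real_of_int n * pi) = cis (2 * pi * real_of_int k) * cis pi" by (simp only: cis_mult)
  then show ?thesis using False by (simp add: parity_sign_def)
qed

lemma uminus_cis: "- cis s = cis (s + pi)"
  unfolding cis_mult[symmetric] by simp

lemma cis_lattice_shift:
  "cis (lattice_point p \<bullet> (s + pi, t)) = complex_of_real (parity_sign (fst p)) * cis (lattice_point p \<bullet> (s, t))"
  "cis (lattice_point p \<bullet> (s, t + pi)) = complex_of_real (parity_sign (snd p)) * cis (lattice_point p \<bullet> (s, t))"
  unfolding cis_int_pi[symmetric] cis_mult by (simp_all add: lattice_inner algebra_simps)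

lemma trig_poly_bank:
  assumes "\<And>p. p \<notin> mask_box \<Longrightarrow> g p = 0"
  shows "trig_poly g mask_box \<omega> = trig_poly g bank_box \<omega>"
    and "cis (fst \<omega>) * trig_poly g mask_box \<omega> = trig_poly (\<lambda>p. g (p - (1, 0))) bank_box \<omega>"
proof -
  have fin: "finite bank_box" by (simp add: bank_box_def)
  show "trig_poly g mask_box \<omega> = trig_poly g bank_box \<omega>"
    unfolding trig_poly_def using assms
    by (intro sum.mono_neutral_left fin) (auto simp: mask_box_def bank_box_def)
  have "cis (fst \<omega>) * trig_poly g mask_box \<omega>
      = (\<Sum>p\<in>mask_box. complex_of_real (g p) * cis (lattice_point (p + (1, 0)) \<bullet> \<omega>))"
    unfolding trig_poly_def sum_distrib_left
  proof (rule sum.cong[OF refl])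
    fix p
    have "cis (fst \<omega>) * cis (lattice_point p \<bullet> \<omega>) = cis (lattice_point (p + (1, 0)) \<bullet> \<omega>)"
      unfolding cis_mult by (simp add: lattice_inner algebra_simps)
    then show "cis (fst \<omega>) * (complex_of_real (g p) * cis (lattice_point p \<bullet> \<omega>))
        = complex_of_real (g p) * cis (lattice_point (p + (1, 0)) \<bullet> \<omega>)"
      by (simp add: mult.left_commute)
  qed
  also have "\<dots> = (\<Sum>p\<in>(\<lambda>p. p + (1, 0)) ` mask_box. complex_of_real (g (p - (1, 0))) * cis (lattice_point p \<bullet> \<omega>))"
    by (subst sum.reindex) (auto simp: inj_on_def)
  also have "\<dots> = trig_poly (\<lambda>p. g (p - (1, 0))) bank_box \<omega>"
    unfolding trig_poly_def
  proof (rule sum.mono_neutral_left[OF fin])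
    show "(\<lambda>p. p + (1, 0)) ` mask_box \<subseteq> bank_box"
      by (auto simp: mask_box_def bank_box_def)
    show "\<forall>p\<in>bank_box - (\<lambda>p. p + (1, 0)) ` mask_box. complex_of_real (g (p - (1, 0))) * cis (lattice_point p \<bullet> \<omega>) = 0"
    proof
      fix p :: "int \<times> int" assume p: "p \<in> bank_box - (\<lambda>p. p + (1, 0)) ` mask_box"
      have "p - (1, 0) \<notin> mask_box"
      proof
        assume "p - (1, 0) \<in> mask_box"
        then have "(p - (1, 0)) + (1, 0) \<in> (\<lambda>p. p + (1, 0)) ` mask_box" by (rule imageI)
        then show False using p by simp
      qed
      then show "complex_of_real (g (p - (1, 0))) * cis (lattice_point p \<bullet> \<omega>) = 0" by (simp add: assms)
    qed
  qed
  finally show "cis (fst \<omega>) * trig_poly g mask_box \<omega> = trig_poly (\<lambda>p. g (p - (1, 0))) bank_box \<omega>" .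
qed

lemma wavelet_mask_torus:
  assumes i: "i \<in> {1, 2, 3}"
  shows "wavelet_mask a b i (cis s) (cis t) = trig_poly (filter_coeff (mask_coeff a b) i) bank_box (s, t)"
proof -
  define c where "c = mask_coeff a b"
  have c0: "c p = 0" if "p \<notin> mask_box" for p using that by (simp add: c_def mask_coeff_support)
  have 1: "refinement_mask a b (- cis s) (cis t) = trig_poly (\<lambda>p. parity_sign (fst p) * c p) mask_box (s, t)"
    unfolding uminus_cis refinement_mask_torus trig_poly_def cis_lattice_shift c_def by (simp add: mult_ac)
  have 2: "refinement_mask a b (cis s) (- cis t) = trig_poly (\<lambda>p. parity_sign (snd p) * c p) mask_box (s, t)"
    unfolding uminus_cis refinement_mask_torus trig_poly_def cis_lattice_shift c_def by (simp add: mult_ac)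
  have 3: "refinement_mask a b (- cis s) (- cis t) = trig_poly (\<lambda>p. parity_sign (fst p + snd p) * c p) mask_box (s, t)"
    unfolding uminus_cis refinement_mask_torus trig_poly_def cis_lattice_shift c_def parity_sign_mult[symmetric] by (simp add: mult_ac)
  have f: "filter_coeff c 1 = (\<lambda>p. parity_sign (fst p) * c p)"
    "filter_coeff c 2 = (\<lambda>p. (\<lambda>p. parity_sign (snd p) * c p) (p - (1, 0)))"
    "filter_coeff c 3 = (\<lambda>p. (\<lambda>p. parity_sign (fst p + snd p) * c p) (p - (1, 0)))"
    by (auto simp: filter_coeff_def fun_eq_iff)
  show ?thesis
    using i trig_poly_bank(1)[of "\<lambda>p. parity_sign (fst p) * c p" "(s, t)"]
      trig_poly_bank(2)[of "\<lambda>p. parity_sign (snd p) * c p" "(s, t)"]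
      trig_poly_bank(2)[of "\<lambda>p. parity_sign (fst p + snd p) * c p" "(s, t)"]
    unfolding c_def[symmetric] by (auto simp: wavelet_mask_def 1 2 3 f c0 simp del: One_nat_def)
qed

text \<open>The 4 of the refinement equation cancels the 1/4 that comes with the transform of a
  function of \<open>2 *\<^sub>R u\<close>, so the symbol is the plain trigonometric polynomial of
  the coefficients.\<close>

lemma has_fourier_L2_refine_with:
  assumes K: "finite K" and FT: "has_fourier_L2 \<phi> \<Phi>"
  shows "has_fourier_L2 (refine_with h K \<phi>) (\<lambda>\<omega>. trig_poly h K (\<omega> /\<^sub>R 2) * \<Phi> (\<omega> /\<^sub>R 2))"
proof -
  have "has_fourier_L2 (\<lambda>u. \<Sum>p\<in>K. complex_of_real (4 * h p) * \<phi> (2 *\<^sub>R u - lattice_point p))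
      (\<lambda>\<omega>. \<Sum>p\<in>K. complex_of_real (4 * h p) * (complex_of_real (1 / 2\<^sup>2) * (cis (lattice_point p \<bullet> \<omega> / 2) * \<Phi> (\<omega> /\<^sub>R 2))))"
    by (intro has_fourier_L2_sum has_fourier_L2_scale has_fourier_L2_affine K FT) auto
  moreover have "(\<Sum>p\<in>K. complex_of_real (4 * h p) * (complex_of_real (1 / 2\<^sup>2) * (cis (lattice_point p \<bullet> \<omega> / 2) * \<Phi> (\<omega> /\<^sub>R 2))))
      = trig_poly h K (\<omega> /\<^sub>R 2) * \<Phi> (\<omega> /\<^sub>R 2)" for \<omega>
    unfolding trig_poly_def sum_distrib_right by (intro sum.cong refl) simp
  ultimately show ?thesis by (simp add: refine_with_def[abs_def])
qed

lemma cmod_cis_diff_le: "cmod (cis x - cis y) \<le> \<bar>x - y\<bar>"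
proof -
  have "cis x - cis y = cis y * (cis (x - y) - 1)"
    by (simp add: right_diff_distrib cis_mult)
  then have "cmod (cis x - cis y) = cmod (cis (x - y) - 1)" by (simp add: norm_mult)
  also have "\<dots> \<le> \<bar>x - y\<bar>"
    using iexp_approx1[of "x - y" 0] by (simp add: cis_conv_exp)
  finally show ?thesis .
qed

lemma trig_poly_lipschitz:
  "cmod (trig_poly c K \<omega> - trig_poly c K \<eta>) \<le> (\<Sum>p\<in>K. \<bar>c p\<bar> * norm (lattice_point p)) * norm (\<omega> - \<eta>)"
proof -
  have "cmod (trig_poly c K \<omega> - trig_poly c K \<eta>)
      \<le> (\<Sum>p\<in>K. cmod (complex_of_real (c p) * (cis (lattice_point p \<bullet> \<omega>) - cis (lattice_point p \<bullet> \<eta>))))"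
    unfolding trig_poly_def sum_subtractf[symmetric] right_diff_distrib[symmetric] by (rule norm_sum)
  also have "\<dots> \<le> (\<Sum>p\<in>K. \<bar>c p\<bar> * norm (lattice_point p) * norm (\<omega> - \<eta>))"
  proof (rule sum_mono)
    fix p
    have "cmod (cis (lattice_point p \<bullet> \<omega>) - cis (lattice_point p \<bullet> \<eta>)) \<le> \<bar>lattice_point p \<bullet> (\<omega> - \<eta>)\<bar>"
      unfolding inner_diff_right by (rule cmod_cis_diff_le)
    also have "\<dots> \<le> norm (lattice_point p) * norm (\<omega> - \<eta>)" by (rule Cauchy_Schwarz_ineq2)
    finally show "cmod (complex_of_real (c p) * (cis (lattice_point p \<bullet> \<omega>) - cis (lattice_point p \<bullet> \<eta>)))
        \<le> \<bar>c p\<bar> * norm (lattice_point p) * norm (\<omega> - \<eta>)"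
      by (simp add: norm_mult mult_left_mono mult.assoc)
  qed
  finally show ?thesis by (simp add: sum_distrib_right)
qed

section \<open>The scaling function and the wavelets of a quadrature mask\<close>

context qmf_mask
begin

abbreviation "M \<equiv> trig_poly (mask_coeff a b) mask_box"

text \<open>The summand 1 secures positivity, which the radius \<open>1 / (2 * L)\<close> relies
  on.\<close>

definition lipschitz_const :: real where
  "lipschitz_const = 1 + (\<Sum>p\<in>mask_box. \<bar>c p\<bar> * norm (lattice_point p))"

lemma M_eq: "M \<omega> = refinement_mask a b (cis (fst \<omega>)) (cis (snd \<omega>))"
  by (simp add: refinement_mask_torus)

sublocale product: refinement_product M lipschitz_const
proof
  have "continuous_on UNIV M"
    unfolding trig_poly_def by (intro continuous_intros)
  then show "M \<in> borel_measurable borel" by (rule borel_measurable_continuous_onI)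
  show "M 0 = 1" using mask_1 by (simp add: M_eq)
  show qmf: "(cmod (M \<omega>))\<^sup>2 + (cmod (M (\<omega> + (0, pi))))\<^sup>2 + (cmod (M (\<omega> + (pi, 0))))\<^sup>2 + (cmod (M (\<omega> + (pi, pi))))\<^sup>2 = 1" for \<omega>
    using mask_qmf[of "cis (fst \<omega>)" "cis (snd \<omega>)"] unfolding M_eq uminus_cis by (simp add: add_ac)
  \<comment> \<open>The quadrature identity bounds each of its four nonnegative terms by 1.\<close>
  show "cmod (M \<omega>) \<le> 1" for \<omega>
  proof -
    have "(cmod (M \<omega>))\<^sup>2 \<le> 1\<^sup>2"
      using qmf[of \<omega>] zero_le_power2[of "cmod (M (\<omega> + (0, pi)))"] zero_le_power2[of "cmod (M (\<omega> + (pi, 0)))"]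
        zero_le_power2[of "cmod (M (\<omega> + (pi, pi)))"] unfolding power_one by linarith
    then show ?thesis by (rule power2_le_imp_le) simp
  qed
  have "0 \<le> (\<Sum>p\<in>mask_box. \<bar>c p\<bar> * norm (lattice_point p))" by (intro sum_nonneg) auto
  then show "lipschitz_const > 0" by (simp add: lipschitz_const_def)
  show "cmod (M \<omega> - M \<eta>) \<le> lipschitz_const * norm (\<omega> - \<eta>)" for \<omega> \<eta>
    using trig_poly_lipschitz[of c mask_box \<omega> \<eta>] by (simp add: lipschitz_const_def distrib_right add_increasing)
  show "M (\<omega> + (2 * pi, 0)) = M \<omega>" "M (\<omega> + (0, 2 * pi)) = M \<omega>" for \<omega>
    unfolding M_eq by (simp_all add: cis_mult[symmetric])
qed

lemma scaling_hat_eq: "scaling_hat a b = product.full_product"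
proof
  fix \<omega>
  have "fst (\<omega> /\<^sub>R r) = fst \<omega> / r" "snd (\<omega> /\<^sub>R r) = snd \<omega> / r" for r
    by (simp_all add: divide_inverse mult.commute)
  then show "scaling_hat a b \<omega> = product.full_product \<omega>"
    unfolding product.full_product_def M_eq scaling_hat_def cis_conv_exp by (simp only:)
qed

lemma wavelet_hat_eq:
  assumes "i \<in> {1, 2, 3}"
  shows "wavelet_hat a b i = (\<lambda>\<omega>. trig_poly (filter_coeff c i) bank_box (\<omega> /\<^sub>R 2) * scaling_hat a b (\<omega> /\<^sub>R 2))"
proof
  fix \<omega> :: "real \<times> real"
  have half: "\<omega> /\<^sub>R 2 = (fst \<omega> / 2, snd \<omega> / 2)" by (cases \<omega>) simp
  show "wavelet_hat a b i \<omega> = trig_poly (filter_coeff c i) bank_box (\<omega> /\<^sub>R 2) * scaling_hat a b (\<omega> /\<^sub>R 2)"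
    unfolding wavelet_hat_def half cis_conv_exp[symmetric] wavelet_mask_torus[OF assms] ..
qed

lemma scaling_refinement:
  assumes "has_fourier_L2 \<phi> (scaling_hat a b)"
  shows "AE u in lborel. \<phi> u = refine_with (filter_coeff c 0) bank_box \<phi> u"
proof (rule has_fourier_L2_unique[OF assms])
  have "filter_coeff c 0 = c" by (simp add: filter_coeff_def fun_eq_iff)
  then have "trig_poly (filter_coeff c 0) bank_box \<omega> = M \<omega>" for \<omega>
    using trig_poly_bank(1)[of c \<omega>] by (simp add: mask_coeff_support)
  then have "(\<lambda>\<omega>. trig_poly (filter_coeff c 0) bank_box (\<omega> /\<^sub>R 2) * scaling_hat a b (\<omega> /\<^sub>R 2)) = scaling_hat a b"
    unfolding scaling_hat_eq by (simp only: product.full_product_refine[symmetric])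
  then show "has_fourier_L2 (refine_with (filter_coeff c 0) bank_box \<phi>) (scaling_hat a b)"
    using has_fourier_L2_refine_with[OF finite_K assms, of "filter_coeff c 0"] by simp
qed

text \<open>The prescribed transforms determine each \<open>\<psi> i\<close> almost everywhere as
  the refinement of \<open>\<phi>\<close> by filter \<open>i\<close>, so the frame theorem applies
  to every choice of representatives.\<close>

lemma wavelet_frame:
  assumes FT: "has_fourier_L2 \<phi> (scaling_hat a b)"
    and psi: "\<And>i. i \<in> {1, 2, 3} \<Longrightarrow> has_fourier_L2 (\<psi> i) (wavelet_hat a b i)"
  shows "tight_frame_L2 ({1, 2, 3} \<times> UNIV \<times> UNIV) (wavelet_system \<psi>)"
proof -
  interpret frame: refinable_frame "filter_coeff c" bank_box \<phi> "scaling_hat a b"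
    by unfold_locales
      (use FT scaling_refinement[OF FT] in \<open>auto simp: scaling_hat_eq product.full_product_le product.full_product_lim\<close>)
  show ?thesis
  proof (rule frame.tight_frame)
    fix i :: nat assume i: "i \<in> {1, 2, 3}"
    show "\<psi> i \<in> L2" using psi[OF i] by (rule has_fourier_L2_L2)
    have "has_fourier_L2 (refine_with (filter_coeff c i) bank_box \<phi>) (wavelet_hat a b i)"
      unfolding wavelet_hat_eq[OF i] by (rule has_fourier_L2_refine_with[OF finite_K FT])
    then show "AE u in lborel. \<psi> i u = refine_with (filter_coeff c i) bank_box \<phi> u"
      by (rule has_fourier_L2_unique[OF psi[OF i]])
  qed
qed

lemma wavelets_exist:
  assumes FT: "has_fourier_L2 \<phi> (scaling_hat a b)"
  shows "\<exists>\<psi>. \<forall>i\<in>{1, 2, 3}. has_fourier_L2 (\<psi> i) (wavelet_hat a b i)"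
  using has_fourier_L2_refine_with[OF finite_K FT]
  by (intro exI[of _ "\<lambda>i. refine_with (filter_coeff c i) bank_box \<phi>"]) (simp add: wavelet_hat_eq)

text \<open>The contradiction is with normalisation, not orthogonality: a unit vector
  \<open>\<phi>\<close> would have a transform of mass exactly 4 pi^2.\<close>

lemma not_orthonormal_if_cycle:
  assumes FT: "has_fourier_L2 \<phi> (scaling_hat a b)"
    and \<theta>: "\<theta> \<noteq> 0" "\<bar>fst \<theta>\<bar> < pi" "\<bar>snd \<theta>\<bar> < pi" "\<And>j. cmod (M (2 ^ j *\<^sub>R \<theta>)) = 1"
  shows "\<not> orthonormal_set_L2 (range (translate \<phi>))"
proof
  assume orth: "orthonormal_set_L2 (range (translate \<phi>))"
  have t0: "translate \<phi> 0 = \<phi>" by (simp add: translate_def lattice_point_def fun_eq_iff flip: zero_prod_def)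
  have "translate \<phi> 0 \<in> range (translate \<phi>)" by (rule rangeI)
  then have "L2_inner \<phi> \<phi> = 1" using orth unfolding orthonormal_set_L2_def t0 by blast
  then have "(L2_norm \<phi>)\<^sup>2 = 1" unfolding L2_inner_self using of_real_eq_1_iff by blast
  then have "L2_mass (scaling_hat a b) = ennreal (4 * pi\<^sup>2)"
    using plancherel_L2[OF FT] has_fourier_L2_L2(2)[OF FT] by (simp add: L2_mass_eq)
  then show False
    using product.full_product_mass_less[OF \<theta>] by (simp add: scaling_hat_eq)
qed

end

section \<open>Unimodular cycles on the axes\<close>

text \<open>At a primitive eighth root of unity \<open>x ^ 4 = - 1\<close>, so \<open>p x\<close>
  and \<open>p (- x)\<close> are multiples of \<open>C0 - C1\<close>. The quadrature identity
  becomes 4 (C0 - C1)^2 = 1 = 4 (C0 + C1)^2, whence C0 C1 = 0. Of the survivors, (1 + x^5) / 2 is 1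
  at fifth roots of unity and (x + x^4) / 2 equals x at cube roots.\<close>

lemma univariate_cycle:
  fixes p :: "complex \<Rightarrow> complex" and C0 C1 :: real
  assumes p: "\<And>x. p x = complex_of_real C0 * (1 + x ^ 5) + complex_of_real C1 * (x + x ^ 4)"
    and p1: "p 1 = 1"
    and qmf: "\<And>x. cmod x = 1 \<Longrightarrow> (cmod (p x))\<^sup>2 + (cmod (p (- x)))\<^sup>2 = 1"
  shows "\<exists>N\<in>{3, 5}. \<forall>x. x ^ N = 1 \<longrightarrow> cmod (p x) = 1"
proof -
  have "complex_of_real (2 * C0 + 2 * C1) = complex_of_real 1"
    using p1 unfolding p by (simp add: algebra_simps)
  then have s: "2 * C0 + 2 * C1 = 1" using of_real_eq_iff by blast
  define x where "x = cis (pi / 4)"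
  have x4: "x ^ 4 = - 1" unfolding x_def Complex.DeMoivre by simp
  then have x5: "x ^ 5 = - x" by (simp add: numeral_eq_Suc)
  have px: "p x = complex_of_real (C0 - C1) * (1 - x)" "p (- x) = complex_of_real (C0 - C1) * (1 + x)"
    unfolding p by (simp_all add: x4 x5 algebra_simps)
  have "(cmod (1 - x))\<^sup>2 + (cmod (1 + x))\<^sup>2 = 4"
  proof -
    have "(Re x)\<^sup>2 + (Im x)\<^sup>2 = 1" by (simp add: x_def)
    then show ?thesis unfolding cmod_power2 by (simp add: power2_eq_square algebra_simps)
  qed
  moreover have "(C0 - C1)\<^sup>2 * ((cmod (1 - x))\<^sup>2 + (cmod (1 + x))\<^sup>2) = 1"
    using qmf[of x] unfolding px norm_mult norm_of_real by (simp add: x_def power_mult_distrib distrib_left)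
  ultimately have "(2 * (C0 - C1))\<^sup>2 = (2 * C0 + 2 * C1)\<^sup>2" using s by (simp add: power2_eq_square algebra_simps)
  then have "C0 * C1 = 0" by (simp add: power2_eq_square algebra_simps)
  then consider "C0 = 0" "C1 = 1 / 2" | "C1 = 0" "C0 = 1 / 2" using s by fastforce
  then show ?thesis
  proof cases
    case 1
    have "cmod (p z) = 1" if z: "z ^ 3 = 1" for z
    proof -
      have "cmod z ^ 3 = 1 ^ 3" using arg_cong[OF z, of cmod] by (simp add: norm_power)
      then have "cmod z = 1" by (rule power_eq_imp_eq_base) auto
      moreover have "z ^ 4 = z" using z by (simp add: numeral_eq_Suc mult_ac)
      ultimately show ?thesis unfolding p by (simp add: 1)
    qed
    then show ?thesis by auto
  next
    case 2
    have "cmod (p z) = 1" if z: "z ^ 5 = 1" for z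
      unfolding p by (simp add: 2 z)
    then show ?thesis by auto
  qed
qed

text \<open>Doubling the angle squares a root of unity, so the whole doubling orbit consists of
  \<open>N\<close>-th roots.\<close>

lemma cis_root: "N > 0 \<Longrightarrow> cis (2 ^ j * (2 * pi / real N)) ^ N = 1"
proof -
  assume "N > 0"
  then have "cis (2 ^ j * (2 * pi / real N)) ^ N = cis (2 * pi * 2 ^ j)"
    unfolding Complex.DeMoivre by (simp add: mult_ac)
  also have "\<dots> = 1" by (rule cis_multiple_2pi) simp
  finally show ?thesis .
qed

lemma
  shows refinement_mask_on_x_axis: "refinement_mask a b x 1 =
      complex_of_real (a 0 + b 8 + a 3 + b 5 + a 6 + b 2) * (1 + x ^ 5)
      + complex_of_real (b 0 + a 8 + b 3 + a 5 + b 6 + a 2) * (x + x ^ 4)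
      + complex_of_real (a 1 + b 7 + a 4 + b 4 + a 7 + b 1) * (x ^ 2 + x ^ 3)"
    and refinement_mask_on_y_axis: "refinement_mask a b 1 y =
      complex_of_real (a 0 + b 0 + a 1 + b 1 + a 2 + b 2) * (1 + y ^ 5)
      + complex_of_real (b 8 + a 8 + b 7 + a 7 + b 6 + a 6) * (y + y ^ 4)
      + complex_of_real (a 3 + b 3 + a 4 + b 4 + a 5 + b 5) * (y ^ 2 + y ^ 3)"
  by (simp_all add: refinement_mask_def mask_matrix_def eval_nat_numeral algebra_simps)

text \<open>Vanishing at \<open>y = - 1\<close> makes the alternating sum of each column 0. In the
  column of x^2 the even rows hold \<open>a 1\<close>, \<open>a 4\<close>, \<open>a 7\<close> and
  the odd rows the \<open>b\<close> entries. Hence the coefficient of \<open>x ^ 2 + x ^ 3\<close>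
  on the axis is twice the sum in the hypothesis.\<close>

lemma mask_balanced_x:
  assumes "\<And>x. refinement_mask a b x (- 1) = 0"
  shows "a 1 + a 4 + a 7 = b 1 + b 4 + b 7"
proof -
  define e where "e k = (\<Sum>r<6. (- 1) ^ r * complex_of_real (mask_matrix a b ! r ! k))" for k
  have "(\<Sum>k\<le>5. e k * x ^ k) = 0" for x
  proof -
    have "(\<Sum>k\<le>5. e k * x ^ k) = (\<Sum>k<6. \<Sum>r<6. (- 1) ^ r * complex_of_real (mask_matrix a b ! r ! k) * x ^ k)"
      unfolding e_def sum_distrib_right by (intro sum.cong) auto
    also have "\<dots> = refinement_mask a b x (- 1)"
      unfolding refinement_mask_def by (rule sum.swap)
    finally show ?thesis using assms by simp
  qed
  then have "e 2 = 0" by (rule zero_polynom_imp_zero_coeffs) simp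
  then have "complex_of_real (a 1 - b 7 + a 4 - b 4 + a 7 - b 1) = complex_of_real 0"
    by (simp add: e_def mask_matrix_def eval_nat_numeral)
  then have "a 1 - b 7 + a 4 - b 4 + a 7 - b 1 = 0" using of_real_eq_iff by blast
  then show ?thesis by simp
qed

lemma mask_balanced_y:
  assumes "\<And>y. refinement_mask a b (- 1) y = 0"
  shows "a 3 + a 4 + a 5 = b 3 + b 4 + b 5"
proof -
  define e where "e r = (\<Sum>k<6. (- 1) ^ k * complex_of_real (mask_matrix a b ! r ! k))" for r
  have "(\<Sum>r\<le>5. e r * y ^ r) = 0" for y
  proof -
    have "(\<Sum>r\<le>5. e r * y ^ r) = refinement_mask a b (- 1) y"
      unfolding e_def sum_distrib_right refinement_mask_def by (intro sum.cong) (auto simp: mult_ac)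
    then show ?thesis using assms by simp
  qed
  then have "e 2 = 0" by (rule zero_polynom_imp_zero_coeffs) simp
  then have "complex_of_real (a 3 - b 3 + a 4 - b 4 + a 5 - b 5) = complex_of_real 0"
    by (simp add: e_def mask_matrix_def eval_nat_numeral)
  then have "a 3 - b 3 + a 4 - b 4 + a 5 - b 5 = 0" using of_real_eq_iff by blast
  then show ?thesis by simp
qed

context qmf_mask
begin

text \<open>On the axis \<open>y = 1\<close> the two quadrature terms with \<open>- y\<close>
  vanish, so the restriction satisfies a one-variable quadrature identity, and the zero sum removes
  its middle coefficient. The angle \<open>2 * pi / N\<close> with \<open>N\<close> at least 3 lies
  strictly inside (-pi, pi). The other axis is symmetric.\<close>

lemma cycle_exists:
  assumes zero: "\<And>x. refinement_mask a b x (- 1) = 0" "\<And>y. refinement_mask a b (- 1) y = 0"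
    and cond: "a 1 + a 4 + a 7 = 0 \<or> a 3 + a 4 + a 5 = 0"
  shows "\<exists>\<theta>. \<theta> \<noteq> 0 \<and> \<bar>fst \<theta>\<bar> < pi \<and> \<bar>snd \<theta>\<bar> < pi \<and> (\<forall>j. cmod (M (2 ^ j *\<^sub>R \<theta>)) = 1)"
  using cond
proof
  assume cx: "a 1 + a 4 + a 7 = 0"
  have C2: "a 1 + b 7 + a 4 + b 4 + a 7 + b 1 = 0" using cx mask_balanced_x[OF zero(1)] by simp
  have "\<exists>N\<in>{3, 5}. \<forall>x. x ^ N = 1 \<longrightarrow> cmod (refinement_mask a b x 1) = 1"
  proof (rule univariate_cycle)
    show "refinement_mask a b x 1 = complex_of_real (a 0 + b 8 + a 3 + b 5 + a 6 + b 2) * (1 + x ^ 5)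
      + complex_of_real (b 0 + a 8 + b 3 + a 5 + b 6 + a 2) * (x + x ^ 4)" for x
      unfolding refinement_mask_on_x_axis C2 by simp
    show "(cmod (refinement_mask a b x 1))\<^sup>2 + (cmod (refinement_mask a b (- x) 1))\<^sup>2 = 1" if "cmod x = 1" for x
      using mask_qmf[OF that, of 1] by (simp add: zero)
  qed (rule mask_1)
  then obtain N where N: "N \<in> {3, 5}" "\<And>x. x ^ N = 1 \<Longrightarrow> cmod (refinement_mask a b x 1) = 1" by blast
  then have N3: "real N \<ge> 3" by auto
  show ?thesis
  proof (intro exI[of _ "(2 * pi / real N, 0)"] conjI allI)
    show "(2 * pi / real N, 0) \<noteq> 0" using N3 by (simp add: zero_prod_def)
    show "\<bar>fst (2 * pi / real N, 0)\<bar> < pi" using N3 by (simp add: field_simps)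
    show "cmod (M (2 ^ j *\<^sub>R (2 * pi / real N, 0))) = 1" for j
      unfolding M_eq using N(2)[OF cis_root] N3 by simp
  qed simp
next
  assume cy: "a 3 + a 4 + a 5 = 0"
  have C2: "a 3 + b 3 + a 4 + b 4 + a 5 + b 5 = 0" using cy mask_balanced_y[OF zero(2)] by simp
  have "\<exists>N\<in>{3, 5}. \<forall>y. y ^ N = 1 \<longrightarrow> cmod (refinement_mask a b 1 y) = 1"
  proof (rule univariate_cycle)
    show "refinement_mask a b 1 y = complex_of_real (a 0 + b 0 + a 1 + b 1 + a 2 + b 2) * (1 + y ^ 5)
      + complex_of_real (b 8 + a 8 + b 7 + a 7 + b 6 + a 6) * (y + y ^ 4)" for y
      unfolding refinement_mask_on_y_axis C2 by simp
    show "(cmod (refinement_mask a b 1 y))\<^sup>2 + (cmod (refinement_mask a b 1 (- y)))\<^sup>2 = 1" if "cmod y = 1" for y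
      using mask_qmf[OF _ that, of 1] by (simp add: zero)
  qed (rule mask_1)
  then obtain N where N: "N \<in> {3, 5}" "\<And>y. y ^ N = 1 \<Longrightarrow> cmod (refinement_mask a b 1 y) = 1" by blast
  then have N3: "real N \<ge> 3" by auto
  show ?thesis
  proof (intro exI[of _ "(0, 2 * pi / real N)"] conjI allI)
    show "(0, 2 * pi / real N) \<noteq> 0" using N3 by (simp add: zero_prod_def)
    show "\<bar>snd (0, 2 * pi / real N)\<bar> < pi" using N3 by (simp add: field_simps)
    show "cmod (M (2 ^ j *\<^sub>R (0, 2 * pi / real N))) = 1" for j
      unfolding M_eq using N(2)[OF cis_root] N3 by simp
  qed simp
qed

end

theorem mainTheorem3:
  fixes a b :: "nat \<Rightarrow> real" and \<phi> :: "real \<times> real \<Rightarrow> complex"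
  assumes "refinement_mask a b 1 1 = 1"
    and "\<And>x y :: complex. cmod x = 1 \<Longrightarrow> cmod y = 1 \<Longrightarrow>
      (cmod (refinement_mask a b x y))\<^sup>2 + (cmod (refinement_mask a b (- x) y))\<^sup>2
        + (cmod (refinement_mask a b x (- y)))\<^sup>2 + (cmod (refinement_mask a b (- x) (- y)))\<^sup>2 = 1"
    and "\<And>x y :: complex. x \<noteq> 0 \<Longrightarrow> y \<noteq> 0 \<Longrightarrow>
      refinement_mask a b (1 / x) (1 / y) = x powi (- 5) * y powi (- 5) * refinement_mask a b x y"
    and "\<exists>mt. bivariate_polynomial mt \<and> (\<forall>x y. refinement_mask a b x y = (x + 1) * (y + 1) * mt x y)"
    and "(a 1 + a 4 + a 7 = 1 / 4 \<and> a 3 + a 4 + a 5 = 0) \<or>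
         (a 1 + a 4 + a 7 = 0 \<and> a 3 + a 4 + a 5 = 1 / 4) \<or>
         (a 1 + a 4 + a 7 = 0 \<and> a 3 + a 4 + a 5 = 0)"
    and "has_fourier_L2 \<phi> (scaling_hat a b)"
  shows "\<not> orthonormal_set_L2 (range (translate \<phi>)) \<and>
    (\<exists>\<psi>. \<forall>i\<in>{1, 2, 3}. has_fourier_L2 (\<psi> i) (wavelet_hat a b i)) \<and>
    (\<forall>\<psi>. (\<forall>i\<in>{1, 2, 3}. has_fourier_L2 (\<psi> i) (wavelet_hat a b i)) \<longrightarrow>
      tight_frame_L2 ({1, 2, 3} \<times> UNIV \<times> UNIV) (wavelet_system \<psi>))"
proof -
  interpret qmf_mask a b
    by unfold_locales (fact assms(1), fact assms(2))
  have zero: "refinement_mask a b x (- 1) = 0" "refinement_mask a b (- 1) y = 0" for x y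
    using assms(4) by auto
  \<comment> \<open>Each of the three alternatives contains one of the two vanishing sums.\<close>
  obtain \<theta> where \<theta>: "\<theta> \<noteq> 0" "\<bar>fst \<theta>\<bar> < pi" "\<bar>snd \<theta>\<bar> < pi" "\<And>j. cmod (M (2 ^ j *\<^sub>R \<theta>)) = 1"
    using cycle_exists[OF zero] assms(5) by blast
  show ?thesis
  proof (intro conjI allI impI)
    show "\<not> orthonormal_set_L2 (range (translate \<phi>))"
      by (rule not_orthonormal_if_cycle[OF assms(6) \<theta>])
    show "\<exists>\<psi>. \<forall>i\<in>{1, 2, 3}. has_fourier_L2 (\<psi> i) (wavelet_hat a b i)"
      by (rule wavelets_exist[OF assms(6)])
    show "tight_frame_L2 ({1, 2, 3} \<times> UNIV \<times> UNIV) (wavelet_system \<psi>)"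
      if "\<forall>i\<in>{1, 2, 3}. has_fourier_L2 (\<psi> i) (wavelet_hat a b i)" for \<psi>
      using that by (intro wavelet_frame[OF assms(6)]) blast
  qed
qed

end
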